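(* Let $n \geqslant k \geqslant 3$ be natural numbers. Then: (i) If $k$ is even, then $d_k(S_n)=2$. Moreover, $d_k(A_n)=2$ unless either $k \in \{n-1,n\}$ and $k$ is a power of $2$, or $(n,k)=(6,6)$. (ii) If $k$ is odd, then $d_k(A_n)=2$, except when $n=3$, in which case $d_3(A_3)=1$.
   Context: For a positive integer $k$ and a group $G$ that is generated by finitely many elements of order $k$, $d_k(G)$ denotes the smallest cardinality of a generating set of $G$ all of whose elements have order exactly $k$. $S_n$ and $A_n$ denote the symmetric and alternating groups on $\{1,\dots,n\}$. *)

theory Defs
  imports "HOL-Algebra.Algebra"
begin

definition order_k_gen_set :: "nat \<Rightarrow> ('a, 'b) monoid_scheme \<Rightarrow> 'a set \<Rightarrow> bool" where
  "order_k_gen_set k G S \<longleftrightarrow> finite S \<and> S \<subseteq> carrier G \<and>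
     (\<forall>x\<in>S. group.ord G x = k) \<and> generate G S = carrier G"

definition d_gen :: "nat \<Rightarrow> ('a, 'b) monoid_scheme \<Rightarrow> nat" where
  "d_gen k G = (if \<exists>S. order_k_gen_set k G S
     then (LEAST m. \<exists>S. order_k_gen_set k G S \<and> card S = m) else 0)"

end

theory Submission
  imports Defs
begin

text \<open>
  Two elements \<open>a\<close>, \<open>b\<close> of order \<open>k\<close> that generate a transitive group containing a 3-cycle, and that
  each map some point of that 3-cycle into it, generate all 3-cycles: the maximal set carrying all its
  3-cycles is moved off itself or fixed by every group element, so it absorbs everything reachable.
  The parities of \<open>a\<close> and \<open>b\<close> then decide between the alternating and the symmetric group.

  The 3-cycle comes from a commutator of two permutations whose supports meet in one point, or that
  disagree at few points. For \<open>k\<close> odd, a pair on few points is extended \<open>k\<close> points at a time by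
  attaching a \<open>k\<close>-cycle to each generator so that a 4th power of \<open>a\<^sup>-\<^sup>1 b\<close> is not affected. For \<open>k\<close>
  even and \<open>n \<ge> 2 k - 1\<close>, two \<open>k\<close>-cycles with one common point are enough, since disjoint
  transpositions adjust transitivity and parity and vanish in the squares; for \<open>k + 2 \<le> n \<le> 2 k - 2\<close>
  a transposition is multiplied onto \<open>k\<close>-cycles sharing many points. For \<open>n \<in> {k, k + 1}\<close> and \<open>A\<^sub>n\<close>
  one writes \<open>k = 2\<^sup>\<alpha> m\<close> with \<open>m\<close> odd and uses products of a \<open>k/2\<close>-cycle and a \<open>2\<^sup>\<alpha>\<close>-cycle, which
  needs \<open>m > 1\<close> and \<open>k \<noteq> 6\<close>. For \<open>k = 3\<close> the product \<open>a b\<close> is arranged to have one 3-cycle, one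
  cycle of length prime to 3 and otherwise involutions, so that a power of it is a 3-cycle.
\<close>

text \<open>The criterion is in the spirit of Jordan's theorem on primitive groups containing a
  3-cycle, but only one maximal set has to be controlled instead of proving primitivity. The parity
  of \<open>k\<close> decides what can be added for free. For even \<open>k\<close> a disjoint
  transposition changes neither the order nor the square, so it can join distant points and set the
  parity. For odd \<open>k\<close> the parity is automatic, but only cycles of length dividing
  \<open>k\<close> are available, so distant points are reached by whole \<open>k\<close>-cycles. A
  link in such a chain inserts two new points into \<open>inv' a \<circ> b\<close> at two points
  that it fixes or swaps; this makes two transpositions or one 4-cycle, hence the exponent 4. The
  next link needs two further points of the new cycle, hence \<open>k \<ge> 4\<close>, and
  \<open>k = 3\<close> gets an invariant of its own. The exceptions for A_n come from missing
  elements: if \<open>k\<close> is a power of 2 and \<open>n\<close> is \<open>k\<close> or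
  \<open>k + 1\<close>, an element of order \<open>k\<close> is a \<open>k\<close>-cycle and
  therefore odd; the elements of order 6 in S_6 are 6-cycles and products of a 3-cycle and a
  transposition, all odd.\<close>

section \<open>3-cycles, generated sets of permutations and the generation criterion\<close>

definition cyc3 :: "'a \<Rightarrow> 'a \<Rightarrow> 'a \<Rightarrow> 'a \<Rightarrow> 'a" where
  "cyc3 x y z w = (if w = x then y else if w = y then z else if w = z then x else w)"

lemma cyc3_apply:
  assumes "distinct [x, y, z]"
  shows "cyc3 x y z x = y" "cyc3 x y z y = z" "cyc3 x y z z = x"
    "w \<noteq> x \<Longrightarrow> w \<noteq> y \<Longrightarrow> w \<noteq> z \<Longrightarrow> cyc3 x y z w = w"
  using assms by (auto simp: cyc3_def)

lemma cyc3_eqI: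
  assumes "distinct [x, y, z]" "f x = y" "f y = z" "f z = x"
    and "\<And>w. w \<noteq> x \<Longrightarrow> w \<noteq> y \<Longrightarrow> w \<noteq> z \<Longrightarrow> f w = w"
  shows "f = cyc3 x y z"
  using assms by (auto simp: cyc3_def fun_eq_iff)

lemma cyc3_cycle_of_list: "distinct [x, y, z] \<Longrightarrow> cycle_of_list [x, y, z] = cyc3 x y z"
  by (rule cyc3_eqI) (auto simp: transpose_def)

lemma cyc3_rotate: "distinct [x, y, z] \<Longrightarrow> cyc3 y z x = cyc3 x y z"
  by (auto simp: cyc3_def fun_eq_iff)

lemma cyc3_bij: "distinct [x, y, z] \<Longrightarrow> bij (cyc3 x y z)"
  using permutation_bijective[OF permutation_of_cycle[of "[x, y, z]"]] cyc3_cycle_of_list by metis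

lemma inv_cyc3:
  assumes "distinct [x, y, z]"
  shows "inv' (cyc3 x y z) = cyc3 y x z"
proof -
  have "cyc3 x y z \<circ> cyc3 y x z = id" "cyc3 y x z \<circ> cyc3 x y z = id"
    using assms by (auto simp: cyc3_def fun_eq_iff)
  then show ?thesis
    using inv_unique_comp by blast
qed

lemma conj_cyc3:
  assumes "distinct [x, y, z]" "bij p"
  shows "p \<circ> cyc3 x y z \<circ> inv' p = cyc3 (p x) (p y) (p z)"
proof -
  have "distinct [p x, p y, p z]"
    using assms(1) inj_eq[OF bij_is_inj[OF assms(2)]] by simp
  moreover have "p \<circ> cycle_of_list [x, y, z] \<circ> inv' p = cycle_of_list (map p [x, y, z])"
    by (rule conjugation_of_cycle[OF assms])
  ultimately show ?thesis
    using cyc3_cycle_of_list[OF assms(1)] cyc3_cycle_of_list[of "p x" "p y" "p z"]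
    by (simp only: list.map)
qed

text \<open>Generation is phrased for bare functions, without carrier or group structure. The pairs
  can then live on any finite set, and groups enter only in the final passage to
  \<open>sym_group\<close> and \<open>alt_group\<close>.\<close>

inductive_set perm_span :: "('a \<Rightarrow> 'a) set \<Rightarrow> ('a \<Rightarrow> 'a) set" for S where
  one: "id \<in> perm_span S"
| gen: "f \<in> S \<Longrightarrow> f \<in> perm_span S"
| comp: "f \<in> perm_span S \<Longrightarrow> g \<in> perm_span S \<Longrightarrow> f \<circ> g \<in> perm_span S"
| inv: "f \<in> perm_span S \<Longrightarrow> inv' f \<in> perm_span S"

lemma perm_span_permutes:
  assumes "\<And>f. f \<in> S \<Longrightarrow> f permutes \<Omega>" "g \<in> perm_span S"
  shows "g permutes \<Omega>"
  using assms(2)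
proof induction
  case one
  show ?case by (rule permutes_id)
next
  case (comp f g)
  then show ?case by (intro permutes_compose)
qed (use assms(1) permutes_inv in blast)+

lemma perm_span_funpow:
  assumes "f \<in> perm_span S"
  shows "f ^^ i \<in> perm_span S"
proof (induction i)
  case 0
  show ?case unfolding funpow.simps by (rule perm_span.one)
next
  case (Suc i)
  show ?case unfolding funpow.simps by (rule perm_span.comp[OF assms Suc])
qed

lemma perm_span_conj:
  "f \<in> perm_span S \<Longrightarrow> g \<in> perm_span S \<Longrightarrow> g \<circ> f \<circ> inv' g \<in> perm_span S"
  by (intro perm_span.comp perm_span.inv)

lemma perm_span_subset:
  assumes "\<And>f. f \<in> S \<Longrightarrow> f \<in> perm_span T" "g \<in> perm_span S"
  shows "g \<in> perm_span T"
  using assms(2)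
proof induction
  case one
  show ?case by (rule perm_span.one)
next
  case (gen f)
  then show ?case by (rule assms(1))
next
  case (comp f g)
  show ?case by (rule perm_span.comp[OF comp.IH])
next
  case (inv f)
  show ?case by (rule perm_span.inv[OF inv.IH])
qed

definition has_three_cycles :: "('a \<Rightarrow> 'a) set \<Rightarrow> 'a set \<Rightarrow> bool" where
  "has_three_cycles G D \<longleftrightarrow>
     (\<forall>x\<in>D. \<forall>y\<in>D. \<forall>z\<in>D. distinct [x, y, z] \<longrightarrow> cyc3 x y z \<in> G)"

lemma has_three_cyclesD:
  "has_three_cycles G D \<Longrightarrow> x \<in> D \<Longrightarrow> y \<in> D \<Longrightarrow> z \<in> D \<Longrightarrow> distinct [x, y, z] \<Longrightarrow> cyc3 x y z \<in> G"
  unfolding has_three_cycles_def by blast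

text \<open>Conjugating \<open>cyc3 u v p\<close> by \<open>cyc3 u v d\<close> gives
  \<open>cyc3 v d p\<close>, and inversion exchanges \<open>u\<close> and \<open>v\<close>. With
  these two moves the single pair \<open>(i, j)\<close> reaches every ordered pair of distinct
  points of \<open>D\<close>.\<close>

lemma has_three_cycles_insert:
  assumes D: "has_three_cycles (perm_span S) D" and p: "p \<notin> D"
    and ij: "i \<in> D" "j \<in> D" "i \<noteq> j" and c: "cyc3 i j p \<in> perm_span S"
  shows "has_three_cycles (perm_span S) (insert p D)"
proof -
  define T where "T u v \<longleftrightarrow> cyc3 u v p \<in> perm_span S" for u v
  have flip: "T v u" if "T u v" "u \<in> D" "v \<in> D" "u \<noteq> v" for u v
  proof -
    have "inv' (cyc3 u v p) = cyc3 v u p"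
      using that p by (intro inv_cyc3) auto
    then show ?thesis
      using perm_span.inv[OF that(1)[unfolded T_def]] unfolding T_def by simp
  qed
  have step: "T v d" if "T u v" "u \<in> D" "v \<in> D" "d \<in> D" "distinct [u, v, d]" for u v d
  proof -
    have "cyc3 u v d \<in> perm_span S"
      using that by (intro has_three_cyclesD[OF D]) auto
    then have "cyc3 u v d \<circ> cyc3 u v p \<circ> inv' (cyc3 u v d) \<in> perm_span S"
      using that(1) unfolding T_def by (intro perm_span_conj)
    also have "cyc3 u v d \<circ> cyc3 u v p \<circ> inv' (cyc3 u v d)
        = cyc3 (cyc3 u v d u) (cyc3 u v d v) (cyc3 u v d p)"
      by (rule conj_cyc3) (use that p in \<open>auto intro!: cyc3_bij\<close>)
    also have "\<dots> = cyc3 v d p"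
    proof -
      have "p \<noteq> u" "p \<noteq> v" "p \<noteq> d" using that p by auto
      then show ?thesis
        by (simp add: cyc3_apply[OF that(5)])
    qed
    finally show ?thesis unfolding T_def .
  qed
  have T_i: "T i v" if "v \<in> D" "v \<noteq> i" for v
  proof (cases "v = j")
    case True
    then show ?thesis using c T_def by simp
  next
    case False
    have "T j i" using flip[of i j] c ij T_def by simp
    then show ?thesis using step[of j i v] that False ij by auto
  qed
  have T: "T u v" if "u \<in> D" "v \<in> D" "u \<noteq> v" for u v
  proof -
    consider "u = i" | "v = i" | "u \<noteq> i" "v \<noteq> i" by blast
    then show ?thesis
    proof cases
      case 1
      then show ?thesis using T_i that by auto
    next
      case 2
      then show ?thesis using flip[of i u] T_i[of u] that by auto
    next
      case 3
      then show ?thesis using step[of i u v] T_i[of u] that ij by auto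
    qed
  qed
  show ?thesis
    unfolding has_three_cycles_def
  proof (intro ballI impI)
    fix x y z assume xyz: "x \<in> insert p D" "y \<in> insert p D" "z \<in> insert p D" "distinct [x, y, z]"
    then consider "x \<in> D" "y \<in> D" "z \<in> D" | "x = p" "y \<in> D" "z \<in> D"
      | "y = p" "x \<in> D" "z \<in> D" | "z = p" "x \<in> D" "y \<in> D"
      unfolding distinct.simps insert_iff list.set by blast
    then show "cyc3 x y z \<in> perm_span S"
    proof cases
      case 1
      then show ?thesis by (intro has_three_cyclesD[OF D]) (use xyz(4) in simp_all)
    next
      case 2
      then have "T y z" using T[of y z] xyz(4) by simp
      then show ?thesis using cyc3_rotate[of p y z] xyz(4) 2(1) unfolding T_def by simp
    next
      case 3
      then have "T z x" using T[of z x] xyz(4) by auto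
      moreover have "cyc3 p z x = cyc3 x p z" "cyc3 z x p = cyc3 p z x"
        using cyc3_rotate[of x p z] cyc3_rotate[of p z x] xyz(4) 3(1) by auto
      ultimately show ?thesis using 3(1) unfolding T_def by simp
    next
      case 4
      then show ?thesis using T[of x y] xyz(4) unfolding T_def by simp
    qed
  qed
qed

lemma has_three_cycles_image:
  assumes D: "has_three_cycles (perm_span S) D" and g: "g \<in> perm_span S" "bij g"
  shows "has_three_cycles (perm_span S) (g ` D)"
  unfolding has_three_cycles_def
proof (intro ballI impI)
  fix x y z assume "x \<in> g ` D" "y \<in> g ` D" "z \<in> g ` D" and d: "distinct [x, y, z]"
  then obtain x' y' z' where xyz: "x = g x'" "y = g y'" "z = g z'" "x' \<in> D" "y' \<in> D" "z' \<in> D"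
    by auto
  then have d': "distinct [x', y', z']" using d by auto
  have "g \<circ> cyc3 x' y' z' \<circ> inv' g \<in> perm_span S"
    using xyz d' g by (intro perm_span_conj has_three_cyclesD[OF D]) auto
  then show "cyc3 x y z \<in> perm_span S"
    using conj_cyc3[OF d' g(2)] xyz by simp
qed

text \<open>A maximal set carrying all its 3-cycles behaves like a block of imprimitivity.\<close>

lemma three_cycle_block:
  assumes fin: "finite \<Omega>" and S: "\<And>f. f \<in> S \<Longrightarrow> f permutes \<Omega>"
    and xyz: "x \<in> \<Omega>" "y \<in> \<Omega>" "z \<in> \<Omega>" "distinct [x, y, z]" and c: "cyc3 x y z \<in> perm_span S"
  obtains D where "{x, y, z} \<subseteq> D" "D \<subseteq> \<Omega>" "has_three_cycles (perm_span S) D"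
    "\<And>g p. g \<in> perm_span S \<Longrightarrow> p \<in> D \<Longrightarrow> g p \<in> D \<Longrightarrow> g ` D \<subseteq> D"
proof -
  define F where "F = {D. {x, y, z} \<subseteq> D \<and> D \<subseteq> \<Omega> \<and> has_three_cycles (perm_span S) D}"
  have "finite F"
    unfolding F_def by (rule finite_subset[of _ "Pow \<Omega>"]) (use fin in auto)
  moreover have "{x, y, z} \<in> F"
  proof -
    have "cyc3 u v w \<in> perm_span S" if "u \<in> {x, y, z}" "v \<in> {x, y, z}" "w \<in> {x, y, z}" "distinct [u, v, w]"
      for u v w
    proof -
      have c': "cyc3 y x z \<in> perm_span S"
        using perm_span.inv[OF c] inv_cyc3[OF xyz(4)] by simp
      have d': "distinct [y, x, z]" using xyz(4) by auto
      have "cyc3 y z x \<in> perm_span S" "cyc3 z x y \<in> perm_span S"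
        "cyc3 x z y \<in> perm_span S" "cyc3 z y x \<in> perm_span S"
        using c c' cyc3_rotate[OF xyz(4)] cyc3_rotate[of y z x] cyc3_rotate[OF d'] cyc3_rotate[of x z y] xyz(4)
        by auto
      then show ?thesis using that c c' by auto
    qed
    then show ?thesis using xyz unfolding F_def has_three_cycles_def by blast
  qed
  ultimately obtain D where D: "D \<in> F" and max: "\<And>E. E \<in> F \<Longrightarrow> D \<subseteq> E \<Longrightarrow> D = E"
    using finite_has_maximal2[of F "{x, y, z}"] by metis
  have D': "{x, y, z} \<subseteq> D" "D \<subseteq> \<Omega>" "has_three_cycles (perm_span S) D"
    using D unfolding F_def by auto
  have finD: "finite D" using D' fin finite_subset by blast
  have "card {x, y, z} \<le> card D" by (rule card_mono) (use D' finD in auto)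
  then have cardD: "card D \<ge> 3" using xyz(4) by auto
  have add: "q \<in> D" if "q \<in> \<Omega>" "i \<in> D" "j \<in> D" "i \<noteq> j" "cyc3 i j q \<in> perm_span S" for i j q
  proof (rule ccontr)
    assume "q \<notin> D"
    then have "has_three_cycles (perm_span S) (insert q D)"
      using that by (intro has_three_cycles_insert[OF D'(3)]) auto
    then have "insert q D \<in> F" using D' that unfolding F_def by auto
    then have "D = insert q D" using max[of "insert q D"] by blast
    then show False using \<open>q \<notin> D\<close> by blast
  qed
  have "g ` D \<subseteq> D" if g: "g \<in> perm_span S" "p \<in> D" "g p \<in> D" for g p
  proof
    fix q assume q: "q \<in> g ` D"
    have gp: "g permutes \<Omega>" using perm_span_permutes[OF S g(1)] by blast
    then have bij: "bij g" by (rule permutes_bij)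
    have gD: "has_three_cycles (perm_span S) (g ` D)"
      by (rule has_three_cycles_image[OF D'(3) g(1) bij])
    have gD_sub: "g ` D \<subseteq> \<Omega>" using permutes_image[OF gp] D' by blast
    have card_gD: "card (g ` D) = card D" using bij by (intro card_image) (auto simp: bij_def inj_on_def)
    show "q \<in> D"
    proof (rule ccontr)
      assume qD: "q \<notin> D"
      show False
      proof (cases "\<exists>w. w \<in> g ` D \<and> w \<in> D \<and> w \<noteq> g p")
        \<comment> \<open>With a second common point \<open>w\<close>, the 3-cycle on
          \<open>w\<close>, \<open>g p\<close>, \<open>q\<close> has two points in \<open>D\<close>
          and so adds \<open>q\<close> to it.\<close>
        case True
        then obtain w where w: "w \<in> g ` D" "w \<in> D" "w \<noteq> g p" by blast
        then have "cyc3 w (g p) q \<in> perm_span S"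
          using q g qD by (intro has_three_cyclesD[OF gD]) auto
        then show False using add[of q w "g p"] w g q gD_sub qD by blast
      next
        \<comment> \<open>Now \<open>g p\<close> is the only common point. Conjugating a 3-cycle on
          \<open>g p\<close>, \<open>d\<close>, \<open>d'\<close> by one on \<open>g p\<close>,
          \<open>q\<close>, \<open>q'\<close> replaces just \<open>g p\<close> by \<open>q\<close>,
          which again gives a 3-cycle with two points in \<open>D\<close>.\<close>
        case False
        have "card (g ` D - {g p, q}) \<ge> 1"
          using card_gD cardD diff_card_le_card_Diff[of "{g p, q}" "g ` D"]
          by (simp add: card_insert_if split: if_splits)
        then obtain q' where q': "q' \<in> g ` D" "q' \<noteq> g p" "q' \<noteq> q"
          by (metis DiffE card.empty equals0I insertI1 insertI2 not_one_le_zero)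
        have q'D: "q' \<notin> D" using False q' by blast
        have "card (D - {g p}) \<ge> 2" using cardD g finD by simp
        then obtain d d' where d: "d \<in> D" "d' \<in> D" "distinct [g p, d, d']"
          by (metis DiffD1 DiffD2 card_le_Suc0_iff_eq finD finite_Diff insertI1 distinct_length_2_or_more
              distinct_singleton not_less_eq_eq numeral_2_eq_2)
        have 1: "cyc3 (g p) q q' \<in> perm_span S"
          using q q' g qD by (intro has_three_cyclesD[OF gD]) auto
        have 2: "cyc3 (g p) d d' \<in> perm_span S"
          using d g by (intro has_three_cyclesD[OF D'(3)]) auto
        have dist: "distinct [g p, q, q']" using q' qD g by auto
        have "cyc3 (g p) q q' \<circ> cyc3 (g p) d d' \<circ> inv' (cyc3 (g p) q q') \<in> perm_span S"
          by (intro perm_span_conj 1 2)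
        also have "cyc3 (g p) q q' \<circ> cyc3 (g p) d d' \<circ> inv' (cyc3 (g p) q q') = cyc3 q d d'"
        proof -
          have "d \<noteq> g p" "d \<noteq> q" "d \<noteq> q'" "d' \<noteq> g p" "d' \<noteq> q" "d' \<noteq> q'"
            using d qD q'D by auto
          then show ?thesis
            unfolding conj_cyc3[OF d(3) cyc3_bij[OF dist]] by (simp add: cyc3_apply[OF dist])
        qed
        also have "\<dots> = cyc3 d d' q"
          by (rule cyc3_rotate[symmetric]) (use d qD in auto)
        finally show False using add[of q d d'] d q gD_sub qD by auto
      qed
    qed
  qed
  then show thesis using that[OF D'] by blast
qed

text \<open>Forward closure is enough: for permutations of a finite set it implies invariance, so
  this is transitivity of the generated group.\<close>

definition transitive_pair :: "'a set \<Rightarrow> ('a \<Rightarrow> 'a) \<Rightarrow> ('a \<Rightarrow> 'a) \<Rightarrow> bool" where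
  "transitive_pair \<Omega> a b \<longleftrightarrow>
     (\<forall>S. S \<subseteq> \<Omega> \<longrightarrow> S \<noteq> {} \<longrightarrow> a ` S \<subseteq> S \<longrightarrow> b ` S \<subseteq> S \<longrightarrow> S = \<Omega>)"

text \<open>\<open>chase\<close> hands the block property of \<open>D\<close> to the caller. Where
  the 3-cycle itself shows no point that a generator keeps inside, words that return one point of
  \<open>D\<close> to \<open>D\<close> first produce further points of \<open>D\<close>.\<close>

theorem all_three_cycles:
  assumes fin: "finite \<Omega>" and ab: "a permutes \<Omega>" "b permutes \<Omega>" and tr: "transitive_pair \<Omega> a b"
    and xyz: "x \<in> \<Omega>" "y \<in> \<Omega>" "z \<in> \<Omega>" "distinct [x, y, z]" and c: "cyc3 x y z \<in> perm_span {a, b}"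
    and chase: "\<And>D. {x, y, z} \<subseteq> D \<Longrightarrow> D \<subseteq> \<Omega> \<Longrightarrow>
       (\<And>g p. g \<in> perm_span {a, b} \<Longrightarrow> p \<in> D \<Longrightarrow> g p \<in> D \<Longrightarrow> g ` D \<subseteq> D) \<Longrightarrow>
       (\<exists>p\<in>D. a p \<in> D) \<and> (\<exists>p\<in>D. b p \<in> D)"
  shows "has_three_cycles (perm_span {a, b}) \<Omega>"
proof -
  have S: "\<And>f. f \<in> {a, b} \<Longrightarrow> f permutes \<Omega>" using ab by auto
  from three_cycle_block[OF fin S xyz c] obtain D where
    D: "{x, y, z} \<subseteq> D" "D \<subseteq> \<Omega>" "has_three_cycles (perm_span {a, b}) D"
    "\<And>g p. g \<in> perm_span {a, b} \<Longrightarrow> p \<in> D \<Longrightarrow> g p \<in> D \<Longrightarrow> g ` D \<subseteq> D"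
    by blast
  have "(\<exists>p\<in>D. a p \<in> D) \<and> (\<exists>p\<in>D. b p \<in> D)"
    by (rule chase[OF D(1,2)]) (rule D(4))
  then obtain p q where "p \<in> D" "a p \<in> D" "q \<in> D" "b q \<in> D" by blast
  then have "a ` D \<subseteq> D" "b ` D \<subseteq> D"
    using D(4)[of a p] D(4)[of b q] perm_span.gen[of a "{a, b}"] perm_span.gen[of b "{a, b}"] by blast+
  moreover have "D \<noteq> {}" using D(1) by auto
  ultimately have "D = \<Omega>" using tr D(2) unfolding transitive_pair_def by blast
  then show ?thesis using D(3) by simp
qed

text \<open>As \<open>h\<close> fixes every point moved by \<open>g\<close> except \<open>p\<close>,
  the conjugate \<open>h \<circ> inv' g \<circ> inv' h\<close> is \<open>inv' g\<close> with
  \<open>p\<close> relabelled as \<open>h p\<close>. Composed with \<open>g\<close> it cancels away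
  from three points.\<close>

lemma commutator_single_intersection:
  assumes g: "bij g" and h: "bij h" and p: "g p \<noteq> p" "h p \<noteq> p"
    and only: "\<And>q. g q \<noteq> q \<Longrightarrow> h q \<noteq> q \<Longrightarrow> q = p"
  shows "g \<circ> h \<circ> inv' g \<circ> inv' h = cyc3 p (g p) (h p)" "distinct [p, g p, h p]"
proof -
  have ig: "inv' g (g q) = q" "g (inv' g q) = q" for q
    using g by (simp_all add: bij_is_inj bij_is_surj surj_f_inv_f)
  have ih: "inv' h (h q) = q" "h (inv' h q) = q" for q
    using h by (simp_all add: bij_is_inj bij_is_surj surj_f_inv_f)
  have gfix: "inv' g q = q" if "g q = q" for q using that ig by metis
  have hfix: "inv' h q = q" if "h q = q" for q using that ih by metis
  have h1: "h (g p) = g p"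
    using only[of "g p"] p ig by metis
  have g1: "g (h p) = h p"
    using only[of "h p"] p ih by metis
  have g2: "g (inv' h p) = inv' h p"
    using only[of "inv' h p"] p ih by metis
  have h2: "h (inv' g p) = inv' g p"
    using only[of "inv' g p"] p ig by metis
  have ne: "g p \<noteq> h p"
    using g1 ig p by metis
  then show d: "distinct [p, g p, h p]" using p by auto
  show "g \<circ> h \<circ> inv' g \<circ> inv' h = cyc3 p (g p) (h p)"
  proof (rule cyc3_eqI[OF d])
    show "(g \<circ> h \<circ> inv' g \<circ> inv' h) p = g p" using gfix[OF g2] ih by simp
    show "(g \<circ> h \<circ> inv' g \<circ> inv' h) (g p) = h p" using hfix[OF h1] ig g1 by simp
    show "(g \<circ> h \<circ> inv' g \<circ> inv' h) (h p) = p" using ih ig h2 by simp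
    fix w assume w: "w \<noteq> p" "w \<noteq> g p" "w \<noteq> h p"
    show "(g \<circ> h \<circ> inv' g \<circ> inv' h) w = w"
    proof (cases "h w = w")
      case True
      have "h (inv' g w) = inv' g w"
      proof (cases "g w = w")
        case True
        then show ?thesis using gfix \<open>h w = w\<close> by simp
      next
        case False
        then have "g (inv' g w) \<noteq> inv' g w" using ig by metis
        then show ?thesis using only[of "inv' g w"] w ig by metis
      qed
      then show ?thesis using hfix[OF True] ig by simp
    next
      case False
      then have gw: "g w = w" using only w by blast
      have "h (inv' h w) \<noteq> inv' h w" using False ih by metis
      then have "g (inv' h w) = inv' h w" using only[of "inv' h w"] w ih by metis
      then show ?thesis using gfix[of "inv' h w"] ih gw by simp
    qed
  qed
qed

section \<open>Element orders and generating pairs\<close>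

definition has_order :: "nat \<Rightarrow> ('a \<Rightarrow> 'a) \<Rightarrow> bool" where
  "has_order k f \<longleftrightarrow> f ^^ k = id \<and> (\<forall>i. 0 < i \<longrightarrow> i < k \<longrightarrow> f ^^ i \<noteq> id)"

lemma funpow_conj:
  assumes "bij p"
  shows "(p \<circ> f \<circ> inv' p) ^^ i = p \<circ> (f ^^ i) \<circ> inv' p"
proof (induction i)
  case 0
  show ?case
    unfolding funpow.simps comp_id by (rule bij_is_surj[OF assms, unfolded surj_iff, symmetric])
next
  case (Suc i)
  have "(p \<circ> f \<circ> inv' p) ^^ Suc i = p \<circ> f \<circ> (inv' p \<circ> p) \<circ> (f ^^ i) \<circ> inv' p"
    unfolding funpow.simps Suc by (simp only: comp_assoc)
  also have "\<dots> = p \<circ> (f ^^ Suc i) \<circ> inv' p"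
    unfolding inv_o_cancel[OF bij_is_inj[OF assms]] funpow.simps comp_id by (simp only: comp_assoc)
  finally show ?case .
qed

lemma has_order_conj:
  assumes "bij p" "has_order k f"
  shows "has_order k (p \<circ> f \<circ> inv' p)"
proof -
  have "f ^^ i = id" if "p \<circ> (f ^^ i) \<circ> inv' p = id" for i
  proof
    fix x
    have "p ((f ^^ i) (inv' p (p x))) = p x" using fun_cong[OF that, of "p x"] by simp
    then show "(f ^^ i) x = id x" using assms(1) by (simp add: bij_is_inj inj_eq)
  qed
  moreover have "p \<circ> id \<circ> inv' p = id"
    unfolding comp_id by (rule bij_is_surj[OF assms(1), unfolded surj_iff])
  ultimately show ?thesis
    using assms(2) unfolding has_order_def funpow_conj[OF assms(1)] by metis
qed

text \<open>For an odd permutation the parity of \<open>f ^^ i\<close> is that of \<open>i\<close>,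
  whereas the identity is even.\<close>

lemma odd_order_evenperm:
  assumes "permutation f" "f ^^ k = id" "odd k"
  shows "evenperm f"
proof (rule ccontr)
  assume odd: "\<not> evenperm f"
  have "permutation (f ^^ i) \<and> (evenperm (f ^^ i) \<longleftrightarrow> even i)" for i
  proof (induction i)
    case (Suc i)
    have "evenperm (f \<circ> f ^^ i) = (evenperm f = evenperm (f ^^ i))"
      by (rule evenperm_comp) (use Suc assms(1) in auto)
    moreover have "permutation (f \<circ> f ^^ i)"
      by (rule permutation_compose) (use Suc assms(1) in auto)
    ultimately show ?case using Suc odd unfolding funpow.simps even_Suc by blast
  next
    case 0
    show ?case unfolding funpow.simps by (intro conjI permutation_id) simp
  qed
  from this[of k] show False using assms(2,3) by simp
qed

definition generating_pair :: "nat \<Rightarrow> 'a set \<Rightarrow> ('a \<Rightarrow> 'a) \<Rightarrow> ('a \<Rightarrow> 'a) \<Rightarrow> bool" where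
  "generating_pair k \<Omega> a b \<longleftrightarrow> a permutes \<Omega> \<and> b permutes \<Omega> \<and> has_order k a \<and> has_order k b \<and>
     has_three_cycles (perm_span {a, b}) \<Omega>"

lemma map_permutation_inv:
  assumes "bij_betw \<phi> \<Omega> \<Omega>'" "f permutes \<Omega>"
  shows "map_permutation \<Omega> \<phi> (inv' f) = inv' (map_permutation \<Omega> \<phi> f)"
proof -
  have inj: "inj_on \<phi> \<Omega>" using assms(1) by (simp add: bij_betw_def)
  have "map_permutation \<Omega> \<phi> f \<circ> map_permutation \<Omega> \<phi> (inv' f) = id"
    unfolding map_permutation_compose'[OF inj permutes_inv[OF assms(2)], symmetric]
    using map_permutation_id'[OF inj] by (simp add: permutes_inv_o(1)[OF assms(2)])
  moreover have "map_permutation \<Omega> \<phi> (inv' f) \<circ> map_permutation \<Omega> \<phi> f = id"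
    unfolding map_permutation_compose'[OF inj assms(2), symmetric]
    using map_permutation_id'[OF inj] by (simp add: permutes_inv_o(2)[OF assms(2)])
  ultimately show ?thesis
    using inv_unique_comp by metis
qed

lemma map_permutation_funpow:
  assumes "inj_on \<phi> \<Omega>" "f permutes \<Omega>"
  shows "map_permutation \<Omega> \<phi> (f ^^ i) = map_permutation \<Omega> \<phi> f ^^ i"
proof (induction i)
  case 0
  show ?case unfolding funpow.simps by (rule map_permutation_id'[OF assms(1)])
next
  case (Suc i)
  then show ?case
    unfolding funpow.simps map_permutation_compose'[OF assms(1) permutes_funpow[OF assms(2)]] by simp
qed

lemma map_permutation_perm_span:
  assumes bij: "bij_betw \<phi> \<Omega> \<Omega>'" and S: "\<And>f. f \<in> S \<Longrightarrow> f permutes \<Omega>" and g: "g \<in> perm_span S"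
  shows "map_permutation \<Omega> \<phi> g \<in> perm_span (map_permutation \<Omega> \<phi> ` S)"
  using g
proof induction
  have inj: "inj_on \<phi> \<Omega>" using bij by (simp add: bij_betw_def)
  note perm = perm_span_permutes[OF S]
  case one
  show ?case unfolding map_permutation_id'[OF inj] by (rule perm_span.one)
next
  case (gen f)
  then show ?case by (intro perm_span.gen imageI)
next
  have inj: "inj_on \<phi> \<Omega>" using bij by (simp add: bij_betw_def)
  case (comp f g)
  have "g permutes \<Omega>" by (rule perm_span_permutes[OF S]) (use comp in auto)
  then have "map_permutation \<Omega> \<phi> (f \<circ> g) = map_permutation \<Omega> \<phi> f \<circ> map_permutation \<Omega> \<phi> g"
    by (rule map_permutation_compose'[OF inj])
  then show ?case using perm_span.comp[OF comp.IH] by metis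
next
  case (inv f)
  have "f permutes \<Omega>" by (rule perm_span_permutes[OF S]) (use inv in auto)
  then have "map_permutation \<Omega> \<phi> (inv' f) = inv' (map_permutation \<Omega> \<phi> f)"
    by (rule map_permutation_inv[OF bij])
  then show ?case using perm_span.inv[OF inv.IH] by metis
qed

text \<open>Each construction works on the point set that suits it, an initial segment or a
  \<open>rep_set\<close>. Relabelling along a bijection preserves orders, parities and 3-cycles and
  leads to \<open>{1..n}\<close>.\<close>

lemma generating_pair_transport:
  assumes gp: "generating_pair k \<Omega> a b" and fin: "finite \<Omega>" "finite \<Omega>'" "card \<Omega> = card \<Omega>'"
  shows "\<exists>a' b'. generating_pair k \<Omega>' a' b' \<and> evenperm a' = evenperm a \<and> evenperm b' = evenperm b"
proof -
  obtain \<phi> where bij: "bij_betw \<phi> \<Omega> \<Omega>'"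
    using finite_same_card_bij[OF fin] by blast
  then have inj: "inj_on \<phi> \<Omega>" and im: "\<phi> ` \<Omega> = \<Omega>'" by (simp_all add: bij_betw_def)
  define M where "M = map_permutation \<Omega> \<phi>"
  have ab: "a permutes \<Omega>" "b permutes \<Omega>" "has_order k a" "has_order k b"
    "has_three_cycles (perm_span {a, b}) \<Omega>"
    using gp unfolding generating_pair_def by auto
  have order: "has_order k (M f)" if "f permutes \<Omega>" "has_order k f" for f
  proof -
    have "f ^^ i = id" if "M f ^^ i = id" for i
    proof
      fix x
      show "(f ^^ i) x = id x"
      proof (cases "x \<in> \<Omega>")
        case True
        have "M (f ^^ i) (\<phi> x) = \<phi> ((f ^^ i) x)"
          unfolding M_def by (rule map_permutation_apply[OF inj True])
        moreover have "M (f ^^ i) = id"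
          using \<open>M f ^^ i = id\<close> map_permutation_funpow[OF inj \<open>f permutes \<Omega>\<close>] unfolding M_def by simp
        ultimately have "\<phi> x = \<phi> ((f ^^ i) x)" by simp
        moreover have "(f ^^ i) x \<in> \<Omega>"
          using True permutes_in_image[OF permutes_funpow[OF \<open>f permutes \<Omega>\<close>]] by metis
        ultimately show ?thesis using inj True by (simp add: inj_on_def)
      next
        case False
        then show ?thesis
          using permutes_not_in[OF permutes_funpow[OF \<open>f permutes \<Omega>\<close>]] by simp
      qed
    qed
    moreover have "M f ^^ k = id"
      using that(2) map_permutation_funpow[OF inj \<open>f permutes \<Omega>\<close>, of k] map_permutation_id'[OF inj]
      unfolding M_def has_order_def by simp
    ultimately show ?thesis using that(2) unfolding has_order_def by blast
  qed
  have "has_three_cycles (perm_span {M a, M b}) \<Omega>'"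
    unfolding has_three_cycles_def
  proof (intro ballI impI)
    fix x y z assume "x \<in> \<Omega>'" "y \<in> \<Omega>'" "z \<in> \<Omega>'" and d: "distinct [x, y, z]"
    then obtain u v w where uvw: "u \<in> \<Omega>" "v \<in> \<Omega>" "w \<in> \<Omega>" "x = \<phi> u" "y = \<phi> v" "z = \<phi> w"
      using im by blast
    then have d': "distinct [u, v, w]" using d by auto
    have "M (cyc3 u v w) = cyc3 x y z"
    proof (rule cyc3_eqI[OF d])
      show "M (cyc3 u v w) x = y" "M (cyc3 u v w) y = z" "M (cyc3 u v w) z = x"
        unfolding M_def uvw(4-6)
        by (simp_all add: map_permutation_apply[OF inj] uvw(1-3) cyc3_apply[OF d'])
      fix q assume q: "q \<noteq> x" "q \<noteq> y" "q \<noteq> z"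
      show "M (cyc3 u v w) q = q"
      proof (cases "q \<in> \<Omega>'")
        case True
        then obtain r where r: "r \<in> \<Omega>" "q = \<phi> r" using im by blast
        have "r \<noteq> u" "r \<noteq> v" "r \<noteq> w" using q r uvw by auto
        then show ?thesis
          unfolding M_def r(2) by (simp add: map_permutation_apply[OF inj] r cyc3_apply[OF d'])
      next
        case False
        then show ?thesis unfolding M_def map_permutation_def im by simp
      qed
    qed
    moreover have "M (cyc3 u v w) \<in> perm_span (M ` {a, b})"
      unfolding M_def
      by (rule map_permutation_perm_span[OF bij])
        (use ab has_three_cyclesD[OF ab(5) uvw(1-3) d'] in auto)
    ultimately show "cyc3 x y z \<in> perm_span {M a, M b}" by simp
  qed
  then have "generating_pair k \<Omega>' (M a) (M b)"
    unfolding generating_pair_def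
    using order ab map_permutation_permutes[OF bij] unfolding M_def by auto
  moreover have "evenperm (M a) = evenperm a" "evenperm (M b) = evenperm b"
    unfolding M_def using evenperm_map_permutation[OF inj _ fin(1)] ab by auto
  ultimately show ?thesis by blast
qed

section \<open>From generating pairs to the value of \<open>d_gen\<close>\<close>

lemma (in group) generate_commutes:
  assumes "H \<subseteq> carrier G" "z \<in> carrier G" "\<And>s. s \<in> H \<Longrightarrow> z \<otimes> s = s \<otimes> z" "h \<in> generate G H"
  shows "z \<otimes> h = h \<otimes> z"
  using assms(4)
proof induction
  case one
  show ?case using assms(2) by simp
next
  case (incl h)
  then show ?case by (rule assms(3))
next
  case (inv h)
  then have h: "h \<in> carrier G" "z \<otimes> h = h \<otimes> z" using assms by auto
  then show ?case
    using assms(2) by (metis inv_closed inv_solve_left inv_solve_right m_assoc m_closed)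
next
  case (eng h1 h2)
  then have "h1 \<in> carrier G" "h2 \<in> carrier G" using generate_in_carrier assms(1) by auto
  then show ?case using eng.IH assms(2) by (metis m_assoc)
qed

text \<open>Source of the lower bound 2: a group with two non-commuting elements cannot be generated
  by fewer than two elements.\<close>

lemma (in group) generate_small_commutative:
  assumes "H \<subseteq> carrier G" "finite H" "card H \<le> 1" "x \<in> generate G H" "y \<in> generate G H"
  shows "x \<otimes> y = y \<otimes> x"
proof -
  have HH: "s \<otimes> t = t \<otimes> s" if "s \<in> H" "t \<in> H" for s t
  proof -
    have "s = t"
      using assms(3) that card_le_Suc0_iff_eq[OF assms(2)] by simp
    then show ?thesis by simp
  qed
  have "s \<otimes> y = y \<otimes> s" if "s \<in> H" for s
    using generate_commutes[of H s y] assms(1,5) that HH by blast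
  then have "y \<otimes> x = x \<otimes> y"
    using generate_commutes[of H y x] assms(1,4,5) generate_in_carrier by metis
  then show ?thesis by simp
qed

lemma d_gen_eq_2:
  assumes G: "group G" and S: "order_k_gen_set k G {a, b}"
    and nc: "x \<in> carrier G" "y \<in> carrier G" "x \<otimes>\<^bsub>G\<^esub> y \<noteq> y \<otimes>\<^bsub>G\<^esub> x"
  shows "d_gen k G = 2"
proof -
  have lower: "2 \<le> card T" if "order_k_gen_set k G T" for T
    using group.generate_small_commutative[OF G, of T x y] that nc
    unfolding order_k_gen_set_def by (metis not_less_eq_eq numeral_2_eq_2 One_nat_def)
  \<comment> \<open>The lower bound also excludes \<open>a = b\<close>.\<close>
  have "card {a, b} = 2"
    using lower[OF S] by (cases "a = b") auto
  then have "(LEAST m. \<exists>T. order_k_gen_set k G T \<and> card T = m) = 2"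
    using S lower by (intro Least_equality) auto
  then show ?thesis using S unfolding d_gen_def by auto
qed

lemma sym_group_pow: "f [^]\<^bsub>sym_group n\<^esub> (i::nat) = f ^^ i"
  by (induction i) (simp_all add: sym_group_def nat_pow_def funpow_swap1 fun_eq_iff)

lemma alt_group_pow: "f [^]\<^bsub>alt_group n\<^esub> (i::nat) = f ^^ i"
  by (induction i) (simp_all add: alt_group_def sym_group_def nat_pow_def funpow_swap1 fun_eq_iff)

lemma (in group) ord_eqI:
  assumes "x \<in> carrier G" "0 < k" "x [^] k = \<one>" "\<And>i. 0 < i \<Longrightarrow> i < k \<Longrightarrow> x [^] i \<noteq> \<one>"
  shows "ord x = k"
proof -
  have "ord x dvd k" using assms(1,3) by (simp add: pow_eq_id)
  moreover have "x [^] ord x = \<one>" using assms(1) by simp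
  ultimately show ?thesis
    using assms(2) assms(4)[of "ord x"] by (metis dvd_imp_le dvd_pos_nat le_neq_implies_less)
qed

lemma sym_group_ord:
  assumes "f permutes {1..n}" "has_order k f" "0 < k"
  shows "group.ord (sym_group n) f = k"
  by (rule group.ord_eqI[OF sym_group_is_group])
    (use assms in \<open>auto simp: sym_group_carrier sym_group_pow sym_group_one has_order_def\<close>)

lemma alt_group_ord:
  assumes "f permutes {1..n}" "evenperm f" "has_order k f" "0 < k"
  shows "group.ord (alt_group n) f = k"
  by (rule group.ord_eqI[OF alt_group_is_group])
    (use assms in \<open>auto simp: alt_group_carrier alt_group_pow alt_group_one has_order_def\<close>)

lemma perm_span_subset_generate:
  assumes S: "S \<subseteq> carrier (sym_group n)" and f: "f \<in> perm_span S"
  shows "f \<in> generate (sym_group n) S"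
proof -
  interpret group "sym_group n" by (rule sym_group_is_group)
  show ?thesis
    using f
  proof induction
    case one
    show ?case using generate.one[of "sym_group n" S] unfolding sym_group_one .
  next
    case (gen f)
    then show ?case by (rule generate.incl)
  next
    case (comp f g)
    show ?case using generate.eng[OF comp.IH] unfolding sym_group_mult .
  next
    case (inv f)
    then show ?case
      using generate_m_inv_closed[OF S inv.IH] sym_group_inv_equality[OF generate_in_carrier[OF S inv.IH]]
      by simp
  qed
qed

lemma alt_subset_generate:
  assumes S: "S \<subseteq> carrier (sym_group n)" and c: "has_three_cycles (perm_span S) {1..n}"
  shows "carrier (alt_group n) \<subseteq> generate (sym_group n) S"
proof -
  interpret group "sym_group n" by (rule sym_group_is_group)
  have alt: "alt_group n = sym_group n \<lparr> carrier := carrier (alt_group n) \<rparr>"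
    unfolding alt_group_def by simp
  have "carrier (alt_group n) = generate (alt_group n) (three_cycles n)"
    by (rule alt_group_carrier_as_three_cycles)
  also have "\<dots> = generate (sym_group n) (three_cycles n)"
    \<comment> \<open>Generation inside the subgroup and inside \<open>sym_group n\<close> agree, so
      it is enough to catch the 3-cycles.\<close>
    using generate_consistent[OF three_cycles_incl alt_group_is_subgroup] alt by metis
  also have "\<dots> \<subseteq> generate (sym_group n) S"
  proof (rule generate_subgroup_incl[OF _ generate_is_subgroup[OF S]])
    show "three_cycles n \<subseteq> generate (sym_group n) S"
    proof
      fix f assume "f \<in> three_cycles n"
      then obtain cs where cs: "f = cycle_of_list cs" "distinct cs" "length cs = 3" "set cs \<subseteq> {1..n}"
        by blast
      define x y z where "x = cs ! 0" and "y = cs ! 1" and "z = cs ! 2"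
      have "cs = [x, y, z]" unfolding x_def y_def z_def by (rule stupid_lemma[OF cs(3)])
      then have "f = cyc3 x y z" "cyc3 x y z \<in> perm_span S"
        using cs cyc3_cycle_of_list[of x y z] has_three_cyclesD[OF c, of x y z] by auto
      then show "f \<in> generate (sym_group n) S"
        using perm_span_subset_generate[OF S] by simp
    qed
  qed
  finally show ?thesis .
qed

lemma alt_group_noncommutative:
  assumes "4 \<le> n"
  shows "\<exists>x y. x \<in> carrier (alt_group n) \<and> y \<in> carrier (alt_group n) \<and> x \<circ> y \<noteq> y \<circ> x"
proof (intro exI conjI)
  have "cycle_of_list [1, 2, 3::nat] \<in> three_cycles n"
    using assms by (intro CollectI exI[of _ "[1, 2, 3::nat]"]) (simp del: cycle_of_list.simps)
  moreover have "cycle_of_list [2, 3, 4::nat] \<in> three_cycles n"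
    using assms by (intro CollectI exI[of _ "[2, 3, 4::nat]"]) (simp del: cycle_of_list.simps)
  ultimately show "cycle_of_list [1, 2, 3::nat] \<in> carrier (alt_group n)"
    "cycle_of_list [2, 3, 4::nat] \<in> carrier (alt_group n)"
    using three_cycles_incl by blast+
  have "(cycle_of_list [1, 2, 3::nat] \<circ> cycle_of_list [2, 3, 4]) 1 = 2"
    "(cycle_of_list [2, 3, 4::nat] \<circ> cycle_of_list [1, 2, 3]) 1 = 3"
    by (simp_all add: transpose_def)
  moreover have "(2::nat) \<noteq> 3" by simp
  ultimately show "cycle_of_list [1, 2, 3::nat] \<circ> cycle_of_list [2, 3, 4]
      \<noteq> cycle_of_list [2, 3, 4] \<circ> cycle_of_list [1, 2, 3]"
    by metis
qed

text \<open>The generated group contains all even permutations, and the odd generator supplies the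
  other coset: an odd \<open>p\<close> is \<open>a\<close> times the even permutation
  \<open>inv' a \<circ> p\<close>.\<close>

theorem d_gen_sym_group:
  assumes "4 \<le> n" "0 < k" "generating_pair k {1..n} a b" "\<not> evenperm a"
  shows "d_gen k (sym_group n) = 2"
proof -
  interpret group "sym_group n" by (rule sym_group_is_group)
  have ab: "a permutes {1..n}" "b permutes {1..n}" "has_order k a" "has_order k b"
    "has_three_cycles (perm_span {a, b}) {1..n}"
    using assms(3) unfolding generating_pair_def by auto
  have S: "{a, b} \<subseteq> carrier (sym_group n)" using ab by (simp add: sym_group_carrier)
  note alt = alt_subset_generate[OF S ab(5)]
  have "p \<in> generate (sym_group n) {a, b}" if p: "p permutes {1..n}" for p
  proof (cases "evenperm p")
    case True
    then show ?thesis using p alt by (auto simp: alt_group_carrier)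
  next
    case False
    have pa: "permutation a" "permutation p" using ab(1) p permutes_imp_permutation by blast+
    have "evenperm (inv' a \<circ> p)"
      using evenperm_comp[OF permutation_inverse[OF pa(1)] pa(2)] evenperm_inv[OF pa(1)] False assms(4) by simp
    moreover have "inv' a \<circ> p permutes {1..n}"
      by (rule permutes_compose[OF p permutes_inv[OF ab(1)]])
    ultimately have "inv' a \<circ> p \<in> generate (sym_group n) {a, b}"
      using alt by (auto simp: alt_group_carrier)
    then have "a \<circ> (inv' a \<circ> p) \<in> generate (sym_group n) {a, b}"
      using generate.eng[OF generate.incl[of a "{a, b}" "sym_group n"]] by (simp add: sym_group_mult)
    moreover have "a \<circ> (inv' a \<circ> p) = p"
      using permutes_inv_o(1)[OF ab(1)] by (simp only: comp_assoc[symmetric] id_comp)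
    ultimately show ?thesis by simp
  qed
  then have "generate (sym_group n) {a, b} = carrier (sym_group n)"
    using generate_incl[OF S] by (auto simp: sym_group_carrier)
  then have "order_k_gen_set k (sym_group n) {a, b}"
    using S sym_group_ord ab assms(2) unfolding order_k_gen_set_def by auto
  moreover obtain x y where "x \<in> carrier (alt_group n)" "y \<in> carrier (alt_group n)" "x \<circ> y \<noteq> y \<circ> x"
    using alt_group_noncommutative[OF assms(1)] by blast
  ultimately show ?thesis
    by (intro d_gen_eq_2[OF sym_group_is_group, of k n a b x y])
      (auto simp: sym_group_carrier alt_group_carrier sym_group_mult)
qed

lemma generate_alt_group:
  assumes "S \<subseteq> carrier (alt_group n)" "has_three_cycles (perm_span S) {1..n}"
  shows "generate (alt_group n) S = carrier (alt_group n)"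
proof
  show "generate (alt_group n) S \<subseteq> carrier (alt_group n)"
    by (rule group.generate_incl[OF alt_group_is_group assms(1)])
  have alt: "alt_group n = sym_group n \<lparr> carrier := carrier (alt_group n) \<rparr>"
    unfolding alt_group_def by simp
  have "generate (alt_group n) S = generate (sym_group n) S"
    using group.generate_consistent[OF sym_group_is_group assms(1) alt_group_is_subgroup] alt by metis
  moreover have "S \<subseteq> carrier (sym_group n)"
    using assms(1) by (auto simp: alt_group_carrier sym_group_carrier)
  ultimately show "carrier (alt_group n) \<subseteq> generate (alt_group n) S"
    using alt_subset_generate[OF _ assms(2)] by simp
qed

theorem d_gen_alt_group:
  assumes "4 \<le> n" "0 < k" "generating_pair k {1..n} a b" "evenperm a" "evenperm b"
  shows "d_gen k (alt_group n) = 2"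
proof -
  have ab: "a permutes {1..n}" "b permutes {1..n}" "has_order k a" "has_order k b"
    "has_three_cycles (perm_span {a, b}) {1..n}"
    using assms(3) unfolding generating_pair_def by auto
  have S: "{a, b} \<subseteq> carrier (alt_group n)" using ab assms(4,5) by (simp add: alt_group_carrier)
  then have "order_k_gen_set k (alt_group n) {a, b}"
    using generate_alt_group[OF S ab(5)] alt_group_ord ab assms(2,4,5)
    unfolding order_k_gen_set_def by auto
  moreover obtain x y where "x \<in> carrier (alt_group n)" "y \<in> carrier (alt_group n)" "x \<circ> y \<noteq> y \<circ> x"
    using alt_group_noncommutative[OF assms(1)] by blast
  ultimately show ?thesis
    by (intro d_gen_eq_2[OF alt_group_is_group, of k n a b x y])
      (auto simp: alt_group_mult)
qed

text \<open>A_3 is cyclic and nontrivial, so one generator suffices and the empty set does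
  not.\<close>

lemma d_gen_alt_group_3: "d_gen 3 (alt_group 3) = 1"
proof -
  define c where "c = cyc3 (1::nat) 2 3"
  have d: "distinct [1::nat, 2, 3]" by simp
  have "cycle_of_list [1::nat, 2, 3] \<in> three_cycles 3"
    by (intro CollectI exI[of _ "[1::nat, 2, 3]"]) (simp del: cycle_of_list.simps)
  then have c: "c \<in> carrier (alt_group 3)"
    using three_cycles_incl cyc3_cycle_of_list[OF d] unfolding c_def by auto
  have "has_three_cycles (perm_span {c}) {1..3}"
    unfolding has_three_cycles_def
  proof (intro ballI impI)
    fix x y z :: nat assume "x \<in> {1..3}" "y \<in> {1..3}" "z \<in> {1..3}" and dd: "distinct [x, y, z]"
    then have "x \<in> {1, 2, 3}" "y \<in> {1, 2, 3}" "z \<in> {1, 2, 3}" by auto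
    then consider "(x, y, z) = (1, 2, 3)" | "(x, y, z) = (2, 3, 1)" | "(x, y, z) = (3, 1, 2)"
      | "(x, y, z) = (2, 1, 3)" | "(x, y, z) = (1, 3, 2)" | "(x, y, z) = (3, 2, 1)"
      using dd by auto
    \<comment> \<open>The six arrangements of three points give only two different 3-cycles.\<close>
    then have "cyc3 x y z = c \<or> cyc3 x y z = inv' c"
      unfolding c_def inv_cyc3[OF d] by cases (auto simp: cyc3_def fun_eq_iff)
    moreover have "c \<in> perm_span {c}" "inv' c \<in> perm_span {c}"
      by (auto intro: perm_span.gen perm_span.inv)
    ultimately show "cyc3 x y z \<in> perm_span {c}" by metis
  qed
  then have gen: "generate (alt_group 3) {c} = carrier (alt_group 3)"
    using c by (intro generate_alt_group) auto
  have "has_order 3 c"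
  proof -
    have c1: "c 1 = 2" "c 2 = 3" "c 3 = 1" by (auto simp: c_def cyc3_def)
    have "c ^^ 3 = id" by (auto simp: fun_eq_iff c_def cyc3_def eval_nat_numeral)
    moreover have "c ^^ i \<noteq> id" if "0 < i" "i < 3" for i
    proof -
      have "i = 1 \<or> i = 2" using that by auto
      then have "(c ^^ i) 1 \<noteq> 1"
      proof
        assume "i = 1" then show ?thesis using c1 by simp
      next
        assume "i = 2"
        then have "c ^^ i = c \<circ> c" by (simp add: eval_nat_numeral)
        then show ?thesis using c1 by simp
      qed
      then show ?thesis by auto
    qed
    ultimately show ?thesis unfolding has_order_def by blast
  qed
  then have "order_k_gen_set 3 (alt_group 3) {c}"
    using c gen alt_group_ord[of c 3 3] unfolding order_k_gen_set_def by (auto simp: alt_group_carrier)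
  moreover have "1 \<le> card T" if T: "order_k_gen_set 3 (alt_group 3) T" for T
  proof (rule ccontr)
    assume "\<not> 1 \<le> card T"
    then have "T = {}" using T unfolding order_k_gen_set_def by (simp add: not_le)
    then have "carrier (alt_group 3) = {id}"
      using T group.generate_empty[OF alt_group_is_group] unfolding order_k_gen_set_def
      by (simp add: alt_group_one)
    then have "c 1 = 1" using c by simp
    then show False by (simp add: c_def cyc3_def)
  qed
  ultimately have "(LEAST m. \<exists>T. order_k_gen_set 3 (alt_group 3) T \<and> card T = m) = 1"
    by (intro Least_equality) (auto intro!: exI[of _ "{c}"])
  then show ?thesis
    using \<open>order_k_gen_set 3 (alt_group 3) {c}\<close> unfolding d_gen_def by auto
qed

section \<open>Cycles on intervals and products of disjoint permutations\<close>

lemma cycle_of_list_funpow_nth: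
  assumes "distinct xs" "i < length xs"
  shows "(cycle_of_list xs ^^ j) (xs ! i) = xs ! ((j + i) mod length xs)"
proof -
  have "(cycle_of_list xs ^^ j) (xs ! i) = map (cycle_of_list xs ^^ j) xs ! i"
    using assms(2) by simp
  also have "\<dots> = rotate j xs ! i"
    by (simp only: cyclic_rotation[OF assms(1)])
  also have "\<dots> = xs ! ((j + i) mod length xs)"
    using assms(2) by (rule nth_rotate)
  finally show ?thesis .
qed

lemma cycle_of_list_nth:
  assumes "distinct xs" "i < length xs"
  shows "cycle_of_list xs (xs ! i) = xs ! (Suc i mod length xs)"
  using cycle_of_list_funpow_nth[OF assms, of 1] by simp

lemma evenperm_cycle_of_list:
  assumes "distinct xs" "xs \<noteq> []"
  shows "evenperm (cycle_of_list xs) \<longleftrightarrow> odd (length xs)"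
proof -
  have "swapidseq (length xs - 1) (cycle_of_list xs)"
    by (rule swapidseq_ext_imp_swapidseq[OF swapidseq_ext_of_cycles[OF assms(1)]])
  then have "evenperm (cycle_of_list xs) = even (length xs - 1)"
    by (rule evenperm_unique) simp
  then show ?thesis using assms(2) by (cases xs) auto
qed

definition rot :: "nat \<Rightarrow> nat \<Rightarrow> nat \<Rightarrow> nat" where
  "rot l k = cycle_of_list [l..<l + k]"

lemma rot_apply:
  "rot l k x = (if l \<le> x \<and> x < l + k then if Suc x < l + k then Suc x else l else x)"
proof (cases "l \<le> x \<and> x < l + k")
  case True
  have "x - l < k" using True by auto
  then have "rot l k ([l..<l + k] ! (x - l)) = [l..<l + k] ! (Suc (x - l) mod k)"
    unfolding rot_def using cycle_of_list_nth[of "[l..<l + k]" "x - l"] True by simp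
  moreover have "[l..<l + k] ! (x - l) = x" using True by simp
  moreover have "Suc (x - l) mod k = (if Suc x < l + k then Suc x - l else 0)"
    using True by (cases "Suc (x - l) = k") auto
  moreover have "k > 0" using True by auto
  ultimately show ?thesis using True by auto
next
  case False
  then show ?thesis unfolding rot_def by (auto intro!: id_outside_supp)
qed

lemma rot_permutes: "rot l k permutes {l..<l + k}"
  unfolding rot_def using cycle_permutes[of "[l..<l + k]"] by simp

lemma rot_funpow: "i < k \<Longrightarrow> (rot l k ^^ j) (l + i) = l + (j + i) mod k"
  unfolding rot_def using cycle_of_list_funpow_nth[of "[l..<l + k]" i j] by simp

lemma rot_funpow_id: "rot l k ^^ k = id"
  unfolding rot_def using cycle_is_id_root[of "[l..<l + k]"] by simp

lemma has_orderI:
  assumes "f ^^ k = id" "\<And>i. 0 < i \<Longrightarrow> i < k \<Longrightarrow> (f ^^ i) x \<noteq> x"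
  shows "has_order k f"
  using assms unfolding has_order_def by (metis id_apply)

lemma rot_has_order: "has_order k (rot l k)"
  by (rule has_orderI[OF rot_funpow_id, of _ _ l]) (use rot_funpow[of 0 k _ l] in auto)

lemma evenperm_rot: "0 < k \<Longrightarrow> evenperm (rot l k) \<longleftrightarrow> odd k"
  unfolding rot_def using evenperm_cycle_of_list[of "[l..<l + k]"] by simp

lemma funpow_comp_commute:
  assumes "f \<circ> g = g \<circ> f"
  shows "(f \<circ> g) ^^ i = f ^^ i \<circ> g ^^ i"
proof (induction i)
  case 0
  show ?case by simp
next
  case (Suc i)
  have comm: "f ^^ i \<circ> g = g \<circ> f ^^ i"
  proof (induction i)
    case (Suc i)
    have "f ^^ Suc i \<circ> g = f \<circ> (f ^^ i \<circ> g)" by (simp only: funpow.simps comp_assoc)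
    also have "\<dots> = (f \<circ> g) \<circ> f ^^ i" unfolding Suc by (simp only: comp_assoc)
    also have "\<dots> = g \<circ> f ^^ Suc i" unfolding assms by (simp only: funpow.simps comp_assoc)
    finally show ?case .
  qed simp
  have "(f \<circ> g) ^^ Suc i = f \<circ> (g \<circ> f ^^ i) \<circ> g ^^ i" by (simp only: funpow.simps comp_assoc Suc)
  also have "\<dots> = f ^^ Suc i \<circ> g ^^ Suc i"
    unfolding comm[symmetric] by (simp only: funpow.simps comp_assoc)
  finally show ?case .
qed

lemma permutes_disjoint_commute:
  assumes "f permutes A" "g permutes B" "A \<inter> B = {}"
  shows "f \<circ> g = g \<circ> f"
proof
  fix x
  consider "x \<in> A" | "x \<in> B" | "x \<notin> A" "x \<notin> B" by blast
  then show "(f \<circ> g) x = (g \<circ> f) x"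
  proof cases
    case 1
    then have "f x \<in> A" using permutes_in_image[OF assms(1)] by simp
    then show ?thesis using 1 assms(3) permutes_not_in[OF assms(2)] by (metis comp_apply disjoint_iff)
  next
    case 2
    then have "g x \<in> B" using permutes_in_image[OF assms(2)] by simp
    then show ?thesis using 2 assms(3) permutes_not_in[OF assms(1)] by (metis comp_apply disjoint_iff)
  next
    case 3
    then show ?thesis using permutes_not_in[OF assms(1)] permutes_not_in[OF assms(2)] by simp
  qed
qed

text \<open>On \<open>A\<close> the powers of the product are those of \<open>f\<close>, which fixes
  the order. The factor \<open>g\<close> may be anything that the exponent \<open>k\<close> kills:
  another \<open>k\<close>-cycle, or for even \<open>k\<close> an involution that changes the
  parity.\<close>

lemma has_order_disjoint_comp:
  assumes "f permutes A" "g permutes B" "A \<inter> B = {}" "has_order k f" "g ^^ k = id"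
  shows "has_order k (f \<circ> g)"
proof -
  have pow: "(f \<circ> g) ^^ i = f ^^ i \<circ> g ^^ i" for i
    by (rule funpow_comp_commute[OF permutes_disjoint_commute[OF assms(1-3)]])
  have "f ^^ i = id" if "(f \<circ> g) ^^ i = id" for i
  proof
    fix x
    show "(f ^^ i) x = id x"
    proof (cases "x \<in> A")
      case True
      then have "(g ^^ i) x = x"
        using assms(3) permutes_not_in[OF permutes_funpow[OF assms(2)]] by blast
      then show ?thesis using fun_cong[OF that, of x] by (simp add: pow)
    next
      case False
      then show ?thesis using permutes_not_in[OF permutes_funpow[OF assms(1)]] by simp
    qed
  qed
  moreover have "(f \<circ> g) ^^ k = id" using assms(4,5) pow[of k] unfolding has_order_def by simp
  ultimately show ?thesis using assms(4) unfolding has_order_def by blast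
qed

lemma funpow_agree:
  assumes "\<And>x. x \<in> S \<Longrightarrow> f x = g x" "\<And>x. x \<in> S \<Longrightarrow> g x \<in> S" "x \<in> S"
  shows "(f ^^ i) x = (g ^^ i) x \<and> (g ^^ i) x \<in> S"
  using assms by (induction i) auto

text \<open>The easy case of \<open>chase\<close>: the witnesses already lie on the 3-cycle.\<close>

lemma all_three_cycles_support:
  assumes "finite \<Omega>" "a permutes \<Omega>" "b permutes \<Omega>" "transitive_pair \<Omega> a b"
    and "x \<in> \<Omega>" "y \<in> \<Omega>" "z \<in> \<Omega>" "distinct [x, y, z]" "cyc3 x y z \<in> perm_span {a, b}"
    and pa: "\<exists>p\<in>{x, y, z}. a p \<in> {x, y, z}" and pb: "\<exists>p\<in>{x, y, z}. b p \<in> {x, y, z}"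
  shows "has_three_cycles (perm_span {a, b}) \<Omega>"
proof (rule all_three_cycles[OF assms(1-9)])
  fix D assume D: "{x, y, z} \<subseteq> D"
  obtain p q where "p \<in> {x, y, z}" "a p \<in> {x, y, z}" "q \<in> {x, y, z}" "b q \<in> {x, y, z}"
    using pa pb by blast
  then show "(\<exists>p\<in>D. a p \<in> D) \<and> (\<exists>p\<in>D. b p \<in> D)"
    using D by (meson subsetD)
qed

section \<open>Attaching a cycle to each generator\<close>

text \<open>\<open>u\<close> marks the place for the next link. It must be moved by \<open>b\<close>
  because the link uses the two points \<open>u\<close> and \<open>b u\<close>.\<close>

definition linkable :: "nat \<Rightarrow> nat \<Rightarrow> (nat \<Rightarrow> nat) \<Rightarrow> (nat \<Rightarrow> nat) \<Rightarrow> nat \<Rightarrow> bool" where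
  "linkable k n a b u \<longleftrightarrow> a permutes {..<n} \<and> b permutes {..<n} \<and> has_order k a \<and> has_order k b \<and>
     transitive_pair {..<n} a b \<and> u < n \<and> b u \<noteq> u"

text \<open>Adding the cycle \<open>rot n k\<close> to both permutations and exchanging \<open>b u\<close> with the second new
  point in \<open>b\<close> changes \<open>a\<^sup>-\<^sup>1 b\<close> only by the transpositions \<open>(u n)\<close> and \<open>(b u, n + 1)\<close>.\<close>

definition link_a :: "nat \<Rightarrow> nat \<Rightarrow> (nat \<Rightarrow> nat) \<Rightarrow> nat \<Rightarrow> nat" where
  "link_a k n a = a \<circ> rot n k"

definition link_b :: "nat \<Rightarrow> nat \<Rightarrow> (nat \<Rightarrow> nat) \<Rightarrow> nat \<Rightarrow> nat \<Rightarrow> nat" where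
  "link_b k n b u = transpose (b u) (Suc n) \<circ> (b \<circ> rot n k) \<circ> inv' (transpose (b u) (Suc n))"

context
  fixes k n u a b
  assumes k: "4 \<le> k" and l: "linkable k n a b u"
begin

private lemma l': "a permutes {..<n}" "b permutes {..<n}" "has_order k a" "has_order k b"
  "transitive_pair {..<n} a b" "u < n" "b u \<noteq> u" "b u < n"
  using l permutes_in_image[of b "{..<n}" u] unfolding linkable_def by auto

lemma link_a_apply:
  "x < n \<Longrightarrow> link_a k n a x = a x" "n \<le> x \<Longrightarrow> link_a k n a x = rot n k x"
proof -
  show "link_a k n a x = a x" if "x < n" using that by (simp add: link_a_def rot_apply)
  assume "n \<le> x"
  then have "n \<le> rot n k x" by (simp add: rot_apply)
  then show "link_a k n a x = rot n k x"
    using permutes_not_in[OF l'(1), of "rot n k x"] by (simp add: link_a_def)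
qed

lemma link_b_apply:
  "x < n \<Longrightarrow> x \<noteq> u \<Longrightarrow> x \<noteq> b u \<Longrightarrow> link_b k n b u x = b x"
  "link_b k n b u u = Suc n" "link_b k n b u (b u) = Suc (Suc n)"
  "link_b k n b u n = b u" "link_b k n b u (Suc n) = b (b u)"
  "Suc (Suc n) \<le> x \<Longrightarrow> link_b k n b u x = rot n k x"
proof -
  have inj: "b x = b y \<longleftrightarrow> x = y" for x y by (rule inj_eq[OF permutes_inj[OF l'(2)]])
  have less: "b x < n" if "x < n" for x using that permutes_in_image[OF l'(2), of x] by simp
  have big: "b x = x" if "n \<le> x" for x using that permutes_not_in[OF l'(2), of x] by simp
  have e: "link_b k n b u x = transpose (b u) (Suc n) (b (rot n k (transpose (b u) (Suc n) x)))" for x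
    by (simp add: link_b_def)
  show "link_b k n b u x = b x" if "x < n" "x \<noteq> u" "x \<noteq> b u"
    using that less[of x] inj[of x u] unfolding e by (simp add: rot_apply transpose_def)
  show "link_b k n b u u = Suc n"
    using l' unfolding e by (simp add: rot_apply transpose_def)
  show "link_b k n b u (b u) = Suc (Suc n)"
    using l' k unfolding e by (simp add: rot_apply transpose_def big)
  show "link_b k n b u n = b u"
    using l' k unfolding e by (simp add: rot_apply transpose_def big)
  show "link_b k n b u (Suc n) = b (b u)"
    using l' inj[of "b u" u] less[of "b u"] unfolding e by (simp add: rot_apply transpose_def)
  show "link_b k n b u x = rot n k x" if "Suc (Suc n) \<le> x"
    using that l' unfolding e by (simp add: rot_apply transpose_def big)
qed

text \<open>The delicate point is transitivity, since \<open>b'\<close> no longer agrees with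
  \<open>b\<close> at \<open>u\<close> and \<open>b u\<close>. Their images lie on the new cycle,
  \<open>a'\<close> runs around all of it, and its points \<open>n\<close> and \<open>n + 1\<close>
  are sent by \<open>b'\<close> to \<open>b u\<close> and \<open>b (b u)\<close>, so the lost images
  are recovered.\<close>

lemma link_linkable: "linkable k (n + k) (link_a k n a) (link_b k n b u) (Suc (Suc n))"
proof -
  define a' b' where "a' = link_a k n a" and "b' = link_b k n b u"
  define \<tau> where "\<tau> = transpose (b u) (Suc n)"
  have rp: "rot n k permutes {..<n + k}"
    by (rule permutes_subset[OF rot_permutes]) auto
  have ap: "a' permutes {..<n + k}"
    unfolding a'_def link_a_def
    by (rule permutes_compose[OF rp permutes_subset[OF l'(1)]]) auto
  have bp0: "b \<circ> rot n k permutes {..<n + k}"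
    by (rule permutes_compose[OF rp permutes_subset[OF l'(2)]]) auto
  have tp: "\<tau> permutes {..<n + k}"
    unfolding \<tau>_def by (rule permutes_swap_id) (use l' k in auto)
  have bp: "b' permutes {..<n + k}"
    unfolding b'_def link_b_def \<tau>_def[symmetric]
    by (rule permutes_compose[OF permutes_inv[OF tp] permutes_compose[OF bp0 tp]])
  have disj: "{..<n} \<inter> {n..<n + k} = {}" by auto
  have ao: "has_order k a'"
    unfolding a'_def link_a_def
    by (rule has_order_disjoint_comp[OF l'(1) rot_permutes disj l'(3) rot_funpow_id])
  have bo: "has_order k b'"
    unfolding b'_def link_b_def \<tau>_def[symmetric]
    by (rule has_order_conj[OF permutes_bij[OF tp]
          has_order_disjoint_comp[OF l'(2) rot_permutes disj l'(4) rot_funpow_id]])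
  have "transitive_pair {..<n + k} a' b'"
    unfolding transitive_pair_def
  proof (intro allI impI)
    fix S assume S: "S \<subseteq> {..<n + k}" "S \<noteq> {}" "a' ` S \<subseteq> S" "b' ` S \<subseteq> S"
    have aS: "a' x \<in> S" if "x \<in> S" for x using that S by blast
    have bS: "b' x \<in> S" if "x \<in> S" for x using that S by blast
    have rS: "(rot n k ^^ j) x \<in> S" if "x \<in> S" "n \<le> x" for x j
    proof -
      have "(rot n k ^^ j) x \<in> S \<and> n \<le> (rot n k ^^ j) x"
      proof (induction j)
        case 0
        show ?case using that by simp
      next
        case (Suc j)
        then have "rot n k ((rot n k ^^ j) x) \<in> S"
          using aS link_a_apply(2)[of "(rot n k ^^ j) x"] unfolding a'_def by metis
        moreover have "n \<le> rot n k ((rot n k ^^ j) x)"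
          using Suc rot_apply[of n k "(rot n k ^^ j) x"] by (auto split: if_splits)
        ultimately show ?case by simp
      qed
      then show ?thesis by simp
    qed
    have Y: "{n..<n + k} \<subseteq> S" if "x \<in> S" "n \<le> x" for x
    proof
      fix y assume y: "y \<in> {n..<n + k}"
      have x: "x < n + k" using that(1) S by auto
      \<comment> \<open>From \<open>x\<close> the rotation wraps around to \<open>n\<close> after
        \<open>k - (x - n)\<close> steps and needs \<open>y - n\<close> more to reach
        \<open>y\<close>.\<close>
      have "(rot n k ^^ (k - (x - n) + (y - n))) (n + (x - n)) = n + (k - (x - n) + (y - n) + (x - n)) mod k"
        by (rule rot_funpow) (use x that k in auto)
      also have "k - (x - n) + (y - n) + (x - n) = (y - n) + k" using x that by auto
      also have "n + ((y - n) + k) mod k = n + (y - n) mod k" by (simp only: mod_add_self2)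
      also have "\<dots> = y" using y mod_less[of "y - n" k] by auto
      finally show "y \<in> S" using rS[OF that] that(2) by (metis le_add_diff_inverse)
    qed
    have old: "b x \<in> S" if "x \<in> S" "x < n" for x
    proof -
      consider "x = u" | "x = b u" | "x \<noteq> u" "x \<noteq> b u" by blast
      then show ?thesis
      proof cases
        case 1
        then have "Suc n \<in> S" using bS[OF that(1)] link_b_apply(2) unfolding b'_def by simp
        then have "n \<in> S" using Y[of "Suc n"] k by auto
        then show ?thesis using bS[of n] link_b_apply(4) 1 unfolding b'_def by simp
      next
        case 2
        then have "Suc (Suc n) \<in> S" using bS[OF that(1)] link_b_apply(3) unfolding b'_def by simp
        then have "Suc n \<in> S" using Y[of "Suc (Suc n)"] k by auto
        then show ?thesis using bS[of "Suc n"] link_b_apply(5) 2 unfolding b'_def by simp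
      next
        case 3
        then show ?thesis using bS[OF that(1)] link_b_apply(1)[OF that(2)] unfolding b'_def by simp
      qed
    qed
    have "S \<inter> {..<n} \<noteq> {}"
    proof -
      obtain x where x: "x \<in> S" using S by blast
      show ?thesis
      proof (cases "x < n")
        case False
        then have "n \<in> S" using Y[OF x] k by auto
        then have "b u \<in> S" using bS[of n] link_b_apply(4) unfolding b'_def by simp
        then show ?thesis using l'(8) by auto
      qed (use x in auto)
    qed
    moreover have "a ` (S \<inter> {..<n}) \<subseteq> S \<inter> {..<n}"
      using aS link_a_apply(1) permutes_in_image[OF l'(1)] unfolding a'_def by fastforce
    moreover have "b ` (S \<inter> {..<n}) \<subseteq> S \<inter> {..<n}"
      using old permutes_in_image[OF l'(2)] by fastforce
    ultimately have "S \<inter> {..<n} = {..<n}"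
      using l'(5) unfolding transitive_pair_def by (metis inf_le2)
    moreover from this have "Suc n \<in> S"
      using bS[of u] l'(6) link_b_apply(2) unfolding b'_def by auto
    ultimately have "{..<n} \<subseteq> S" "{n..<n + k} \<subseteq> S" using Y[of "Suc n"] by auto
    moreover have "{..<n + k} = {..<n} \<union> {n..<n + k}" by auto
    ultimately show "S = {..<n + k}" using S(1) by blast
  qed
  \<comment> \<open>The next link starts at \<open>n + 2\<close>. Since \<open>k \<ge> 4\<close>,
    both \<open>n + 2\<close> and its image \<open>n + 3\<close> are new points, and the new
    quotient fixes them.\<close>
  moreover have "b' (Suc (Suc n)) \<noteq> Suc (Suc n)"
    using link_b_apply(6)[of "Suc (Suc n)"] k unfolding b'_def by (simp add: rot_apply)
  ultimately show ?thesis
    using ap bp ao bo k unfolding linkable_def a'_def b'_def by simp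
qed

lemma link_quotient:
  defines "t \<equiv> inv' a \<circ> b" and "t' \<equiv> inv' (link_a k n a) \<circ> link_b k n b u"
  shows "x < n \<Longrightarrow> x \<noteq> u \<Longrightarrow> x \<noteq> b u \<Longrightarrow> t' x = t x"
    and "t' u = n" "t' (b u) = Suc n" "t' n = t u" "t' (Suc n) = t (b u)"
    and "Suc (Suc n) \<le> x \<Longrightarrow> t' x = x"
proof -
  have inj: "inj (link_a k n a)"
    using link_linkable permutes_inj unfolding linkable_def by blast
  \<comment> \<open>The value of the quotient at \<open>x\<close> is the \<open>y\<close> with
    \<open>link_a k n a y = link_b k n b u x\<close>, so no inverse has to be computed.\<close>
  have t'I: "t' x = y" if "link_a k n a y = link_b k n b u x" for x y
    using that inv_f_eq[OF inj that] unfolding t'_def by simp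
  have ia: "a (inv' a x) = x" for x using permutes_inverses(1)[OF l'(1)] by simp
  have tn: "t x < n" if "x < n" for x
    using permutes_in_image[OF permutes_compose[OF l'(2) permutes_inv[OF l'(1)]], of x] that
    unfolding t_def by simp
  have at: "link_a k n a (t x) = b x" if "x < n" for x
    using link_a_apply(1)[OF tn[OF that]] ia unfolding t_def by simp
  show "t' x = t x" if "x < n" "x \<noteq> u" "x \<noteq> b u"
    using t'I at that link_b_apply(1) by simp
  show "t' u = n"
    using k by (intro t'I) (simp add: link_b_apply link_a_apply rot_apply)
  show "t' (b u) = Suc n"
    using k by (intro t'I) (simp add: link_b_apply link_a_apply rot_apply)
  show "t' n = t u" by (intro t'I) (simp add: link_b_apply at l')
  show "t' (Suc n) = t (b u)" by (intro t'I) (simp add: link_b_apply at l')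
  show "t' x = x" if "Suc (Suc n) \<le> x"
    using that by (intro t'I) (simp add: link_b_apply link_a_apply)
qed

end

text \<open>The 3-cycle is required to be a word in \<open>(a\<^sup>-\<^sup>1 b)\<^sup>4\<close> and any permutation extending \<open>a\<close>, so that
  it survives all later links: these multiply \<open>a\<^sup>-\<^sup>1 b\<close> by elements of order dividing 4.\<close>

definition chainable :: "nat \<Rightarrow> nat \<Rightarrow> (nat \<Rightarrow> nat) \<Rightarrow> (nat \<Rightarrow> nat) \<Rightarrow> nat \<Rightarrow> bool" where
  "chainable k n a b u \<longleftrightarrow> linkable k n a b u \<and>
     (inv' a \<circ> b) u \<in> {u, b u} \<and> (inv' a \<circ> b) (b u) \<in> {u, b u} \<and>
     (\<exists>x y z. x < n \<and> y < n \<and> z < n \<and> distinct [x, y, z] \<and>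
        (\<forall>A. bij A \<longrightarrow> (\<forall>i<n. A i = a i) \<longrightarrow> cyc3 x y z \<in> perm_span {A, (inv' a \<circ> b) ^^ 4}) \<and>
        (\<exists>p\<in>{x, y, z}. a p \<in> {x, y, z}) \<and>
        (\<exists>p\<in>{x, y, z}. p \<noteq> u \<and> p \<noteq> b u \<and> b p \<in> {x, y, z}))"

lemma chainable_generating_pair:
  assumes "chainable k n a b u"
  shows "generating_pair k {..<n} a b"
proof -
  obtain x y z where xyz: "x < n" "y < n" "z < n" "distinct [x, y, z]"
    and span: "\<And>A. bij A \<Longrightarrow> (\<forall>i<n. A i = a i) \<Longrightarrow> cyc3 x y z \<in> perm_span {A, (inv' a \<circ> b) ^^ 4}"
    and pa: "\<exists>p\<in>{x, y, z}. a p \<in> {x, y, z}" and pb: "\<exists>p\<in>{x, y, z}. b p \<in> {x, y, z}"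
    using assms unfolding chainable_def by metis
  have l: "a permutes {..<n}" "b permutes {..<n}" "has_order k a" "has_order k b"
    "transitive_pair {..<n} a b"
    using assms unfolding chainable_def linkable_def by auto
  have gen: "a \<in> perm_span {a, b}" "b \<in> perm_span {a, b}" by (auto intro: perm_span.gen)
  \<comment> \<open>The case \<open>A = a\<close>; the other generator is a word in \<open>a\<close>
    and \<open>b\<close>.\<close>
  have c: "cyc3 x y z \<in> perm_span {a, b}"
    by (rule perm_span_subset[OF _ span[OF permutes_bij[OF l(1)]]])
      (use gen in \<open>auto intro!: perm_span_funpow perm_span.comp perm_span.inv\<close>)
  have "has_three_cycles (perm_span {a, b}) {..<n}"
    by (rule all_three_cycles_support[OF finite_lessThan l(1,2,5) _ _ _ xyz(4) c pa pb])
      (use xyz in simp_all)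
  then show ?thesis using l unfolding generating_pair_def by simp
qed

lemma chainable_step:
  assumes k: "4 \<le> k" and c: "chainable k n a b u"
  shows "chainable k (n + k) (link_a k n a) (link_b k n b u) (Suc (Suc n))"
proof -
  have l: "linkable k n a b u" using c unfolding chainable_def by blast
  then have l': "a permutes {..<n}" "b permutes {..<n}" "u < n" "b u \<noteq> u"
    unfolding linkable_def by auto
  then have "b u < n" using permutes_in_image[of b "{..<n}" u] by auto
  define t t' where "t = inv' a \<circ> b" and "t' = inv' (link_a k n a) \<circ> link_b k n b u"
  note q = link_quotient[OF k l, folded t_def t'_def]
  obtain x y z where xyz: "x < n" "y < n" "z < n" "distinct [x, y, z]"
    and span: "\<And>A. bij A \<Longrightarrow> (\<forall>i<n. A i = a i) \<Longrightarrow> cyc3 x y z \<in> perm_span {A, t ^^ 4}"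
    and pa: "\<exists>p\<in>{x, y, z}. a p \<in> {x, y, z}"
    and pb: "\<exists>p\<in>{x, y, z}. p \<noteq> u \<and> p \<noteq> b u \<and> b p \<in> {x, y, z}"
    and uv: "t u \<in> {u, b u}" "t (b u) \<in> {u, b u}"
    using c unfolding chainable_def t_def by metis
  have tp: "t permutes {..<n}"
    unfolding t_def by (rule permutes_compose[OF l'(2) permutes_inv[OF l'(1)]])
  have tinj: "t x = t y \<longleftrightarrow> x = y" for x y by (rule inj_eq[OF permutes_inj[OF tp]])
  \<comment> \<open>If \<open>t\<close> fixes \<open>u\<close> and \<open>b u\<close>, then
    \<open>t'\<close> acts on these points together with \<open>n\<close> and \<open>n + 1\<close>
    as two transpositions; if \<open>t\<close> swaps them, as one 4-cycle. Either way the 4th power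
    is trivial there.\<close>
  have uv': "t u = u \<and> t (b u) = b u \<or> t u = b u \<and> t (b u) = u"
    using uv tinj[of u "b u"] l'(4) by auto
  have "(t' ^^ 4) x = (t ^^ 4) x" for x
  proof -
    consider "x < n" "x \<noteq> u" "x \<noteq> b u" | "x \<in> {u, b u, n, Suc n}" | "Suc (Suc n) \<le> x" by force
    then show ?thesis
    proof cases
      case 1
      have "t y \<noteq> u \<and> t y \<noteq> b u" if "y \<noteq> u" "y \<noteq> b u" for y
        using uv' tinj that by metis
      moreover have "t y < n" if "y < n" for y using permutes_in_image[OF tp, of y] that by simp
      ultimately show ?thesis
        using funpow_agree[of "{y. y < n \<and> y \<noteq> u \<and> y \<noteq> b u}" t' t x 4] q(1) 1 by simp
    next
      case 2
      have "t n = n" "t (Suc n) = Suc n" using permutes_not_in[OF tp] by auto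
      then show ?thesis
        using 2 uv' q(2-5) by (auto simp: eval_nat_numeral)
    next
      case 3
      have "t x = x" using permutes_not_in[OF tp, of x] 3 by auto
      then show ?thesis using q(6)[OF 3] by (simp add: eval_nat_numeral)
    qed
  qed
  then have t4: "t' ^^ 4 = t ^^ 4" by blast
  \<comment> \<open>A bijection extending \<open>link_a k n a\<close> also extends \<open>a\<close>,
    so the old property applies to it unchanged.\<close>
  have span': "\<forall>A. bij A \<longrightarrow> (\<forall>i<n + k. A i = link_a k n a i) \<longrightarrow> cyc3 x y z \<in> perm_span {A, t' ^^ 4}"
  proof (intro allI impI)
    fix A assume "bij A" "\<forall>i<n + k. A i = link_a k n a i"
    then show "cyc3 x y z \<in> perm_span {A, t' ^^ 4}"
      unfolding t4 by (intro span) (use link_a_apply[OF k l] in auto)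
  qed
  have pa': "\<exists>p\<in>{x, y, z}. link_a k n a p \<in> {x, y, z}"
    using pa xyz link_a_apply(1)[OF k l] by auto
  have nx: "link_b k n b u (Suc (Suc n)) = Suc (Suc (Suc n))"
    using link_b_apply(6)[OF k l, of "Suc (Suc n)"] k by (simp add: rot_apply)
  \<comment> \<open>The old witness avoids \<open>u\<close> and \<open>b u\<close>, the only points
    below \<open>n\<close> at which \<open>link_b\<close> differs from \<open>b\<close>.\<close>
  have pb': "\<exists>p\<in>{x, y, z}. p \<noteq> Suc (Suc n) \<and> p \<noteq> Suc (Suc (Suc n)) \<and> link_b k n b u p \<in> {x, y, z}"
  proof -
    obtain p where p: "p \<in> {x, y, z}" "p \<noteq> u" "p \<noteq> b u" "b p \<in> {x, y, z}" using pb by blast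
    then have "p < n" using xyz by auto
    then show ?thesis using p link_b_apply(1)[OF k l, of p] by (intro bexI[of _ p]) auto
  qed
  have t': "t' (Suc (Suc n)) \<in> {Suc (Suc n), Suc (Suc (Suc n))}"
    "t' (Suc (Suc (Suc n))) \<in> {Suc (Suc n), Suc (Suc (Suc n))}"
    using q(6) by auto
  have less: "x < n + k" "y < n + k" "z < n + k" using xyz by auto
  show ?thesis
    unfolding chainable_def t'_def[symmetric] nx
    by (intro conjI exI[of _ x] exI[of _ y] exI[of _ z] link_linkable[OF k l] t' less xyz(4) span' pa' pb')
qed

lemma chainable_extend:
  assumes "4 \<le> k" "chainable k n a b u"
  shows "\<exists>a b. generating_pair k {..<n + q * k} a b"
proof -
  have "\<exists>a b u. chainable k (n + q * k) a b u"
  proof (induction q)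
    case 0
    show ?case using assms(2) by auto
  next
    case (Suc q)
    then obtain a b u where "chainable k (n + q * k) a b u" by blast
    from chainable_step[OF assms(1) this] show ?case by (auto simp: ac_simps)
  qed
  then show ?thesis using chainable_generating_pair by blast
qed

lemma cyclic_closed:
  assumes f: "\<And>i. i < k \<Longrightarrow> f (g i) = g (Suc i mod k)" and S: "f ` S \<subseteq> S"
    and i: "i < k" "g i \<in> S" and j: "j < k"
  shows "g j \<in> S"
proof -
  have "g ((i + m) mod k) \<in> S" for m
  proof (induction m)
    case 0
    show ?case using i by simp
  next
    case (Suc m)
    have "f (g ((i + m) mod k)) = g ((i + Suc m) mod k)"
      using f[of "(i + m) mod k"] i(1) by (simp add: mod_Suc_eq)
    then show ?case using Suc S by (metis image_subset_iff)
  qed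
  \<comment> \<open>Only forward steps are allowed, so the walk passes the end of the cycle before
    it reaches \<open>j\<close>.\<close>
  from this[of "k - i + j"] show ?thesis using i(1) j by simp
qed

lemma bij_inv_eq: "bij f \<Longrightarrow> f y = x \<Longrightarrow> inv' f x = y"
  by (metis bij_is_inj inv_f_f)

text \<open>Evaluation at \<open>y (x p)\<close> removes both inverses: the commutator records where
  \<open>x \<circ> y\<close> and \<open>y \<circ> x\<close> disagree.\<close>

lemma commutator_apply:
  assumes "bij x" "bij y"
  shows "(x \<circ> y \<circ> inv' x \<circ> inv' y) (y (x p)) = x (y p)"
  using assms by (simp add: bij_is_inj)

definition shift_swap :: "nat \<Rightarrow> nat set \<Rightarrow> nat \<Rightarrow> nat" where
  "shift_swap k R x = (if x < k \<and> x \<in> R then x + k else if k \<le> x \<and> x - k \<in> R then x - k else x)"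

definition rep_set :: "nat \<Rightarrow> nat set \<Rightarrow> nat set" where
  "rep_set k R = {..<k} \<union> (\<lambda>i. i + k) ` R"

text \<open>The place of the \<open>i\<close>-th point of the second cycle. That cycle shares
  exactly the points of \<open>{..<k} - R\<close> with \<open>rot 0 k\<close>.\<close>

definition rep :: "nat \<Rightarrow> nat set \<Rightarrow> nat \<Rightarrow> nat" where
  "rep k R i = (if i \<in> R then i + k else i)"

section \<open>Two cycles sharing many points\<close>

text \<open>The cycle obtained from \<open>rot 0 k\<close> by replacing each point \<open>i \<in> R\<close> by the new point \<open>i + k\<close>.\<close>

definition rot_rep :: "nat \<Rightarrow> nat set \<Rightarrow> nat \<Rightarrow> nat" where
  "rot_rep k R = shift_swap k R \<circ> rot 0 k \<circ> inv' (shift_swap k R)"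

locale replacement =
  fixes k :: nat and R :: "nat set"
  assumes k: "0 < k" and R: "R \<subseteq> {..<k}"
begin

lemma less: "i \<in> R \<Longrightarrow> i < k"
  using R by auto

lemma shift_swap_invol: "shift_swap k R (shift_swap k R x) = x"
  by (auto simp: shift_swap_def dest: less)

lemma shift_swap_permutes: "shift_swap k R permutes rep_set k R"
proof (rule bij_imp_permutes)
  have "shift_swap k R x \<in> rep_set k R" if "x \<in> rep_set k R" for x
    using that less by (auto simp: shift_swap_def rep_set_def)
  then show "bij_betw (shift_swap k R) (rep_set k R) (rep_set k R)"
    by (intro bij_betwI[where g = "shift_swap k R"]) (auto simp: shift_swap_invol)
  show "shift_swap k R x = x" if "x \<notin> rep_set k R" for x
    using that less by (auto simp: shift_swap_def rep_set_def image_iff)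
qed

lemma bij_shift_swap: "bij (shift_swap k R)"
  by (rule permutes_bij[OF shift_swap_permutes])

lemma inv_shift_swap: "inv' (shift_swap k R) = shift_swap k R"
  by (rule inv_unique_comp) (auto simp: fun_eq_iff shift_swap_invol)

lemma rot_permutes_rep: "rot 0 k permutes rep_set k R"
  by (rule permutes_subset[OF rot_permutes]) (auto simp: rep_set_def)

lemma rot_rep_permutes: "rot_rep k R permutes rep_set k R"
  unfolding rot_rep_def
  by (intro permutes_compose permutes_inv shift_swap_permutes rot_permutes_rep)

lemma rot_rep_has_order: "has_order k (rot_rep k R)"
  unfolding rot_rep_def by (rule has_order_conj[OF bij_shift_swap rot_has_order])

lemma rot_rep_conj: "rot_rep k R ^^ e = shift_swap k R \<circ> rot 0 k ^^ e \<circ> shift_swap k R"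
  using funpow_conj[OF bij_shift_swap, where f = "rot 0 k" and i = e] unfolding rot_rep_def inv_shift_swap .

lemma rot_pow:
  "i < k \<Longrightarrow> (rot 0 k ^^ e) i = (i + e) mod k" "k \<le> x \<Longrightarrow> (rot 0 k ^^ e) x = x"
proof -
  show "(rot 0 k ^^ e) i = (i + e) mod k" if "i < k"
    using rot_funpow[OF that, of e 0] by (simp add: add.commute)
  show "(rot 0 k ^^ e) x = x" if "k \<le> x"
    using permutes_not_in[OF permutes_funpow[OF rot_permutes[of 0 k]], of x] that by simp
qed

lemma rot_rep_pow:
  "i < k \<Longrightarrow> (rot_rep k R ^^ e) (rep k R i) = rep k R ((i + e) mod k)"
  "i \<in> R \<Longrightarrow> (rot_rep k R ^^ e) i = i"
proof -
  have sw: "shift_swap k R (rep k R j) = j" "shift_swap k R j = rep k R j" if "j < k" for j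
    using that by (auto simp: shift_swap_def rep_def)
  show "(rot_rep k R ^^ e) (rep k R i) = rep k R ((i + e) mod k)" if "i < k"
    using that k by (simp add: rot_rep_conj sw rot_pow)
  assume i: "i \<in> R"
  then have "shift_swap k R i = i + k" "shift_swap k R (i + k) = i"
    using less by (auto simp: shift_swap_def)
  then show "(rot_rep k R ^^ e) i = i"
    by (simp add: rot_rep_conj rot_pow)
qed

lemma rot_rep_apply:
  "i < k \<Longrightarrow> rot_rep k R (rep k R i) = rep k R (Suc i mod k)" "i \<in> R \<Longrightarrow> rot_rep k R i = i"
  using rot_rep_pow[of i 1] by simp_all

lemma rot_rep_apply':
  assumes "i < k"
  shows "i \<notin> R \<Longrightarrow> Suc i < k \<Longrightarrow> Suc i \<notin> R \<Longrightarrow> rot_rep k R i = Suc i"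
    "i \<notin> R \<Longrightarrow> Suc i < k \<Longrightarrow> Suc i \<in> R \<Longrightarrow> rot_rep k R i = Suc i + k"
    "i \<in> R \<Longrightarrow> Suc i < k \<Longrightarrow> Suc i \<notin> R \<Longrightarrow> rot_rep k R (i + k) = Suc i"
    "i \<in> R \<Longrightarrow> Suc i < k \<Longrightarrow> Suc i \<in> R \<Longrightarrow> rot_rep k R (i + k) = Suc i + k"
    "i \<notin> R \<Longrightarrow> Suc i = k \<Longrightarrow> 0 \<in> R \<Longrightarrow> rot_rep k R i = k"
    "i \<notin> R \<Longrightarrow> Suc i = k \<Longrightarrow> 0 \<notin> R \<Longrightarrow> rot_rep k R i = 0"
    "i \<in> R \<Longrightarrow> Suc i = k \<Longrightarrow> 0 \<in> R \<Longrightarrow> rot_rep k R (i + k) = k"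
    "i \<in> R \<Longrightarrow> Suc i = k \<Longrightarrow> 0 \<notin> R \<Longrightarrow> rot_rep k R (i + k) = 0"
  using rot_rep_apply(1)[OF assms] by (auto simp: rep_def)

lemma rep_setE:
  assumes "x \<in> rep_set k R"
  obtains i where "i < k" "x = i" | i where "i \<in> R" "x = i + k"
  using assms unfolding rep_set_def by auto

text \<open>Every point lies on one of the two cycles and both pass through \<open>w\<close>. The
  maps \<open>f\<close> and \<open>g\<close> are kept general because the generators with an extra
  transposition act in the same way on these points.\<close>

lemma transitive:
  assumes f: "\<And>i. i < k \<Longrightarrow> f i = Suc i mod k"
    and g: "\<And>i. i < k \<Longrightarrow> g (rep k R i) = rep k R (Suc i mod k)"
    and w: "w < k" "w \<notin> R"
  shows "transitive_pair (rep_set k R) f g"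
  unfolding transitive_pair_def
proof (intro allI impI)
  fix S assume S: "S \<subseteq> rep_set k R" "S \<noteq> {}" "f ` S \<subseteq> S" "g ` S \<subseteq> S"
  have X: "j \<in> S" if "i < k" "i \<in> S" "j < k" for i j
    using cyclic_closed[of k f "\<lambda>i. i", OF f S(3)] that by blast
  have Z: "rep k R j \<in> S" if "i < k" "rep k R i \<in> S" "j < k" for i j
    using cyclic_closed[of k g "rep k R", OF g S(4)] that by blast
  have wS: "w \<in> S"
  proof -
    obtain x where x: "x \<in> S" using S(2) by blast
    then have "x \<in> rep_set k R" using S(1) by blast
    then show ?thesis
    proof (cases rule: rep_setE)
      case (1 i)
      then show ?thesis using X x w by blast
    next
      case (2 i)
      then show ?thesis using Z[of i w] x w less[of i] by (simp add: rep_def)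
    qed
  qed
  have "x \<in> S" if "x \<in> rep_set k R" for x
    using that
  proof (cases rule: rep_setE)
    case (1 i)
    then show ?thesis using X[of w i] wS w by blast
  next
    case (2 i)
    then show ?thesis using Z[of w i] wS w less[of i] by (simp add: rep_def)
  qed
  then show "S = rep_set k R" using S(1) by blast
qed

text \<open>Non-commutation of \<open>rot 0 k ^^ e\<close> and \<open>rot_rep k R ^^ e\<close> occurs only where membership in \<open>R\<close>
  changes along steps of length \<open>e\<close>.\<close>

lemma commutator_rep:
  fixes e
  defines "s \<equiv> (\<lambda>i. (i + e) mod k)"
    and "c \<equiv> rot 0 k ^^ e \<circ> rot_rep k R ^^ e \<circ> inv' (rot 0 k ^^ e) \<circ> inv' (rot_rep k R ^^ e)"
  assumes i: "i < k"
  shows "i \<notin> R \<Longrightarrow> s i \<notin> R \<Longrightarrow> c (rep k R (s (s i))) = s (s i)"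
    "i \<notin> R \<Longrightarrow> s i \<in> R \<Longrightarrow> c (s i) = s i + k"
    "i \<in> R \<Longrightarrow> s i \<in> R \<Longrightarrow> c (s i) = s i"
    "i \<in> R \<Longrightarrow> s i \<in> R \<Longrightarrow> c (s i + k) = s i + k"
    "i \<in> R \<Longrightarrow> s i \<notin> R \<Longrightarrow> c (rep k R (s (s i))) = s i"
    "i \<in> R \<Longrightarrow> s i \<notin> R \<Longrightarrow> c (s i) = s (s i)"
proof -
  define x y where "x = rot 0 k ^^ e" and "y = rot_rep k R ^^ e"
  have bij: "bij x" "bij y"
    unfolding x_def y_def
    by (auto intro!: permutes_bij permutes_funpow rot_permutes rot_rep_permutes)
  \<comment> \<open>Each rule below takes \<open>p = i\<close> or \<open>p = i + k\<close>: its
    argument is \<open>y (x p)\<close> and its value \<open>x (y p)\<close>.\<close>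
  have c: "c (y (x p)) = x (y p)" for p
    unfolding c_def x_def[symmetric] y_def[symmetric] by (rule commutator_apply[OF bij])
  have xs: "x j = s j" "s j < k" if "j < k" for j
    using that k rot_pow(1) unfolding x_def s_def by auto
  have xk: "x (j + k) = j + k" for j using rot_pow(2) unfolding x_def by simp
  have yZ: "y (rep k R j) = rep k R (s j)" if "j < k" for j
    using rot_rep_pow(1)[OF that] unfolding y_def s_def .
  have yR: "y j = j" if "j \<in> R" for j using rot_rep_pow(2)[OF that] unfolding y_def .
  have y1: "y j = rep k R (s j)" if "j < k" "j \<notin> R" for j using yZ[OF that(1)] that(2) by (simp add: rep_def)
  have y2: "y (j + k) = rep k R (s j)" if "j \<in> R" for j using yZ[of j] that less by (simp add: rep_def)
  note si = xs(2)[OF i] and ssi = xs(2)[OF xs(2)[OF i]]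
  show "c (rep k R (s (s i))) = s (s i)" if "i \<notin> R" "s i \<notin> R"
    using c[of i] that i si by (simp add: xs y1 rep_def[of k R "s i"])
  show "c (s i) = s i + k" if "i \<notin> R" "s i \<in> R"
    using c[of i] that i si by (simp add: xs y1 yR rep_def xk)
  show "c (s i) = s i" if "i \<in> R" "s i \<in> R"
    using c[of i] that i si by (simp add: xs yR)
  show "c (s i + k) = s i + k" if "i \<in> R" "s i \<in> R"
    using c[of "i + k"] that i si by (simp add: xk y2 rep_def)
  show "c (rep k R (s (s i))) = s i" if "i \<in> R" "s i \<notin> R"
    using c[of i] that i si by (simp add: xs yR y1)
  show "c (s i) = s (s i)" if "i \<in> R" "s i \<notin> R"
    using c[of "i + k"] that i si by (simp add: xk y2 rep_def xs)
qed

lemma commutator_rep_outside: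
  assumes "x \<notin> rep_set k R"
  shows "(rot 0 k ^^ e \<circ> rot_rep k R ^^ e \<circ> inv' (rot 0 k ^^ e) \<circ> inv' (rot_rep k R ^^ e)) x = x"
proof -
  have "rot 0 k ^^ e \<circ> rot_rep k R ^^ e \<circ> inv' (rot 0 k ^^ e) \<circ> inv' (rot_rep k R ^^ e) permutes rep_set k R"
    by (intro permutes_compose permutes_inv permutes_funpow rot_rep_permutes rot_permutes_rep)
  then show ?thesis using assms by (rule permutes_not_in)
qed

end

lemma rep_set_lessThan: "r \<le> k \<Longrightarrow> rep_set k {..<r} = {..<k + r}"
proof -
  have "(\<lambda>i. i + k) ` {..<r} = {k..<k + r}"
    using image_add_atLeastLessThan'[of k 0 r] by (simp add: add.commute lessThan_atLeast0)
  then show ?thesis unfolding rep_set_def by auto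
qed

lemma commutator_conj_in_span:
  "f \<in> perm_span S \<Longrightarrow> g \<in> perm_span S \<Longrightarrow> f \<circ> g \<circ> inv' f \<circ> inv' g \<in> perm_span S"
  by (intro perm_span.comp perm_span.inv)

text \<open>Membership in the interval \<open>R\<close> changes only at its two ends, so the
  commutator \<open>c\<close> moves no point besides \<open>0\<close>, \<open>k\<close>,
  \<open>r\<close> and \<open>r + 1\<close>. The element \<open>g\<close>, the square of
  \<open>b \<circ> inv' a\<close>, fixes \<open>r + 1\<close> and sends the other three to
  \<open>k + 1\<close>, \<open>k + 2\<close> and \<open>r - 2\<close>. Hence \<open>c\<close> and
  its conjugate by \<open>g\<close> have one common moved point. The bound \<open>3 \<le> r\<close>
  makes \<open>k + 2\<close> a point of the set and keeps \<open>r - 2\<close> away from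
  \<open>0\<close>.\<close>

lemma two_cycles_middle:
  assumes r: "3 \<le> r" "r + 2 \<le> k"
  shows "\<exists>a b. generating_pair k {..<k + r} a b"
proof -
  define R where "R = {..<r}"
  interpret replacement k R
    by unfold_locales (use r in \<open>auto simp: R_def\<close>)
  define a b where "a = rot 0 k" and "b = rot_rep k R"
  have \<Omega>: "rep_set k R = {..<k + r}" using rep_set_lessThan[of r k] r unfolding R_def by simp
  have ap: "a permutes {..<k + r}" and bp: "b permutes {..<k + r}"
    using rot_permutes_rep rot_rep_permutes unfolding a_def b_def \<Omega> by auto
  have bij: "bij a" "bij b" using ap bp permutes_bij by blast+
  have tr: "transitive_pair {..<k + r} a b"
    unfolding \<Omega>[symmetric] a_def b_def
    by (rule transitive[where w = r]) (use r rot_pow(1)[of _ 1] rot_rep_apply in \<open>auto simp: R_def\<close>)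
  define c where "c = a ^^ 1 \<circ> b ^^ 1 \<circ> inv' (a ^^ 1) \<circ> inv' (b ^^ 1)"
  have c_eq: "c = a \<circ> b \<circ> inv' a \<circ> inv' b" unfolding c_def by simp
  have cbij: "bij c" unfolding c_eq by (intro bij_comp bij_imp_bij_inv bij)
  have inR: "i \<in> R \<longleftrightarrow> i < r" for i by (simp add: R_def)
  note cr = commutator_rep[where e = 1, folded a_def b_def, folded c_def, unfolded inR rep_def]
  have c1: "c (Suc r) = r" using cr(5)[of "r - 1"] r by simp
  have cfix: "c q = q" if q: "q \<notin> {0, k, r, Suc r}" for q
  proof -
    consider "0 < q" "q < r" | "r + 2 \<le> q" "q < k" | "k < q" "q < k + r" | "k + r \<le> q"
      using q by force
    then show ?thesis
    proof cases
      case 1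
      then show ?thesis using cr(3)[of "q - 1"] r by simp
    next
      case 2
      then have "Suc (q - 2) = q - 1" "Suc (q - 1) = q" by auto
      then show ?thesis using cr(1)[of "q - 2"] r 2 by (simp add: Suc_diff_Suc)
    next
      case 3
      then show ?thesis using cr(4)[of "q - k - 1"] r by simp
    next
      case 4
      then show ?thesis
        using commutator_rep_outside[of q 1] unfolding \<Omega> c_def a_def b_def by simp
    qed
  qed
  define u where "u = b \<circ> inv' a"
  define g where "g = u \<circ> u"
  have a_app: "a i = Suc i" if "Suc i < k" for i using that by (simp add: a_def rot_apply)
  have a_out: "a i = i" if "k \<le> i" for i using that by (simp add: a_def rot_apply)
  have a_last: "a (k - 1) = 0" using r by (simp add: a_def rot_apply)
  have uI: "u x = b y" if "a y = x" for x y
    using bij_inv_eq[OF bij(1) that] unfolding u_def by simp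
  note br = rot_rep_apply[folded b_def, unfolded inR rep_def]
  have "\<not> k - 1 < r" using r by auto
  then have "u 0 = k" using uI[OF a_last] br(1)[of "k - 1"] r by simp
  moreover have "u k = k + 1" using uI[OF a_out[of k]] br(1)[of 0] r by simp
  moreover have "u (k + 1) = k + 2" using uI[OF a_out[of "k + 1"]] br(1)[of 1] r by simp
  moreover have "u r = r - 1" using uI[of "r - 1" r] a_app[of "r - 1"] br(2)[of "r - 1"] r by simp
  moreover have "u (r - 1) = r - 2"
    using uI[of "r - 2" "r - 1"] a_app[of "r - 2"] br(2)[of "r - 2"] r by (simp add: Suc_diff_Suc)
  moreover have "u (Suc r) = Suc r"
    using uI[of r "Suc r"] a_app[of r] br(1)[of r] r by simp
  ultimately have gv: "g 0 = k + 1" "g k = k + 2" "g r = r - 2" "g (Suc r) = Suc r"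
    unfolding g_def by simp_all
  have gbij: "bij g" unfolding g_def u_def by (intro bij_comp bij_imp_bij_inv bij)
  define h where "h = g \<circ> c \<circ> inv' g"
  have hbij: "bij h" unfolding h_def by (intro bij_comp bij_imp_bij_inv cbij gbij)
  have hg: "h (g x) = g (c x)" for x unfolding h_def using gbij by (simp add: bij_is_inj)
  have h_p: "h (Suc r) = r - 2" using hg[of "Suc r"] gv c1 by simp
  have only: "q = Suc r" if "c q \<noteq> q" "h q \<noteq> q" for q
  proof -
    obtain x where x: "q = g x" using gbij by (metis bij_pointE)
    then have "c x \<noteq> x" using hg[of x] that(2) by metis
    then have "x \<in> {0, k, r, Suc r}" using cfix by blast
    then have "q \<in> {k + 1, k + 2, r - 2, Suc r}" using gv x by auto
    moreover have "q \<in> {0, k, r, Suc r}" using cfix that(1) by blast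
    ultimately show ?thesis using r by auto
  qed
  have ne: "c (Suc r) \<noteq> Suc r" "h (Suc r) \<noteq> Suc r" using c1 h_p by auto
  note comm = commutator_single_intersection[OF cbij hbij ne only, unfolded c1 h_p]
  have span: "a \<in> perm_span {a, b}" "b \<in> perm_span {a, b}" by (auto intro: perm_span.gen)
  have cs: "c \<in> perm_span {a, b}" unfolding c_eq by (rule commutator_conj_in_span[OF span])
  have gs: "g \<in> perm_span {a, b}" unfolding g_def u_def by (intro perm_span.comp perm_span.inv span)
  have hs: "h \<in> perm_span {a, b}" unfolding h_def by (rule perm_span_conj[OF cs gs])
  have cyc: "cyc3 (Suc r) r (r - 2) \<in> perm_span {a, b}"
    using commutator_conj_in_span[OF cs hs] comm(1) by metis
  have "has_three_cycles (perm_span {a, b}) {..<k + r}"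
  proof (rule all_three_cycles_support[OF _ ap bp tr _ _ _ comm(2) cyc])
    show "\<exists>p\<in>{Suc r, r, r - 2}. a p \<in> {Suc r, r, r - 2}"
      using a_app[of r] r by auto
    show "\<exists>p\<in>{Suc r, r, r - 2}. b p \<in> {Suc r, r, r - 2}"
      using br(2)[of "r - 2"] r by auto
  qed (use r in auto)
  then show ?thesis
    using ap bp rot_has_order rot_rep_has_order unfolding generating_pair_def a_def b_def by blast
qed

text \<open>With this a quotient \<open>inv' a \<circ> b\<close> that is itself a 3-cycle meets the
  requirement of \<open>chainable\<close> on its 4th power.\<close>

lemma cyc3_pow4:
  assumes "distinct [x, y, z]"
  shows "cyc3 x y z ^^ 4 = cyc3 x y z"
proof
  fix w
  show "(cyc3 x y z ^^ 4) w = cyc3 x y z w"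
    using assms by (cases "w = x"; cases "w = y"; cases "w = z") (auto simp: eval_nat_numeral cyc3_apply)
qed

lemma generating_pairI:
  assumes "finite \<Omega>" "a permutes \<Omega>" "b permutes \<Omega>" "has_order k a" "has_order k b"
    "transitive_pair \<Omega> a b"
    and "x \<in> \<Omega>" "y \<in> \<Omega>" "z \<in> \<Omega>" "distinct [x, y, z]" "cyc3 x y z \<in> perm_span {a, b}"
    and "\<exists>p\<in>{x, y, z}. a p \<in> {x, y, z}" "\<exists>p\<in>{x, y, z}. b p \<in> {x, y, z}"
  shows "generating_pair k \<Omega> a b"
  unfolding generating_pair_def
  by (intro conjI assms(2-5) all_three_cycles_support[OF assms(1-3,6-13)])

lemma perm_span_quotient: "inv' a \<circ> b \<in> perm_span {a, b}"
  by (intro perm_span.comp perm_span.inv perm_span.gen) auto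

lemma chainableI:
  assumes "linkable k n a b u" "b u = v" "inv' a \<circ> b = t" "t u \<in> {u, v}" "t v \<in> {u, v}"
    and "x < n" "y < n" "z < n" "distinct [x, y, z]"
    and "\<And>A. bij A \<Longrightarrow> (\<And>i. i < n \<Longrightarrow> A i = a i) \<Longrightarrow> cyc3 x y z \<in> perm_span {A, t ^^ 4}"
    and "\<exists>p\<in>{x, y, z}. a p \<in> {x, y, z}"
    and "\<exists>p\<in>{x, y, z}. p \<noteq> u \<and> p \<noteq> v \<and> b p \<in> {x, y, z}"
  shows "chainable k n a b u"
proof -
  have *: "\<forall>A. bij A \<longrightarrow> (\<forall>i<n. A i = a i) \<longrightarrow> cyc3 x y z \<in> perm_span {A, t ^^ 4}"
    using assms(10) by blast
  show ?thesis
    unfolding chainable_def assms(2,3)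
    by (intro conjI exI[of _ x] exI[of _ y] exI[of _ z] * assms(1,4-9,11,12))
qed

text \<open>As \<open>b\<close> is \<open>a\<close> conjugated by the transposition of
  \<open>0\<close> and \<open>1\<close>, the quotient \<open>inv' a \<circ> b\<close> is a product
  of two transpositions, of \<open>k - 1, 0\<close> and of \<open>0, 1\<close>. They share one
  point, so the product is a 3-cycle.\<close>

lemma two_cycles_same_support:
  assumes k: "4 \<le> k"
  shows "\<exists>b. generating_pair k {..<k} (rot 0 k) b \<and> (5 \<le> k \<longrightarrow> chainable k k (rot 0 k) b 2)"
proof -
  define a where "a = rot 0 k"
  define \<tau> where "\<tau> = transpose 0 (1::nat)"
  define b where "b = \<tau> \<circ> a \<circ> inv' \<tau>"
  have ap: "a permutes {..<k}" unfolding a_def using rot_permutes[of 0 k] by (simp add: lessThan_atLeast0)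
  have tp: "\<tau> permutes {..<k}" unfolding \<tau>_def by (rule permutes_swap_id) (use k in auto)
  have bp: "b permutes {..<k}"
    unfolding b_def by (intro permutes_compose permutes_inv tp ap)
  have ao: "has_order k a" unfolding a_def by (rule rot_has_order)
  have bo: "has_order k b" unfolding b_def by (rule has_order_conj[OF permutes_bij[OF tp] ao])
  have a_app: "a x = (if x < k then if Suc x < k then Suc x else 0 else x)" for x
    unfolding a_def rot_apply by simp
  have b_app: "b x = transpose 0 1 (a (transpose 0 1 x))" for x unfolding b_def \<tau>_def by simp
  have bv: "b 0 = 2" "b 1 = 0" "b (k - 1) = 1"
    using k by (auto simp: b_app a_app transpose_def)
  have bj: "b x = a x" if "2 \<le> x" "x \<noteq> k - 1" for x
    using that by (auto simp: b_app a_app transpose_def)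
  have tr: "transitive_pair {..<k} a b"
    unfolding transitive_pair_def
  proof (intro allI impI)
    fix S assume S: "S \<subseteq> {..<k}" "S \<noteq> {}" "a ` S \<subseteq> S" "b ` S \<subseteq> S"
    then obtain i where "i \<in> S" "i < k" by auto
    moreover have "a i = Suc i mod k" if "i < k" for i using that by (simp add: a_app mod_Suc)
    ultimately have "j \<in> S" if "j < k" for j
      using cyclic_closed[of k a "\<lambda>i. i" S i j] S(3) that by blast
    then show "S = {..<k}" using S(1) by auto
  qed
  have d: "distinct [0, 1, k - 1]" using k by auto
  define t where "t = inv' a \<circ> b"
  have tI: "t x = y" if "a y = b x" for x y
    using bij_inv_eq[OF permutes_bij[OF ap] that] unfolding t_def by simp
  have t: "t = cyc3 0 1 (k - 1)"
  proof (rule cyc3_eqI[OF d])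
    show "t 0 = 1" "t 1 = k - 1" "t (k - 1) = 0"
      by (rule tI; use k bv a_app in simp)+
    show "t w = w" if "w \<noteq> 0" "w \<noteq> 1" "w \<noteq> k - 1" for w
      by (rule tI) (use that bj[of w] in auto)
  qed
  have pa: "\<exists>p\<in>{0, 1, k - 1}. a p \<in> {0, 1, k - 1}" using k a_app by auto
  have gp: "generating_pair k {..<k} a b"
  proof (rule generating_pairI[OF finite_lessThan ap bp ao bo tr _ _ _ d])
    show "cyc3 0 1 (k - 1) \<in> perm_span {a, b}"
      using perm_span_quotient[of a b] unfolding t[symmetric] t_def .
  qed (use k bv pa in auto)
  have "chainable k k a b 2" if k5: "5 \<le> k"
  proof -
    \<comment> \<open>The link point is \<open>2\<close>; the bound \<open>5 \<le> k\<close> keeps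
      its image \<open>3\<close> away from the point \<open>k - 1\<close> of the 3-cycle.\<close>
    have b2: "b 2 = 3" using bj[of 2] a_app[of 2] k5 by simp
    have t2: "t 2 = 2" "t 3 = 3" using cyc3_apply(4)[OF d] k5 unfolding t by simp_all
    show ?thesis
    proof (rule chainableI[OF _ b2 t_def[symmetric] _ _ _ _ _ d _ pa])
      show "linkable k k a b 2"
        unfolding linkable_def using ap bp ao bo tr b2 k5 by simp
      show "cyc3 0 1 (k - 1) \<in> perm_span {A, t ^^ 4}" for A
        unfolding t cyc3_pow4[OF d] by (rule perm_span.gen) simp
      show "\<exists>p\<in>{0, 1, k - 1}. p \<noteq> 2 \<and> p \<noteq> 3 \<and> b p \<in> {0, 1, k - 1}"
        using bv by (intro bexI[of _ 1]) auto
    qed (use t2 k5 in auto)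
  qed
  then show ?thesis using gp unfolding a_def by blast
qed

text \<open>Here the conjugating transposition exchanges \<open>0\<close> with the new point
  \<open>k\<close>. The quotient is again a product of two overlapping transpositions, of
  \<open>k - 1, k\<close> and of \<open>0, k\<close>.\<close>

lemma two_cycles_one_new:
  assumes k3: "3 \<le> k"
  shows "\<exists>b. generating_pair k {..<k + 1} (rot 0 k) b \<and> (4 \<le> k \<longrightarrow> chainable k (k + 1) (rot 0 k) b 1)"
proof -
  interpret replacement k "{0}"
    by unfold_locales (use k3 in auto)
  define a b where "a = rot 0 k" and "b = rot_rep k {0}"
  have \<Omega>: "rep_set k {0} = {..<k + 1}" unfolding rep_set_def by auto
  have ap: "a permutes {..<k + 1}" and bp: "b permutes {..<k + 1}"
    using rot_permutes_rep rot_rep_permutes unfolding a_def b_def \<Omega> by auto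
  have ao: "has_order k a" and bo: "has_order k b"
    unfolding a_def b_def by (rule rot_has_order rot_rep_has_order)+
  have tr: "transitive_pair {..<k + 1} a b"
    unfolding \<Omega>[symmetric] a_def b_def
    by (rule transitive[where w = 1]) (use k3 rot_pow(1)[of _ 1] rot_rep_apply in auto)
  have a_app: "a x = (if x < k then if Suc x < k then Suc x else 0 else x)" for x
    unfolding a_def rot_apply by simp
  note br = rot_rep_apply'[folded b_def]
  have bv: "b k = 1" "b 0 = 0" "b (k - 1) = k"
    using br(3)[of 0] rot_rep_apply(2)[of 0, folded b_def] br(5)[of "k - 1"] k3 by auto
  have bj: "b x = a x" if "0 < x" "x \<noteq> k - 1" "x \<noteq> k" for x
  proof (cases "x < k")
    case True
    then show ?thesis using br(1)[of x] that a_app[of x] by auto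
  next
    case False
    then show ?thesis using permutes_not_in[OF bp, of x] that a_app[of x] by auto
  qed
  have d: "distinct [k, 0, k - 1]" using k3 by auto
  define t where "t = inv' a \<circ> b"
  have tI: "t x = y" if "a y = b x" for x y
    using bij_inv_eq[OF permutes_bij[OF ap] that] unfolding t_def by simp
  have t: "t = cyc3 k 0 (k - 1)"
  proof (rule cyc3_eqI[OF d])
    show "t k = 0" "t 0 = k - 1" "t (k - 1) = k"
      by (rule tI; use k3 bv a_app in simp)+
    show "t w = w" if "w \<noteq> k" "w \<noteq> 0" "w \<noteq> k - 1" for w
      by (rule tI) (use that bj[of w] in auto)
  qed
  have pa: "\<exists>p\<in>{k, 0, k - 1}. a p \<in> {k, 0, k - 1}" using k3 a_app by auto
  have gp: "generating_pair k {..<k + 1} a b"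
  proof (rule generating_pairI[OF finite_lessThan ap bp ao bo tr _ _ _ d])
    show "cyc3 k 0 (k - 1) \<in> perm_span {a, b}"
      using perm_span_quotient[of a b] unfolding t[symmetric] t_def .
  qed (use k3 bv pa in auto)
  have "chainable k (k + 1) a b 1" if k4: "4 \<le> k"
  proof -
    have b1: "b 1 = 2" using bj[of 1] a_app[of 1] k4 by simp
    have t1: "t 1 = 1" "t 2 = 2" using cyc3_apply(4)[OF d] k4 unfolding t by simp_all
    show ?thesis
    proof (rule chainableI[OF _ b1 t_def[symmetric] _ _ _ _ _ d _ pa])
      show "linkable k (k + 1) a b 1"
        unfolding linkable_def using ap bp ao bo tr b1 k4 by simp
      show "cyc3 k 0 (k - 1) \<in> perm_span {A, t ^^ 4}" for A
        unfolding t cyc3_pow4[OF d] by (rule perm_span.gen) simp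
      show "\<exists>p\<in>{k, 0, k - 1}. p \<noteq> 1 \<and> p \<noteq> 2 \<and> b p \<in> {k, 0, k - 1}"
        using bv by (intro bexI[of _ 0]) auto
    qed (use t1 k4 in auto)
  qed
  then show ?thesis using gp unfolding a_def by blast
qed

text \<open>The factor \<open>transpose 0 k\<close> of the conjugator produces the 3-cycle as for
  one new point. The factor \<open>cyc3 2 3 (k + 1)\<close> brings in the second new point and
  contributes only the transpositions of \<open>1, 2\<close> and of \<open>3, k + 1\<close>, which
  vanish in the 4th power. The link point \<open>3\<close> has image \<open>k + 1\<close>, so this
  is the case where the quotient swaps the two link points.\<close>

lemma two_cycles_two_new:
  assumes k: "5 \<le> k"
  shows "\<exists>b. chainable k (k + 2) (rot 0 k) b 3"
proof -
  define a where "a = rot 0 k"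
  define \<pi> where "\<pi> = transpose 0 k \<circ> cyc3 2 3 (k + 1)"
  define b where "b = \<pi> \<circ> a \<circ> inv' \<pi>"
  have d0: "distinct [2, 3, k + 1]" using k by auto
  have ap: "a permutes {..<k + 2}"
    unfolding a_def by (rule permutes_subset[OF rot_permutes]) auto
  have "cyc3 2 3 (k + 1) permutes {..<k + 2}"
    using permutes_subset[OF cycle_permutes[of "[2, 3, k + 1]"], of "{..<k + 2}"] cyc3_cycle_of_list[OF d0] k
    by auto
  moreover have "transpose 0 k permutes {..<k + 2}" by (rule permutes_swap_id) auto
  ultimately have pp: "\<pi> permutes {..<k + 2}" unfolding \<pi>_def by (intro permutes_compose)
  have bp: "b permutes {..<k + 2}"
    unfolding b_def by (intro permutes_compose permutes_inv pp ap)
  have ao: "has_order k a" unfolding a_def by (rule rot_has_order)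
  have bo: "has_order k b" unfolding b_def by (rule has_order_conj[OF permutes_bij[OF pp] ao])
  have a_app: "a x = (if x < k then if Suc x < k then Suc x else 0 else x)" for x
    unfolding a_def rot_apply by simp
  have pv: "\<pi> 0 = k" "\<pi> k = 0" "\<pi> 2 = 3" "\<pi> 3 = k + 1" "\<pi> (k + 1) = 2"
    "x \<noteq> 0 \<Longrightarrow> x \<noteq> 2 \<Longrightarrow> x \<noteq> 3 \<Longrightarrow> x \<noteq> k \<Longrightarrow> x \<noteq> k + 1 \<Longrightarrow> \<pi> x = x" for x
    using k by (auto simp: \<pi>_def cyc3_def transpose_def)
  have b_app: "b (\<pi> x) = \<pi> (a x)" for x
    unfolding b_def using permutes_inj[OF pp] by simp
  have b4: "b (k + 1) = 4" using b_app[of 3] pv k by (simp add: a_app)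
  have av: "a 0 = 1" "a k = k" "a 1 = 2" "a (k + 1) = k + 1" "a 2 = 3" "a (k - 1) = 0"
    using k by (auto simp: a_app)
  have "\<pi> 1 = 1" "\<pi> (k - 1) = k - 1" using pv(6)[of 1] pv(6)[of "k - 1"] k by auto
  then have bv: "b k = 1" "b 0 = 0" "b 1 = 3" "b 2 = 2" "b 3 = k + 1" "b (k - 1) = k"
    using b_app[of 0] b_app[of k] b_app[of 1] b_app[of "k + 1"] b_app[of 2] b_app[of "k - 1"]
    unfolding av pv(1-5) by simp_all
  have bj: "b x = a x" if "4 \<le> x" "x \<noteq> k - 1" "x \<noteq> k" "x \<noteq> k + 1" for x
    using b_app[of x] pv(6)[of x] pv(6)[of "a x"] that by (auto simp: a_app)
  have tr: "transitive_pair {..<k + 2} a b"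
    unfolding transitive_pair_def
  proof (intro allI impI)
    fix S assume S: "S \<subseteq> {..<k + 2}" "S \<noteq> {}" "a ` S \<subseteq> S" "b ` S \<subseteq> S"
    have bS: "b x \<in> S" if "x \<in> S" for x using that S(4) by auto
    obtain x where x: "x \<in> S" using S by blast
    then have "x < k + 2" using S(1) by blast
    then consider "x < k" | "x = k" | "x = k + 1" by linarith
    then have "\<exists>i\<in>S. i < k"
    proof cases
      case 2
      then show ?thesis using bS[OF x] bv k by (intro bexI[of _ 1]) auto
    next
      case 3
      then show ?thesis using bS[OF x] b4 k by (intro bexI[of _ 4]) auto
    qed (use x in auto)
    then obtain i where "i \<in> S" "i < k" by auto
    moreover have "a i = Suc i mod k" if "i < k" for i using that by (simp add: a_app mod_Suc)
    ultimately have j: "j \<in> S" if "j < k" for j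
      using cyclic_closed[of k a "\<lambda>i. i" S i j] S(3) that by blast
    have "k \<in> S" "k + 1 \<in> S"
      using bS[OF j[of "k - 1"]] bS[OF j[of 3]] bv k by auto
    then have "y \<in> S" if "y < k + 2" for y
      using j[of y] that by (cases "y < k"; cases "y = k") (auto simp: less_Suc_eq)
    then show "S = {..<k + 2}" using S(1) by auto
  qed
  define t where "t = inv' a \<circ> b"
  have tI: "t x = y" if "a y = b x" for x y
    using bij_inv_eq[OF permutes_bij[OF ap] that] unfolding t_def by simp
  have tv: "t k = 0" "t 0 = k - 1" "t (k - 1) = k" "t 1 = 2" "t 2 = 1" "t 3 = k + 1" "t (k + 1) = 3"
    by (rule tI; use k bv b4 a_app in simp)+
  have tj: "t x = x" if "4 \<le> x" "x \<noteq> k - 1" "x \<noteq> k" "x \<noteq> k + 1" for x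
    by (rule tI) (use that bj[of x] in auto)
  have d: "distinct [k, 0, k - 1]" using k by auto
  have t4: "t ^^ 4 = cyc3 k 0 (k - 1)"
  proof (rule cyc3_eqI[OF d])
    show "(t ^^ 4) k = 0" "(t ^^ 4) 0 = k - 1" "(t ^^ 4) (k - 1) = k"
      using tv by (simp_all add: eval_nat_numeral)
    fix w assume w: "w \<noteq> k" "w \<noteq> 0" "w \<noteq> k - 1"
    consider "w = 1" | "w = 2" | "w = 3" | "w = k + 1" | "4 \<le> w" "w \<noteq> k + 1" using w by linarith
    then show "(t ^^ 4) w = w"
    proof cases
      case 5
      then show ?thesis using tj[of w] w by (simp add: eval_nat_numeral)
    qed (use tv in \<open>auto simp: eval_nat_numeral\<close>)
  qed
  have "chainable k (k + 2) a b 3"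
  proof (rule chainableI[OF _ bv(5) t_def[symmetric] _ _ _ _ _ d])
    show "linkable k (k + 2) a b 3"
      unfolding linkable_def using ap bp ao bo tr bv k by simp
    show "cyc3 k 0 (k - 1) \<in> perm_span {A, t ^^ 4}" for A
      unfolding t4 by (rule perm_span.gen) simp
    show "\<exists>p\<in>{k, 0, k - 1}. a p \<in> {k, 0, k - 1}" using k a_app by auto
    show "\<exists>p\<in>{k, 0, k - 1}. p \<noteq> 3 \<and> p \<noteq> k + 1 \<and> b p \<in> {k, 0, k - 1}"
      using bv by (intro bexI[of _ 0]) auto
  qed (use tv in auto)
  then show ?thesis unfolding a_def by blast
qed

lemma funpow_fixed: "f x = x \<Longrightarrow> (f ^^ i) x = x"
  by (induction i) auto

text \<open>For \<open>r = k - 1\<close> the quotient of the two cycles is one cycle through all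
  points, so no two points are fixed or swapped as \<open>chainable\<close> demands. The first link
  is therefore part of the base. Made at \<open>k\<close> and \<open>k + 1\<close>, it lengthens the
  long cycle of the quotient by two, and its new cycle supplies the fixed points
  \<open>n + 2\<close> and \<open>n + 3\<close> for the links to come.\<close>

lemma chainable_many_new:
  assumes r: "3 \<le> r" "r < k"
  shows "\<exists>a b. chainable k (k + r + k) a b (k + r + 2)"
proof -
  define R where "R = {..<r}"
  interpret replacement k R
    by unfold_locales (use r in \<open>auto simp: R_def\<close>)
  define n where "n = k + r"
  define a0 b0 where "a0 = rot 0 k" and "b0 = rot_rep k R"
  have k4: "4 \<le> k" using r by simp
  have \<Omega>: "rep_set k R = {..<n}" using rep_set_lessThan[of r k] r unfolding R_def n_def by simp
  have ap: "a0 permutes {..<n}" and bp: "b0 permutes {..<n}"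
    using rot_permutes_rep rot_rep_permutes unfolding a0_def b0_def \<Omega> by auto
  have inR: "i \<in> R \<longleftrightarrow> i < r" for i by (simp add: R_def)
  have tr: "transitive_pair {..<n} a0 b0"
    unfolding \<Omega>[symmetric] a0_def b0_def
    by (rule transitive[where w = r]) (use r rot_pow(1)[of _ 1] rot_rep_apply in \<open>auto simp: R_def\<close>)
  note br = rot_rep_apply'[folded b0_def, unfolded inR]
  have a_app: "a0 x = (if x < k then if Suc x < k then Suc x else 0 else x)" for x
    unfolding a0_def rot_apply by simp
  have bk: "b0 k = k + 1" using br(4)[of 0] r by simp
  have link: "linkable k n a0 b0 k"
    unfolding linkable_def using ap bp tr rot_has_order rot_rep_has_order bk r
    by (simp add: a0_def b0_def n_def)
  define a b where "a = link_a k n a0" and "b = link_b k n b0 k"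
  define t where "t = inv' a \<circ> b"
  have bij0: "bij a0" by (rule permutes_bij[OF ap])
  have t0: "(inv' a0 \<circ> b0) x = y" if "a0 y = b0 x" for x y
    using bij_inv_eq[OF bij0 that] by simp
  have bR: "b0 i = i" if "i < r" for i
    using rot_rep_apply(2)[of i] that unfolding inR b0_def by simp
  note q = link_quotient[OF k4 link, folded a_def b_def, folded t_def, unfolded bk]
  have tF: "t (k + j) = k + j + 1" if "2 \<le> j" "j + 1 < r" for j
  proof -
    have "(inv' a0 \<circ> b0) (k + j) = k + j + 1"
      by (rule t0) (use br(4)[of j] that r in \<open>simp add: a_app add.commute\<close>)
    then show ?thesis using q(1)[of "k + j"] that by (simp add: n_def)
  qed
  have tFlast: "t (k + r - 1) = r - 1"
  proof -
    have "(inv' a0 \<circ> b0) (k + r - 1) = r - 1"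
      by (rule t0) (use br(3)[of "r - 1"] r in \<open>simp add: a_app add.commute\<close>)
    then show ?thesis using q(1)[of "k + r - 1"] r by (simp add: n_def)
  qed
  have tX: "t j = j - 1" if "0 < j" "j < r" for j
  proof -
    have "(inv' a0 \<circ> b0) j = j - 1"
      by (rule t0) (use bR[of j] that r in \<open>simp add: a_app\<close>)
    then show ?thesis using q(1)[of j] that r by (simp add: n_def)
  qed
  have t_0: "t 0 = k - 1"
  proof -
    have "(inv' a0 \<circ> b0) 0 = k - 1"
      by (rule t0) (use bR[of 0] r in \<open>simp add: a_app\<close>)
    then show ?thesis using q(1)[of 0] r by (simp add: n_def)
  qed
  have t_last: "t (k - 1) = k"
  proof -
    have "(inv' a0 \<circ> b0) (k - 1) = k"
      by (rule t0) (use br(5)[of "k - 1"] r in \<open>auto simp: a_app\<close>)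
    then show ?thesis using q(1)[of "k - 1"] r by (simp add: n_def)
  qed
  have tmid: "t j = j" if "r \<le> j" "j < k - 1" for j
  proof -
    have "(inv' a0 \<circ> b0) j = j"
      by (rule t0) (use br(1)[of j] that r in \<open>auto simp: a_app\<close>)
    then show ?thesis using q(1)[of j] that r by (simp add: n_def)
  qed
  have t_k: "t k = n" "t n = k + 1" "t (k + 1) = n + 1"
  proof -
    have "(inv' a0 \<circ> b0) k = k + 1"
      by (rule t0) (use bk r in \<open>simp add: a_app\<close>)
    then show "t k = n" "t n = k + 1" "t (k + 1) = n + 1" using q(2,3,4) by simp_all
  qed
  have t_n1: "t (n + 1) = k + 2"
  proof -
    have "(inv' a0 \<circ> b0) (k + 1) = k + 2"
      by (rule t0) (use br(4)[of 1] r in \<open>simp add: a_app\<close>)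
    then show ?thesis using q(5) by simp
  qed
  note t_S = t_k[simplified] t_n1[simplified]
  have t_out: "t x = x" if "n + 2 \<le> x" for x using q(6)[of x] that by simp
  have lnk: "linkable k (n + k) a b (Suc (Suc n))"
    unfolding a_def b_def by (rule link_linkable[OF k4 link])
  then have ap': "a permutes {..<n + k}" and bp': "b permutes {..<n + k}" unfolding linkable_def by auto
  have tp: "t permutes {..<n + k}" unfolding t_def by (intro permutes_compose permutes_inv ap' bp')
  have tbij: "bij t" by (rule permutes_bij[OF tp])
  have it: "inv' t x = y" if "t y = x" for x y by (rule bij_inv_eq[OF tbij that])
  have a_old: "a x = a0 x" if "x < n" for x using link_a_apply(1)[OF k4 link that] unfolding a_def .
  have a_new: "a x = (if Suc x < n + k then Suc x else n)" if "n \<le> x" "x < n + k" for x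
    using link_a_apply(2)[OF k4 link that(1)] that(2) that(1) unfolding a_def rot_apply by simp

  text \<open>\<open>t\<close> is a cycle of odd length \<open>2 r + 3\<close> passing through
    \<open>k, n, k + 1, n + 1, k + 2, \<dots>, k + r - 1, r - 1, \<dots>, 0, k - 1\<close>.\<close>
  define N where "N = 2 * r + 3"
  have p4: "(t ^^ 4) k = k + 2" using t_k t_n1 by (simp add: eval_nat_numeral)
  have pF: "(t ^^ (4 + i)) k = k + 2 + i" if "i + 3 \<le> r" for i
    using that
  proof (induction i)
    case (Suc i)
    have "(t ^^ (4 + Suc i)) k = t ((t ^^ (4 + i)) k)"
      by (simp only: add_Suc_right funpow.simps comp_apply)
    also have "\<dots> = t (k + (2 + i))" using Suc by (simp add: add.assoc)
    also have "\<dots> = k + (2 + i) + 1" by (rule tF) (use Suc in auto)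
    finally show ?case by simp
  qed (use p4 in simp)
  have pX: "(t ^^ (r + 2 + i)) k = r - 1 - i" if "i < r" for i
    using that
  proof (induction i)
    case 0
    have "(t ^^ (r + 1)) k = k + r - 1" using pF[of "r - 3"] r by simp
    moreover have "(t ^^ (r + 2)) k = t ((t ^^ (r + 1)) k)" by simp
    ultimately show ?case using tFlast by simp
  next
    case (Suc i)
    have "(t ^^ (r + 2 + Suc i)) k = t ((t ^^ (r + 2 + i)) k)"
      by (simp only: add_Suc_right funpow.simps comp_apply)
    also have "\<dots> = t (r - 1 - i)" using Suc by simp
    also have "\<dots> = r - 1 - i - 1" by (rule tX) (use Suc in auto)
    finally show ?case by simp
  qed
  have p0: "(t ^^ (2 * r + 1)) k = 0" using pX[of "r - 1"] r by (simp add: mult_2)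
  have pl: "(t ^^ (2 * r + 2)) k = k - 1"
  proof -
    have "(t ^^ (2 * r + 2)) k = t ((t ^^ (2 * r + 1)) k)" by simp
    then show ?thesis using p0 t_0 by simp
  qed
  have pN: "(t ^^ N) k = k"
  proof -
    have "(t ^^ N) k = t ((t ^^ (2 * r + 2)) k)" by (simp add: N_def eval_nat_numeral)
    then show ?thesis using pl t_last by simp
  qed
  have tN: "t ^^ N = id"
  proof
    fix x
    have orb: "(t ^^ N) ((t ^^ i) k) = (t ^^ i) k" for i
      using pN by (metis add.commute comp_apply funpow_add)
    have "t x = x \<or> (\<exists>i. x = (t ^^ i) k)"
    proof -
      consider "x < r" | "r \<le> x" "x < k - 1" | "x = k - 1" | "x = k" | "x = k + 1" | "k + 2 \<le> x" "x < n"
        | "x = n" | "x = n + 1" | "n + 2 \<le> x"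
        by linarith
      then show ?thesis
      proof cases
        case 1
        then have "r - 1 - (r - 1 - x) = x" "r - 1 - x < r" by auto
        then show ?thesis using pX[of "r - 1 - x"] by metis
      next
        case 6
        then have "k + 2 + (x - k - 2) = x" "x - k - 2 + 3 \<le> r" by (auto simp: n_def)
        then show ?thesis using pF[of "x - k - 2"] by metis
      next
        case 4
        then have "x = (t ^^ 0) k" by simp
        then show ?thesis by blast
      next
        case 5
        then have "x = (t ^^ 2) k" using t_k by (simp add: eval_nat_numeral)
        then show ?thesis by blast
      next
        case 7
        then have "x = (t ^^ 1) k" using t_k by simp
        then show ?thesis by blast
      next
        case 8
        then have "x = (t ^^ 3) k" using t_k by (simp add: eval_nat_numeral)
        then show ?thesis by blast
      next
        case 3
        then show ?thesis using pl by metis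
      qed (use tmid t_out in auto)
    qed
    then show "(t ^^ N) x = id x"
    proof
      assume "t x = x"
      then show ?thesis using funpow_fixed[of t x N] by simp
    next
      assume "\<exists>i. x = (t ^^ i) k"
      then obtain i where "x = (t ^^ i) k" by blast
      then show ?thesis using orb[of i] by simp
    qed
  qed
  have t_span: "t \<in> perm_span {A, t ^^ 4}" for A
  proof -
    \<comment> \<open>As \<open>N\<close> is odd, 4 is invertible modulo \<open>N\<close>, so
      \<open>t\<close> is a power of \<open>t ^^ 4\<close>. The multiple of \<open>N\<close> to add
      is 1 or 3, according to \<open>N\<close> modulo 4.\<close>
    obtain m j where mj: "4 * m = 1 + N * j"
    proof (cases "even r")
      case True
      then obtain i where "r = 2 * i" by blast
      then have "4 * (i + 1) = 1 + N * 1" by (simp add: N_def)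
      then show ?thesis using that by blast
    next
      case False
      then obtain i where "r = 2 * i + 1" by (elim oddE)
      then have "4 * (3 * i + 4) = 1 + N * 3" by (simp add: N_def)
      then show ?thesis using that by blast
    qed
    have "(t ^^ 4) ^^ m = t ^^ (1 + N * j)" unfolding mj[symmetric] by (rule funpow_mult)
    also have "\<dots> = t \<circ> (t ^^ N) ^^ j" by (simp only: plus_1_eq_Suc funpow.simps funpow_mult)
    also have "\<dots> = t" unfolding tN id_funpow by simp
    finally have "t = (t ^^ 4) ^^ m" by simp
    moreover have "(t ^^ 4) ^^ m \<in> perm_span {A, t ^^ 4}"
      by (intro perm_span_funpow perm_span.gen) simp
    ultimately show ?thesis by metis
  qed
  define P where "P = {k, k + 1, n + 2, n + 1, n}"
  have cyc: "cyc3 (n + 2) (n + 1) 0 \<in> perm_span {A, t ^^ 4}"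
    if A: "bij A" "\<And>i. i < n + k \<Longrightarrow> A i = a i" for A
  proof -
    define c where "c = inv' t \<circ> A \<circ> t \<circ> inv' A"
    have cbij: "bij c" unfolding c_def by (intro bij_comp bij_imp_bij_inv tbij A(1))
    \<comment> \<open>All values of \<open>c\<close> are computed from this equation, by writing the
      argument as \<open>A w\<close>.\<close>
    have cI: "c (A w) = y" if "t y = A (t w)" for w y
      using it[OF that] A(1) unfolding c_def by (simp add: bij_is_inj)
    \<comment> \<open>On \<open>{..<n + k}\<close> the bijection \<open>A\<close> agrees with a
      permutation of that set, so nothing from outside is mapped into it.\<close>
    have Aout: "n + k \<le> A w" if "n + k \<le> w" for w
    proof (rule ccontr)
      assume "\<not> n + k \<le> A w"
      then have "inv' a (A w) < n + k" "a (inv' a (A w)) = A w"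
        using permutes_in_image[OF permutes_inv[OF ap'], of "A w"] permutes_inverses(1)[OF ap'] by auto
      then have "A (inv' a (A w)) = A w" using A(2) by simp
      then have "inv' a (A w) = w" using A(1) by (simp add: bij_is_inj inj_eq)
      then show False using \<open>inv' a (A w) < n + k\<close> that by simp
    qed
    have Aold: "A x = a0 x" if "x < n" for x using that A(2)[of x] a_old[of x] by simp
    have Anew: "A x = (if Suc x < n + k then Suc x else n)" if "n \<le> x" "x < n + k" for x
      using that A(2)[of x] a_new[of x] by simp
    have Av: "A k = k" "A (k + 1) = k + 1" "A (k + 2) = k + 2" "A n = n + 1" "A (n + 1) = n + 2"
      "A (n + k - 1) = n" "A (k - 1) = 0" "A (r - 1) = r" "A (k + r - 1) = k + r - 1"
      using r by (auto simp: Aold Anew a_app n_def)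
    note Av = Av Av[simplified]
    have t_y: "t (n + 2) = n + 2" "t (n + k - 1) = n + k - 1" using t_out k4 by auto
    note t_y = t_y t_y[simplified]
    have c1: "c k = k + 1" using cI[of "k + 1" k] by (simp add: t_k t_S Av)
    have c2: "c (k + 1) = n + 2" using cI[of "n + 2" "k + 1"] by (simp add: t_k t_S Av t_y)
    have c3: "c (n + 2) = n + 1" using cI[of "n + 1" "n + 1"] by (simp add: t_S Av)
    have c4: "c (n + 1) = n" using cI[of n n] by (simp add: t_k t_S Av)
    have c5: "c n = k" using cI[of k "n + k - 1"] by (simp add: t_y Av t_k t_S)
    have tr1: "t (r - 1) = r - 2" using tX[of "r - 1"] r by (simp add: numeral_2_eq_2)
    have Ar: "A (r - 2) = r - 1" using r by (auto simp: Aold n_def a_app)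
    note tr1 = tr1 tr1[simplified] and tFl = tFlast tFlast[simplified] and tl = t_last t_last[simplified]
    have d1: "c r = k + r - 1"
      using cI[of "k + r - 1" "r - 1"] by (simp add: tr1 Ar Av tFl)
    have d2: "c 0 = k - 1" using cI[of "k - 1" "k - 1"] by (simp add: tl Av)
    have d3: "c (k + r - 1) = r \<and> c (k - 1) = 0" if "r < k - 1"
    proof -
      have "t r = r" "t (k - 2) = k - 2" using tmid that by auto
      moreover have "A (k - 2) = k - 1" using that by (auto simp: Aold n_def a_app)
      ultimately show ?thesis
        using cI[of r "k + r - 1"] cI[of 0 "k - 2"] by (simp add: tFl Av t_0)
    qed
    have d4: "c (k + r - 1) = 0" if "r = k - 1"
    proof -
      have "t 0 = A (t (k + r - 1))" unfolding tFlast t_0 Av(8) using that by simp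
      then show ?thesis using cI[of 0 "k + r - 1"] Av(9) by metis
    qed
    \<comment> \<open>Besides a 5-cycle on \<open>P\<close>, the commutator \<open>c\<close> moves
      only \<open>Q\<close>: by two transpositions if \<open>r < k - 1\<close>, and by one 3-cycle
      if \<open>r = k - 1\<close>, where two of the listed points coincide.\<close>
    define Q where "Q = {k + r - 1, r, 0, k - 1}"
    have cfix: "c x = x" if "x \<notin> P" "x \<notin> Q" for x
    proof -
      obtain w where w: "x = A w" using A(1) by (metis bij_pointE)
      have "w < r - 1 \<or> w = r - 1 \<or> r \<le> w \<and> w < k - 2 \<or> r \<le> w \<and> w = k - 2 \<or> w = k - 1" if "w < k"
        using that r by arith
      moreover have "w = k \<or> w = k + 1 \<or> k + 2 \<le> w \<and> w < k + r - 1 \<or> w = k + r - 1" if "k \<le> w" "w < n"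
        using that unfolding n_def by arith
      moreover have "w = n \<or> w = n + 1 \<or> n + 2 \<le> w \<and> w < n + k - 1 \<or> w = n + k - 1 \<or> n + k \<le> w"
        if "n \<le> w"
        using that by arith
      ultimately consider "w < r - 1" | "w = r - 1" | "r \<le> w" "w < k - 2" | "r \<le> w" "w = k - 2" | "w = k - 1"
        | "w = k" | "w = k + 1" | "k + 2 \<le> w" "w < k + r - 1" | "w = k + r - 1"
        | "w = n" | "w = n + 1" | "n + 2 \<le> w" "w < n + k - 1" | "w = n + k - 1" | "n + k \<le> w"
        by (metis not_less)
      then show ?thesis
      proof cases
        case 1
        then have x: "x = Suc w" using w r by (simp add: Aold n_def a_app)
        show ?thesis
        proof (cases "w = 0")
          case True
          then show ?thesis using cI[of 1 0] w x tX[of 1] r by (simp add: t_0 Av)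
        next
          case False
          then have "t w = w - 1" using tX[of w] 1 by simp
          moreover have "w - 1 < k" "w < k" using 1 r by auto
          ultimately have "A (t w) = w" using False by (simp add: Aold n_def a_app)
          then show ?thesis using cI[of "Suc w" w] tX[of "Suc w"] 1 w x by simp
        qed
      next
        case 2
        then show ?thesis using w that Av by (simp add: Q_def)
      next
        case 3
        then have "x = Suc w" using w by (simp add: Aold n_def a_app)
        then show ?thesis using cI[of "Suc w" w] tmid[of w] tmid[of "Suc w"] 3 w by simp
      next
        case 4
        then have "x = k - 1" using w r by (auto simp: Aold n_def a_app)
        then show ?thesis using that by (simp add: Q_def)
      next
        case 8
        then have tw: "t w = Suc w" using tF[of "w - k"] by simp
        have "A w = w" "A (Suc w) = Suc w" using 8 by (simp_all add: Aold n_def a_app)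
        then show ?thesis using cI[of w w] tw w by simp
      next
        case 12
        then have "x = Suc w" using w by (simp add: Anew)
        then show ?thesis using cI[of "Suc w" w] t_out[of w] t_out[of "Suc w"] 12 w by simp
      next
        case 14
        then show ?thesis using cI[of x w] t_out[of w] t_out[of x] Aout[of w] w k4 by simp
      qed (use w that Av(1-9) in \<open>simp_all add: P_def Q_def\<close>)
    qed
    \<comment> \<open>The exponent is 1 modulo 5 and divisible by 2 and 3, so it keeps the 5-cycle
      on \<open>P\<close> and kills the action on \<open>Q\<close> in both cases.\<close>
    define E where "E = c ^^ 6"
    have E_P: "E k = k + 1" "E (k + 1) = n + 2" "E (n + 2) = n + 1" "E (n + 1) = n" "E n = k"
      unfolding E_def using c1 c2 c3 c4 c5 by (simp_all add: eval_nat_numeral)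
    have Efix: "E x = x" if "x \<notin> P" for x
    proof (cases "x \<in> Q")
      case False
      show ?thesis unfolding E_def by (rule funpow_fixed) (rule cfix[OF that False])
    next
      case True
      have c6: "E x = c (c (c (c (c (c x)))))" for x
        unfolding E_def by (simp add: eval_nat_numeral)
      show ?thesis
      proof (cases "r = k - 1")
        case True
        then have e: "c (k - 1) = k + r - 1" using d1 by simp
        have "x = k + r - 1 \<or> x = 0 \<or> x = k - 1" using \<open>x \<in> Q\<close> True by (auto simp: Q_def)
        then show ?thesis
          unfolding c6 by (elim disjE) (simp_all only: e d2 d4[OF True])
      next
        case False
        then have "r < k - 1" using r by auto
        note d3' = conjunct1[OF d3[OF this]] conjunct2[OF d3[OF this]]
        have "x = k + r - 1 \<or> x = r \<or> x = 0 \<or> x = k - 1" using \<open>x \<in> Q\<close> by (auto simp: Q_def)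
        then show ?thesis
          unfolding c6 by (elim disjE) (simp_all only: d1 d2 d3')
      qed
    qed
    have Ebij: "bij E" unfolding E_def by (rule bij_fn[OF cbij])
    \<comment> \<open>The points of \<open>P\<close> other than \<open>n + 2\<close> are
      \<open>(t ^^ i) k\<close> with \<open>i \<le> 3\<close>. Five more steps take them to
      positions 5 to 8 of the long cycle, which lie outside \<open>P\<close> because
      \<open>8 \<le> 2 * r + 2\<close>, while \<open>n + 2\<close> stays fixed. So \<open>E\<close>
      and its conjugate by \<open>g\<close> have only \<open>n + 2\<close> as a common moved
      point.\<close>
    define g where "g = inv' (t ^^ 5)"
    have t5bij: "bij (t ^^ 5)" by (rule bij_fn[OF tbij])
    have gbij: "bij g" unfolding g_def by (rule bij_imp_bij_inv[OF t5bij])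
    have gI: "g x = y" if "(t ^^ 5) y = x" for x y unfolding g_def by (rule bij_inv_eq[OF t5bij that])
    have g1: "g (n + 2) = n + 2" by (rule gI) (simp add: t_y funpow_fixed)
    have g2: "g (n + 1) = 0" by (rule gI) (simp add: eval_nat_numeral t_0 tl t_k t_S)
    define h where "h = g \<circ> E \<circ> inv' g"
    have hbij: "bij h" unfolding h_def by (intro bij_comp bij_imp_bij_inv gbij Ebij)
    have hg: "h (g x) = g (E x)" for x unfolding h_def using gbij by (simp add: bij_is_inj)
    have h_p: "h (n + 2) = 0" using hg[of "n + 2"] g1 E_P g2 by simp
    have far: "(t ^^ 5) x \<notin> P" if "x \<in> P" "x \<noteq> n + 2" for x
    proof -
      define M where "M = {x. x < k} \<union> {x. k + 2 \<le> x \<and> x < n}"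
      have MP: "x \<notin> P" if "x \<in> M" for x using that by (auto simp: M_def P_def n_def)
      have tM: "t x \<in> M" if xM: "x \<in> M" "x \<noteq> k - 1" for x
      proof -
        consider "0 < x" "x < r" | "r \<le> x" "x < k - 1" | "x = 0" | "k + 2 \<le> x" "x < k + r - 1" | "x = k + r - 1"
          using xM unfolding M_def n_def by fastforce
        then show ?thesis
        proof cases
          case 4
          then show ?thesis using tF[of "x - k"] by (simp add: M_def n_def)
        qed (use tX[of x] tmid[of x] t_0 tFlast r in \<open>auto simp: M_def\<close>)
      qed
      have pM: "(t ^^ i) k \<in> M" if i: "4 \<le> i" "i \<le> 2 * r + 2" for i
        using i
      proof (induction i rule: dec_induct)
        case base
        show ?case using p4 r by (simp add: M_def n_def)
      next
        case (step i)
        have "(t ^^ i) k \<noteq> k - 1"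
        proof (cases "i \<le> r + 1")
          case True
          then have "(t ^^ i) k = k + 2 + (i - 4)"
            using pF[of "i - 4"] step(1) r le_add_diff_inverse[of 4 i] by simp
          then show ?thesis by simp
        next
          case False
          then have "r + 2 + (i - (r + 2)) = i" "i - (r + 2) < r" using step r by auto
          then have "(t ^^ i) k = r - 1 - (i - (r + 2))" using pX[of "i - (r + 2)"] by metis
          then show ?thesis using r by linarith
        qed
        then show ?case using tM step by simp
      qed
      have "x \<in> {(t ^^ 0) k, (t ^^ 1) k, (t ^^ 2) k, (t ^^ 3) k}"
        using that t_k by (auto simp: P_def eval_nat_numeral)
      then have "\<exists>i\<in>{0, 1, 2, 3::nat}. x = (t ^^ i) k" by blast
      then obtain i where "i \<in> {0, 1, 2, 3::nat}" and ix: "x = (t ^^ i) k" by (elim bexE)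
      then have i: "i \<le> 3" "x = (t ^^ i) k" by auto
      then have "(t ^^ 5) x = (t ^^ (5 + i)) k" by (simp add: funpow_add)
      then show ?thesis using MP[OF pM[of "5 + i"]] i r by simp
    qed
    have only: "x = n + 2" if "E x \<noteq> x" "h x \<noteq> x" for x
    proof (rule ccontr)
      assume ne: "x \<noteq> n + 2"
      have xP: "x \<in> P" using Efix that(1) by blast
      obtain y where y: "x = g y" using gbij by (metis bij_pointE)
      then have "E y \<noteq> y" using hg[of y] that(2) by metis
      then have "y \<in> P" using Efix by blast
      moreover have "y = (t ^^ 5) x" using y t5bij unfolding g_def by (simp add: bij_is_surj surj_f_inv_f)
      ultimately show False using far[OF xP ne] by simp
    qed
    have ne: "E (n + 2) \<noteq> n + 2" "h (n + 2) \<noteq> n + 2" using E_P h_p by auto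
    have AS: "A \<in> perm_span {A, t ^^ 4}" by (rule perm_span.gen) simp
    have cS: "c \<in> perm_span {A, t ^^ 4}" unfolding c_def by (intro perm_span.comp perm_span.inv AS t_span)
    have ES: "E \<in> perm_span {A, t ^^ 4}" unfolding E_def by (rule perm_span_funpow[OF cS])
    have gS: "g \<in> perm_span {A, t ^^ 4}" unfolding g_def by (intro perm_span.inv perm_span_funpow t_span)
    have hS: "h \<in> perm_span {A, t ^^ 4}" unfolding h_def by (rule perm_span_conj[OF ES gS])
    show ?thesis
      using commutator_conj_in_span[OF ES hS]
        commutator_single_intersection(1)[OF Ebij hbij ne only] E_P(3) h_p by metis
  qed
  have b_n2: "b (Suc (Suc n)) = Suc (Suc (Suc n))"
    using link_b_apply(6)[OF k4 link, of "Suc (Suc n)"] k4 unfolding b_def by (simp add: rot_apply)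
  have b_0: "b 0 = 0"
    using link_b_apply(1)[OF k4 link, of 0] bR[of 0] r bk unfolding b_def by (simp add: n_def)
  have "chainable k (n + k) a b (Suc (Suc n))"
  proof (rule chainableI[OF lnk b_n2 t_def[symmetric], of "n + 2" "n + 1" 0])
    show "\<exists>p\<in>{n + 2, n + 1, 0}. a p \<in> {n + 2, n + 1, 0}"
      using a_new[of "n + 1"] k4 by (intro bexI[of _ "n + 1"]) auto
    show "\<exists>p\<in>{n + 2, n + 1, 0}. p \<noteq> Suc (Suc n) \<and> p \<noteq> Suc (Suc (Suc n)) \<and> b p \<in> {n + 2, n + 1, 0}"
      using b_0 by (intro bexI[of _ 0]) auto
    show "cyc3 (n + 2) (n + 1) 0 \<in> perm_span {A, t ^^ 4}"
      if "bij A" "\<And>i. i < n + k \<Longrightarrow> A i = a i" for A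
      using cyc that by blast
  qed (use t_out k4 in auto)
  then show ?thesis unfolding n_def by auto
qed

section \<open>Two cycles sharing one point\<close>

text \<open>If powers of \<open>a\<close> and \<open>b\<close> have exactly one common moved point, their commutator is a 3-cycle.\<close>

lemma crossing_generating_pair:
  assumes fin: "finite \<Omega>" and ap: "a permutes \<Omega>" and bp: "b permutes \<Omega>"
    and ord: "has_order k a" "has_order k b" and tr: "transitive_pair \<Omega> a b"
    and A: "\<And>x. x \<notin> A \<Longrightarrow> (a ^^ e) x = x" and B: "\<And>x. x \<notin> B \<Longrightarrow> (b ^^ e) x = x"
    and AB: "A \<inter> B = {w}" and w: "w \<in> \<Omega>"
    and v: "(a ^^ e) w = v" "v \<noteq> w" and u: "(b ^^ e) w = u" "u \<noteq> w"
    and chase: "\<And>D. w \<in> D \<Longrightarrow> v \<in> D \<Longrightarrow> u \<in> D \<Longrightarrow> D \<subseteq> \<Omega> \<Longrightarrow>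
       (\<And>g p. g \<in> perm_span {a, b} \<Longrightarrow> p \<in> D \<Longrightarrow> g p \<in> D \<Longrightarrow> g ` D \<subseteq> D) \<Longrightarrow>
       (\<exists>p\<in>D. a p \<in> D) \<and> (\<exists>p\<in>D. b p \<in> D)"
  shows "generating_pair k \<Omega> a b"
proof -
  have bij: "bij (a ^^ e)" "bij (b ^^ e)"
    using bij_fn[OF permutes_bij[OF ap]] bij_fn[OF permutes_bij[OF bp]] by auto
  have only: "q = w" if "(a ^^ e) q \<noteq> q" "(b ^^ e) q \<noteq> q" for q
    using that A B AB by blast
  have ne: "(a ^^ e) w \<noteq> w" "(b ^^ e) w \<noteq> w" using u v by auto
  note comm = commutator_single_intersection[OF bij ne only, unfolded u(1) v(1)]
  have span: "a \<in> perm_span {a, b}" "b \<in> perm_span {a, b}" by (auto intro: perm_span.gen)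
  have cyc: "cyc3 w v u \<in> perm_span {a, b}"
    using commutator_conj_in_span[OF perm_span_funpow[OF span(1), of e] perm_span_funpow[OF span(2), of e]]
      comm(1) by metis
  have vu: "v \<in> \<Omega>" "u \<in> \<Omega>"
    using permutes_in_image[OF permutes_funpow[OF ap, of e], of w]
      permutes_in_image[OF permutes_funpow[OF bp, of e], of w] w u v by auto
  have "has_three_cycles (perm_span {a, b}) \<Omega>"
  proof (rule all_three_cycles[OF fin ap bp tr w vu comm(2) cyc])
    fix D assume "{w, v, u} \<subseteq> D" "D \<subseteq> \<Omega>"
      "\<And>g p. g \<in> perm_span {a, b} \<Longrightarrow> p \<in> D \<Longrightarrow> g p \<in> D \<Longrightarrow> g ` D \<subseteq> D"
    then show "(\<exists>p\<in>D. a p \<in> D) \<and> (\<exists>p\<in>D. b p \<in> D)" by (intro chase) auto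
  qed
  then show ?thesis using ap bp ord unfolding generating_pair_def by blast
qed

lemma rot_closed:
  assumes "\<And>x. l \<le> x \<Longrightarrow> x < l + k \<Longrightarrow> f x = rot l k x" "f ` S \<subseteq> S"
    and "x \<in> S" "l \<le> x" "x < l + k" "l \<le> y" "y < l + k"
  shows "y \<in> S"
proof -
  have "f (l + i) = l + Suc i mod k" if "i < k" for i
    using assms(1)[of "l + i"] rot_funpow[OF that, of 1 l] that by simp
  from cyclic_closed[of k f "\<lambda>i. l + i", OF this assms(2), of "x - l" "y - l"]
  show ?thesis using assms(3-7) by auto
qed

text \<open>The supports have \<open>k - 1\<close> as their only common point, so the generators
  themselves can be used, with \<open>e = 1\<close>.\<close>

lemma two_cycles_crossing:
  assumes k: "3 \<le> k"
  shows "\<exists>a b. generating_pair k {..<2 * k - 1} a b"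
proof -
  define a b where "a = rot 0 k" and "b = rot (k - 1) k"
  have ap: "a permutes {..<2 * k - 1}" and bp: "b permutes {..<2 * k - 1}"
    unfolding a_def b_def by (rule permutes_subset[OF rot_permutes]; use k in force)+
  have tr: "transitive_pair {..<2 * k - 1} a b"
    unfolding transitive_pair_def
  proof (intro allI impI)
    fix S assume S: "S \<subseteq> {..<2 * k - 1}" "S \<noteq> {}" "a ` S \<subseteq> S" "b ` S \<subseteq> S"
    note aS = rot_closed[of 0 k a S, OF _ S(3), unfolded a_def, OF refl, folded a_def]
      and bS = rot_closed[of "k - 1" k b S, OF _ S(4), unfolded b_def, OF refl, folded b_def]
    obtain x where x: "x \<in> S" "x < 2 * k - 1" using S by auto
    have w: "k - 1 \<in> S"
      using aS[OF x(1), of "k - 1"] bS[OF x(1), of "k - 1"] x(2) k by (cases "x < k") auto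
    have "y \<in> S" if "y < 2 * k - 1" for y
      using aS[OF w, of y] bS[OF w, of y] that k by (cases "y < k") auto
    then show "S = {..<2 * k - 1}" using S(1) by auto
  qed
  have "generating_pair k {..<2 * k - 1} a b"
  proof (rule crossing_generating_pair[where e = 1 and w = "k - 1" and v = 0 and u = k
        and A = "{0..<k}" and B = "{k - 1..<k - 1 + k}"])
    \<comment> \<open>The image \<open>k\<close> of the common point under \<open>b\<close> is fixed
      by \<open>a\<close>, and its image \<open>0\<close> under \<open>a\<close> is fixed by
      \<open>b\<close>.\<close>
    fix D :: "nat set" assume "0 \<in> D" "k \<in> D"
    then show "(\<exists>p\<in>D. a p \<in> D) \<and> (\<exists>p\<in>D. b p \<in> D)"
      using k by (intro conjI bexI[of _ k] bexI[of _ 0]) (auto simp: a_def b_def rot_apply)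
  qed (use ap bp tr k in \<open>auto simp: a_def b_def rot_has_order rot_apply\<close>)
  then show ?thesis by blast
qed

section \<open>Even order: optional transpositions and a matched tail\<close>

lemma toggle_parity:
  assumes "permutation f" "p \<noteq> q"
  shows "\<exists>T. (T = id \<or> T = transpose p q) \<and> evenperm (f \<circ> T) = P"
proof (cases "evenperm f = P")
  case True
  then show ?thesis by (intro exI[of _ id]) simp
next
  case False
  then show ?thesis
    using evenperm_comp[OF assms(1) permutation_swap_id[of p q]] assms(2) evenperm_swap[of p q]
    by (intro exI[of _ "transpose p q"]) auto
qed

lemma toggle_props:
  assumes "T = id \<or> T = transpose p q"
  shows "T permutes {p, q}" "T ^^ 2 = id"
proof -
  show "T permutes {p, q}"
    using assms permutes_swap_id[of p "{p, q}" q] permutes_id[of "{p, q}"] by (elim disjE) (simp_all only: insertI1 insertI2)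
  show "T ^^ 2 = id"
    using assms by (elim disjE) (simp_all add: eval_nat_numeral fun_eq_iff)
qed

lemma funpow_even_id: "f ^^ 2 = id \<Longrightarrow> even i \<Longrightarrow> f ^^ i = id"
  using funpow_mult[where f = f and m = 2 and n = "i div 2"] by simp

text \<open>A matching of neighbours in \<open>{s..<n}\<close>, with a last unmatched point fixed.
  The matchings starting at \<open>s\<close> and at \<open>s + 1\<close> interlock to a path through
  the whole interval.\<close>

definition pairing :: "nat \<Rightarrow> nat \<Rightarrow> nat \<Rightarrow> nat" where
  "pairing s n x = (if s \<le> x \<and> x < n
     then if even (x - s) then if Suc x < n then Suc x else x else x - 1 else x)"

lemma pairing_invol: "pairing s n (pairing s n x) = x"
proof (cases "s \<le> x \<and> x < n \<and> odd (x - s)")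
  case True
  then have "s < x" by (metis diff_self_eq_0 even_zero le_neq_implies_less)
  moreover from this have "x - s = Suc (x - 1 - s)" by auto
  ultimately have "s \<le> x - 1" "x - 1 < n" "even (x - 1 - s)" "Suc (x - 1) = x"
    using True by auto
  then show ?thesis using True by (simp add: pairing_def)
next
  case False
  then show ?thesis by (auto simp: pairing_def)
qed

lemma pairing_permutes: "pairing s n permutes {s..<n}"
proof (rule bij_imp_permutes)
  have "pairing s n x \<in> {s..<n}" if "x \<in> {s..<n}" for x
  proof (cases "even (x - s)")
    case False
    then have "x \<noteq> s" by auto
    then have "s < x" using that by simp
    moreover have "pairing s n x = x - 1"
      using that False unfolding pairing_def by (simp only: atLeastLessThan_iff if_True if_False simp_thms)
    moreover have "x < n" using that by simp
    ultimately show ?thesis by auto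
  qed (use that in \<open>auto simp: pairing_def\<close>)
  then show "bij_betw (pairing s n) {s..<n} {s..<n}"
    by (intro bij_betwI[where g = "pairing s n"]) (auto simp: pairing_invol)
qed (auto simp: pairing_def)

lemma pairing_sq: "pairing s n ^^ 2 = id"
  by (auto simp: eval_nat_numeral fun_eq_iff pairing_invol)

text \<open>Two \<open>k\<close>-cycles with one common point carry the argument, and the remaining
  points hang on them as a path whose edges belong alternately to \<open>a\<close> and
  \<open>b\<close>. All additions are disjoint involutions, so \<open>a ^^ 2\<close> and
  \<open>b ^^ 2\<close> see only the two cycles.\<close>

lemma crossing_tail:
  assumes k: "4 \<le> k" "even k" and n: "2 * k - 1 \<le> n"
  shows "\<exists>a b. generating_pair k {..<n} a b \<and> evenperm a = pa \<and> evenperm b = pb"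
proof -
  \<comment> \<open>\<open>s\<close> is the last point of \<open>B\<close>, so the path starts on
    the second cycle.\<close>
  define s where "s = 2 * k - 2"
  define A B where "A = {0..<0 + k}" and "B = {k - 1..<k - 1 + k}"
  define \<alpha> \<beta> where "\<alpha> = rot 0 k \<circ> pairing s n" and "\<beta> = rot (k - 1) k \<circ> pairing (Suc s) n"
  have perm: "permutation (rot l k \<circ> pairing m n)" for l m
    by (intro permutation_compose permutes_imp_permutation[OF _ rot_permutes]
        permutes_imp_permutation[OF _ pairing_permutes]) auto
  \<comment> \<open>\<open>T\<close> swaps two points outside \<open>A\<close> but in
    \<open>B\<close>, where they will be known to lie in \<open>D\<close>. Likewise \<open>U\<close>
    below swaps points of \<open>A\<close> outside \<open>B\<close>; it avoids \<open>1\<close>, the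
    image of \<open>k - 1\<close> under \<open>a ^^ 2\<close>, because \<open>b\<close> has to fix
    that point.\<close>
  obtain T where T: "T = id \<or> T = transpose k (k + 1)" "evenperm (\<alpha> \<circ> T) = pa"
    using toggle_parity[OF perm[of 0 s], of k "k + 1" pa] unfolding \<alpha>_def by auto
  obtain U where U: "U = id \<or> U = transpose 0 2" "evenperm (\<beta> \<circ> U) = pb"
    using toggle_parity[OF perm[of "k - 1" "Suc s"], of 0 2 pb] unfolding \<beta>_def by auto
  define P Q where "P = pairing s n \<circ> T" and "Q = pairing (Suc s) n \<circ> U"
  define a b where "a = rot 0 k \<circ> P" and "b = rot (k - 1) k \<circ> Q"
  have ev: "evenperm a = pa" "evenperm b = pb"
    using T(2) U(2) unfolding a_def b_def P_def Q_def \<alpha>_def \<beta>_def by (simp_all only: comp_assoc)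
  have Pp: "P permutes {..<n} - A"
    unfolding P_def
    by (intro permutes_compose permutes_subset[OF pairing_permutes] permutes_subset[OF toggle_props(1)[OF T(1)]])
      (use k n in \<open>auto simp: A_def s_def\<close>)
  have Qp: "Q permutes {..<n} - B"
    unfolding Q_def
    by (intro permutes_compose permutes_subset[OF pairing_permutes] permutes_subset[OF toggle_props(1)[OF U(1)]])
      (use k n in \<open>auto simp: B_def s_def\<close>)
  have "{s..<n} \<inter> {k, k + 1} = {}" "{Suc s..<n} \<inter> {0, 2} = {}" using k by (auto simp: s_def)
  note comm = permutes_disjoint_commute[OF pairing_permutes toggle_props(1)[OF T(1)] this(1)]
    permutes_disjoint_commute[OF pairing_permutes toggle_props(1)[OF U(1)] this(2)]
  have P2: "P ^^ 2 = id"
    unfolding P_def funpow_comp_commute[OF comm(1)] by (simp add: pairing_sq toggle_props(2)[OF T(1)])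
  have Q2: "Q ^^ 2 = id"
    unfolding Q_def funpow_comp_commute[OF comm(2)] by (simp add: pairing_sq toggle_props(2)[OF U(1)])
  have rA: "rot 0 k permutes A" and rB: "rot (k - 1) k permutes B"
    unfolding A_def B_def by (rule rot_permutes)+
  have AB\<Omega>: "A \<subseteq> {..<n}" "B \<subseteq> {..<n}" using k n by (auto simp: A_def B_def)
  have ap: "a permutes {..<n}" and bp: "b permutes {..<n}"
    unfolding a_def b_def
    by (rule permutes_compose[OF permutes_subset[OF Pp] permutes_subset[OF rA AB\<Omega>(1)]]
        permutes_compose[OF permutes_subset[OF Qp] permutes_subset[OF rB AB\<Omega>(2)]]; blast)+
  have disj: "A \<inter> ({..<n} - A) = {}" "B \<inter> ({..<n} - B) = {}" by auto
  have ao: "has_order k a"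
    unfolding a_def by (rule has_order_disjoint_comp[OF rA Pp disj(1) rot_has_order funpow_even_id[OF P2 k(2)]])
  have bo: "has_order k b"
    unfolding b_def by (rule has_order_disjoint_comp[OF rB Qp disj(2) rot_has_order funpow_even_id[OF Q2 k(2)]])
  have a2: "a ^^ 2 = rot 0 k ^^ 2"
    unfolding a_def funpow_comp_commute[OF permutes_disjoint_commute[OF rA Pp disj(1)]] P2 by simp
  have b2: "b ^^ 2 = rot (k - 1) k ^^ 2"
    unfolding b_def funpow_comp_commute[OF permutes_disjoint_commute[OF rB Qp disj(2)]] Q2 by simp
  have aA: "a x = rot 0 k x" if "x < k" for x
    using permutes_not_in[OF Pp, of x] that by (simp add: a_def A_def)
  have bB: "b x = rot (k - 1) k x" if "k - 1 \<le> x" "x < k - 1 + k" for x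
  proof -
    have "x \<in> B" unfolding B_def atLeastLessThan_iff using that by blast
    then have "x \<notin> {..<n} - B" by blast
    then show ?thesis using permutes_not_in[OF Qp] by (simp add: b_def)
  qed
  have a_tail: "a x = pairing s n x" if "s \<le> x" for x
  proof -
    have "T x = x" using T(1) that k by (auto simp: s_def)
    moreover have "s \<le> pairing s n x"
      using that permutes_in_image[OF pairing_permutes, of s n x] permutes_not_in[OF pairing_permutes, of x s n]
      by (cases "x < n") auto
    ultimately show ?thesis using k by (simp add: a_def P_def rot_apply s_def)
  qed
  have b_tail: "b x = pairing (Suc s) n x" if "Suc s \<le> x" for x
  proof -
    have "U x = x" using U(1) that k by (auto simp: s_def)
    moreover have "Suc s \<le> pairing (Suc s) n x"
      using that permutes_in_image[OF pairing_permutes, of "Suc s" n x]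
        permutes_not_in[OF pairing_permutes, of x "Suc s" n]
      by (cases "x < n") auto
    moreover have "rot (k - 1) k y = y" if "Suc s \<le> y" for y
      using that k by (auto simp: rot_apply s_def)
    ultimately show ?thesis by (simp add: b_def Q_def)
  qed
  have tr: "transitive_pair {..<n} a b"
    unfolding transitive_pair_def
  proof (intro allI impI)
    fix S assume S: "S \<subseteq> {..<n}" "S \<noteq> {}" "a ` S \<subseteq> S" "b ` S \<subseteq> S"
    have aS: "y \<in> S" if "x \<in> S" "x < k" "y < k" for x y
      using rot_closed[of 0 k a S x y] aA S(3) that by simp
    have bS: "y \<in> S" if "x \<in> S" "k - 1 \<le> x" "x < k - 1 + k" "k - 1 \<le> y" "y < k - 1 + k" for x y
      using rot_closed[of "k - 1" k b S x y] bB S(4) that by simp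
    \<comment> \<open>Neighbours in the tail are exchanged by \<open>a\<close> or by
      \<open>b\<close>, depending on the parity of their distance from \<open>s\<close>.\<close>
    have flip: "x \<in> S \<longleftrightarrow> Suc x \<in> S" if "s \<le> x" "Suc x < n" for x
    proof (cases "even (x - s)")
      case True
      then have "a x = Suc x" "a (Suc x) = x"
        using a_tail[of x] a_tail[of "Suc x"] that by (auto simp: pairing_def Suc_diff_le)
      then show ?thesis using S(3) by (metis image_subset_iff)
    next
      case False
      then have "s \<noteq> x" by auto
      then have "Suc s \<le> x" using that by simp
      moreover from this have "even (x - Suc s)" using False by (simp add: Suc_diff_Suc)
      ultimately have "b x = Suc x" "b (Suc x) = x"
        using b_tail[of x] b_tail[of "Suc x"] that by (auto simp: pairing_def Suc_diff_le)
      then show ?thesis using S(4) by (metis image_subset_iff)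
    qed
    have chain: "s \<in> S \<longleftrightarrow> x \<in> S" if "s \<le> x" "x < n" for x
      using that
    proof (induction x rule: dec_induct)
      case (step x)
      then show ?case using flip[of x] by simp
    qed simp
    obtain x where x: "x \<in> S" "x < n" using S by auto
    have sB: "k - 1 \<le> s" "s < k - 1 + k" using k by (auto simp: s_def)
    have w: "k - 1 \<in> S"
    proof -
      consider "x < k" | "k \<le> x" "x < k - 1 + k" | "s \<le> x" using k unfolding s_def by linarith
      then show ?thesis
      proof cases
        case 1
        then show ?thesis using aS[OF x(1)] k by simp
      next
        case 2
        then show ?thesis using bS[OF x(1)] k by simp
      next
        case 3
        then have "s \<in> S" using chain x by blast
        then show ?thesis using bS[of s "k - 1"] sB k by simp
      qed
    qed
    have "y \<in> S" if "y < n" for y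
    proof -
      consider "y < k" | "k \<le> y" "y < k - 1 + k" | "s \<le> y" using k unfolding s_def by linarith
      then show ?thesis
      proof cases
        case 1
        then show ?thesis using aS[OF w] k by simp
      next
        case 2
        then show ?thesis using bS[OF w] k by simp
      next
        case 3
        have "s \<in> S" using bS[OF w] sB k by simp
        then show ?thesis using chain 3 that by blast
      qed
    qed
    then show "S = {..<n}" using S(1) by auto
  qed
  have "generating_pair k {..<n} a b"
  proof (rule crossing_generating_pair[OF finite_lessThan ap bp ao bo tr,
        where e = 2 and w = "k - 1" and v = 1 and u = "k + 1" and A = A and B = B])
    show "(a ^^ 2) x = x" if "x \<notin> A" for x
      using permutes_not_in[OF permutes_funpow[OF rA]] that unfolding a2 by blast
    show "(b ^^ 2) x = x" if "x \<notin> B" for x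
      using permutes_not_in[OF permutes_funpow[OF rB]] that unfolding b2 by blast
    show "A \<inter> B = {k - 1}" using k by (auto simp: A_def B_def)
    show "k - 1 \<in> {..<n}" using k n by auto
    show "(a ^^ 2) (k - 1) = 1" unfolding a2 using k by (simp add: eval_nat_numeral rot_apply)
    have "rot (k - 1) k (k - 1) = k" "rot (k - 1) k k = k + 1" using k by (auto simp: rot_apply)
    then show "(b ^^ 2) (k - 1) = k + 1" unfolding b2 by (simp add: numeral_2_eq_2)
    fix D assume D: "k - 1 \<in> D" "1 \<in> D" "D \<subseteq> {..<n}"
      "\<And>g p. g \<in> perm_span {a, b} \<Longrightarrow> p \<in> D \<Longrightarrow> g p \<in> D \<Longrightarrow> g ` D \<subseteq> D"
    have b1: "b 1 = 1"
    proof -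
      have "U 1 = 1" using U(1) by auto
      then show ?thesis using k by (auto simp: b_def Q_def pairing_def s_def rot_apply)
    qed
    then have "b ` D \<subseteq> D" using D(4)[of b 1] D(2) perm_span.gen[of b "{a, b}"] by simp
    then have bD: "y \<in> D" if "k - 1 \<le> y" "y < k - 1 + k" for y
      using rot_closed[of "k - 1" k b D "k - 1" y] bB D(1) that k by simp
    have "T k \<in> {k, k + 1}" using T(1) by auto
    moreover have "pairing s n k = k" "pairing s n (k + 1) = k + 1"
      using k by (auto simp: pairing_def s_def)
    ultimately have "a k \<in> {k, k + 1}"
      by (elim insertE emptyE) (simp_all add: a_def P_def rot_apply)
    moreover have "{k, k + 1} \<subseteq> D" using bD k by auto
    ultimately show "(\<exists>p\<in>D. a p \<in> D) \<and> (\<exists>p\<in>D. b p \<in> D)"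
      using b1 D(2) by (intro conjI bexI[of _ k] bexI[of _ 1]) auto
  qed (use k in auto)
  then show ?thesis using ev by blast
qed

section \<open>Products of a half-length cycle and a 2-power cycle\<close>

text \<open>To be used with \<open>2 * h = e * m\<close>, where \<open>e\<close> is even and coprime
  to \<open>m\<close>, and with \<open>cs\<close> of length \<open>e\<close>. The least common
  multiple of \<open>h\<close> and \<open>e\<close> is then \<open>2 * h\<close>, and the
  \<open>e\<close>-th power erases \<open>cs\<close> and \<open>T\<close>, leaving a power of the
  \<open>h\<close>-cycle.\<close>

definition mixed :: "nat \<Rightarrow> nat \<Rightarrow> nat list \<Rightarrow> (nat \<Rightarrow> nat) \<Rightarrow> nat \<Rightarrow> nat" where
  "mixed l h cs T = rot l h \<circ> (cycle_of_list cs \<circ> T)"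

context
  fixes l h e m p q :: nat and cs :: "nat list" and T :: "nat \<Rightarrow> nat"
  assumes em: "e * m = 2 * h" "coprime e m" "even e" "0 < h"
    and cs: "distinct cs" "length cs = e" "set cs \<inter> {l..<l + h} = {}"
    and T: "T = id \<or> T = transpose p q" and pq: "{p, q} \<inter> {l..<l + h} = {}" "{p, q} \<inter> set cs = {}"
begin

private lemma epos: "0 < e"
  using em by (cases e) auto

private lemma P: "cycle_of_list cs \<circ> T permutes (set cs \<union> {p, q})"
  by (rule permutes_compose[OF permutes_subset[OF toggle_props(1)[OF T]] permutes_subset[OF cycle_permutes]]) auto

private lemma P_disj: "{l..<l + h} \<inter> (set cs \<union> {p, q}) = {}"
  using cs pq by blast

private lemma P_pow: "(cycle_of_list cs \<circ> T) ^^ i = cycle_of_list cs ^^ i \<circ> T ^^ i"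
  by (rule funpow_comp_commute[OF permutes_disjoint_commute[OF cycle_permutes toggle_props(1)[OF T]]])
    (use pq in blast)

private lemma P_e: "(cycle_of_list cs \<circ> T) ^^ e = id"
  unfolding P_pow funpow_even_id[OF toggle_props(2)[OF T] em(3)]
  using cycle_is_id_root[OF cs(1)] cs(2) by simp

private lemma mixed_pow_eq: "mixed l h cs T ^^ i = rot l h ^^ i \<circ> (cycle_of_list cs \<circ> T) ^^ i"
  unfolding mixed_def by (rule funpow_comp_commute[OF permutes_disjoint_commute[OF rot_permutes P P_disj]])

lemma mixed_pow: "mixed l h cs T ^^ e = rot l h ^^ e"
  unfolding mixed_pow_eq P_e by simp

lemma mixed_permutes:
  assumes "{l..<l + h} \<subseteq> \<Omega>" "set cs \<subseteq> \<Omega>" "{p, q} \<subseteq> \<Omega>"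
  shows "mixed l h cs T permutes \<Omega>"
  unfolding mixed_def
  by (rule permutes_compose[OF permutes_subset[OF P] permutes_subset[OF rot_permutes assms(1)]]) (use assms in blast)

lemma mixed_apply:
  "l \<le> x \<Longrightarrow> x < l + h \<Longrightarrow> mixed l h cs T x = rot l h x"
  "i < e \<Longrightarrow> mixed l h cs T (cs ! i) = cs ! (Suc i mod e)"
  "mixed l h cs T p = T p"
proof -
  have rot_out: "rot l h y = y" if "y \<notin> {l..<l + h}" for y
    by (rule permutes_not_in[OF rot_permutes that])
  show "mixed l h cs T x = rot l h x" if "l \<le> x" "x < l + h"
  proof -
    have "x \<notin> set cs \<union> {p, q}" using that cs pq by auto
    then show ?thesis using permutes_not_in[OF P, of x] unfolding mixed_def by simp
  qed
  show "mixed l h cs T (cs ! i) = cs ! (Suc i mod e)" if "i < e"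
  proof -
    have "cs ! i \<in> set cs" "cs ! (Suc i mod e) \<in> set cs" using that cs(2) epos by auto
    then have "cs ! i \<notin> {p, q}" "cs ! (Suc i mod e) \<notin> {l..<l + h}" using cs(3) pq(2) by blast+
    moreover from this have "T (cs ! i) = cs ! i" using permutes_not_in[OF toggle_props(1)[OF T]] by blast
    ultimately show ?thesis
      using cycle_of_list_nth[OF cs(1), of i] that cs(2) rot_out unfolding mixed_def by simp
  qed
  have "T p \<in> {p, q}" using T by auto
  then have "T p \<notin> {l..<l + h}" "T p \<notin> set cs" using pq by blast+
  then show "mixed l h cs T p = T p"
    unfolding mixed_def using rot_out id_outside_supp[of "T p" cs] by simp
qed

lemma mixed_has_order: "has_order (2 * h) (mixed l h cs T)"
proof -
  have "e * m dvd i" if "mixed l h cs T ^^ i = id" for i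
  proof -
    have eq: "(rot l h ^^ i) (((cycle_of_list cs \<circ> T) ^^ i) x) = x" for x
      using fun_cong[OF that[unfolded mixed_pow_eq], of x] by simp
    have "l \<in> {l..<l + h}" using em(4) by simp
    then have "l \<notin> set cs \<union> {p, q}" using P_disj by blast
    then have "((cycle_of_list cs \<circ> T) ^^ i) l = l"
      using permutes_not_in[OF permutes_funpow[OF P]] by blast
    then have "(rot l h ^^ i) (l + 0) = l" using eq[of l] by simp
    then have "i mod h = 0" using rot_funpow[of 0 h i l] em(4) by simp
    then have "h dvd i" by blast
    moreover have "m dvd h"
    proof -
      obtain f where "e = 2 * f" using em(3) by blast
      then have "f * m = h" using em(1) by simp
      then show ?thesis by (metis dvd_triv_right)
    qed
    ultimately have "m dvd i" by (rule dvd_trans[rotated])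
    moreover have "e dvd i"
    proof -
      have c0: "cs ! 0 \<in> set cs" using cs(2) epos by auto
      have "cs ! 0 \<notin> {p, q}" using c0 pq(2) by blast
      then have "(T ^^ i) (cs ! 0) = cs ! 0"
        using permutes_not_in[OF permutes_funpow[OF toggle_props(1)[OF T]]] by blast
      then have "((cycle_of_list cs \<circ> T) ^^ i) (cs ! 0) = cs ! (i mod e)"
        using cycle_of_list_funpow_nth[OF cs(1), of 0 i] cs(2) epos unfolding P_pow by simp
      moreover have "cs ! (i mod e) \<in> set cs" using cs(2) epos by simp
      then have "cs ! (i mod e) \<notin> {l..<l + h}" using cs(3) by blast
      then have "(rot l h ^^ i) (cs ! (i mod e)) = cs ! (i mod e)"
        using permutes_not_in[OF permutes_funpow[OF rot_permutes]] by blast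
      ultimately have "cs ! (i mod e) = cs ! 0" using eq[of "cs ! 0"] by simp
      then have "i mod e = 0"
        using cs(1,2) epos nth_eq_iff_index_eq[of cs "i mod e" 0] by simp
      then show ?thesis by blast
    qed
    ultimately show ?thesis using em(2) by (simp add: divides_mult)
  qed
  moreover have "mixed l h cs T ^^ (2 * h) = id"
  proof -
    have "mixed l h cs T ^^ (2 * h) = (rot l h ^^ h) ^^ 2 \<circ> ((cycle_of_list cs \<circ> T) ^^ e) ^^ m"
      unfolding mixed_pow_eq funpow_mult em(1) by (simp only: mult.commute)
    then show ?thesis unfolding P_e rot_funpow_id id_funpow by simp
  qed
  ultimately show ?thesis
    unfolding has_order_def em(1)[symmetric] by (metis nat_dvd_not_less)
qed

end

text \<open>The two \<open>h\<close>-cycles cross at \<open>h - 1\<close> and miss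
  \<open>2 * h - 1\<close> and, if present, \<open>2 * h\<close>. The \<open>e\<close>-cycle of
  \<open>a\<close> ties the point \<open>2 * h - 1\<close> to \<open>B\<close>, and that of
  \<open>b\<close> ties the last point \<open>n - 1\<close> to \<open>A\<close>, which gives
  transitivity. In the \<open>e\<close>-th powers only the crossing \<open>h\<close>-cycles
  remain.\<close>

lemma half_cycles_generating_pair:
  assumes em: "e * m = 2 * h" "coprime e m" "even e" "odd m" "e + 2 \<le> h"
    and n: "n = 2 * h \<or> n = 2 * h + 1"
  shows "\<exists>a b. generating_pair (2 * h) {..<n} a b \<and> evenperm a = pa \<and> evenperm b = pb"
proof -
  have e: "2 \<le> e" using em by (cases "e = 0") (auto elim: evenE)
  \<comment> \<open>Equality would force \<open>m = 4\<close>. The inequality keeps the points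
    \<open>e - 1\<close> and \<open>h - 1 - e\<close> distinct, so that swapping them changes the
    parity.\<close>
  have h2e: "h \<noteq> 2 * e"
  proof
    assume "h = 2 * e"
    then have "e * m = e * 4" using em(1) by linarith
    then show False using e em(4) by simp
  qed
  define A B where "A = {0..<0 + h}" and "B = {h - 1..<h - 1 + h}"
  define cs where "cs = (2 * h - 1) # [h + 2..<h + 1 + e]"
  \<comment> \<open>Room for the other \<open>e - 1\<close> points of the cycle of \<open>b\<close>,
    apart from the two points reserved for its transposition; this is where
    \<open>e + 2 \<le> h\<close> is needed.\<close>
  have "card ({0..<h - 1} - {e - 1, h - 1 - e}) \<ge> e - 1"
  proof -
    have "card {e - 1, h - 1 - e} \<le> 2" by (simp add: card_insert_if)
    moreover have "card {0..<h - 1} - card {e - 1, h - 1 - e} \<le> card ({0..<h - 1} - {e - 1, h - 1 - e})"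
      by (rule diff_card_le_card_Diff) simp
    moreover have "card {0..<h - 1} = h - 1" by simp
    ultimately show ?thesis using em(5) by linarith
  qed
  then obtain V where V: "V \<subseteq> {0..<h - 1} - {e - 1, h - 1 - e}" "card V = e - 1" "finite V"
    by (rule obtain_subset_with_card_n)
  then obtain xs where xs: "set xs = V" "distinct xs" using finite_distinct_list by blast
  then have xs_len: "length xs = e - 1" using V distinct_card[of xs] by simp
  define ds where "ds = (n - 1) # xs"
  have cs': "distinct cs" "length cs = e" "set cs \<inter> {0..<0 + h} = {}" "{h, h + 1} \<inter> set cs = {}"
    using e em(5) by (auto simp: cs_def)
  have h_range: "h - 1 < n - 1" "h - 1 + h \<le> n - 1" "n - 1 < n" using n em(5) by auto
  have xs_range: "x < h - 1 \<and> x \<noteq> e - 1 \<and> x \<noteq> h - 1 - e" if "x \<in> set xs" for x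
    using that V(1) xs(1) by auto
  have ds': "distinct ds" "length ds = e" "set ds \<inter> {h - 1..<h - 1 + h} = {}" "{e - 1, h - 1 - e} \<inter> set ds = {}"
  proof -
    have ds_range: "x = n - 1 \<or> x < h - 1 \<and> x \<noteq> e - 1 \<and> x \<noteq> h - 1 - e" if "x \<in> set ds" for x
      using that xs_range[of x] unfolding ds_def by auto
    have "n - 1 \<notin> set xs" using xs_range[of "n - 1"] h_range by linarith
    then show "distinct ds" unfolding ds_def using xs(2) by simp
    show "length ds = e" unfolding ds_def using xs_len e by simp
    have "x \<notin> {h - 1..<h - 1 + h}" if "x \<in> set ds" for x
      using ds_range[OF that] h_range unfolding atLeastLessThan_iff by linarith
    then show "set ds \<inter> {h - 1..<h - 1 + h} = {}" by blast
    have "e - 1 \<notin> set ds" using ds_range[of "e - 1"] h_range em(5) by linarith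
    moreover have "h - 1 - e \<notin> set ds" using ds_range[of "h - 1 - e"] h_range em(5) by linarith
    ultimately show "{e - 1, h - 1 - e} \<inter> set ds = {}" by blast
  qed
  have tog: "{h, h + 1} \<inter> {0..<0 + h} = {}" "{e - 1, h - 1 - e} \<inter> {h - 1..<h - 1 + h} = {}"
    using e em(5) by auto
  have perm: "permutation (rot l h \<circ> cycle_of_list ys)" for l ys
    by (intro permutation_compose permutes_imp_permutation[OF _ rot_permutes] permutation_of_cycle) auto
  obtain T where T: "T = id \<or> T = transpose h (h + 1)" "evenperm (rot 0 h \<circ> cycle_of_list cs \<circ> T) = pa"
    using toggle_parity[OF perm[of 0 cs], of h "h + 1" pa] by auto
  have "e - 1 \<noteq> h - 1 - e" using h2e em(5) e by linarith
  \<comment> \<open>The two points are the image and the preimage of the crossing point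
    \<open>h - 1\<close> under \<open>a ^^ e\<close>. Both will be found in \<open>D\<close>, so
    \<open>b\<close> keeps \<open>e - 1\<close> in \<open>D\<close> whether or not the transposition
    is present.\<close>
  then obtain U where U: "U = id \<or> U = transpose (e - 1) (h - 1 - e)"
    "evenperm (rot (h - 1) h \<circ> cycle_of_list ds \<circ> U) = pb"
    using toggle_parity[OF perm[of "h - 1" ds], of "e - 1" "h - 1 - e" pb] by auto
  define a b where "a = mixed 0 h cs T" and "b = mixed (h - 1) h ds U"
  have ev: "evenperm a = pa" "evenperm b = pb"
    using T(2) U(2) unfolding a_def b_def mixed_def by (simp_all only: comp_assoc)
  have h0: "0 < h" using em(5) by simp
  note a_facts = em(1-3) h0 cs'(1-3) T(1) tog(1) cs'(4)
    and b_facts = em(1-3) h0 ds'(1-3) U(1) tog(2) ds'(4)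
  have ao: "has_order (2 * h) a" unfolding a_def by (rule mixed_has_order[OF a_facts])
  have bo: "has_order (2 * h) b" unfolding b_def by (rule mixed_has_order[OF b_facts])
  have ap: "a permutes {..<n}"
    unfolding a_def by (rule mixed_permutes[OF a_facts]) (use n em(5) e in \<open>auto simp: cs_def\<close>)
  have bp: "b permutes {..<n}"
    unfolding b_def
    by (rule mixed_permutes[OF b_facts]) (use h_range e em(5) in \<open>auto simp: ds_def dest: xs_range\<close>)
  have ae: "a ^^ e = rot 0 h ^^ e" unfolding a_def by (rule mixed_pow[OF a_facts])
  have be: "b ^^ e = rot (h - 1) h ^^ e" unfolding b_def by (rule mixed_pow[OF b_facts])
  note a_app = mixed_apply[OF a_facts, folded a_def] and b_app = mixed_apply[OF b_facts, folded b_def]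
  have tr: "transitive_pair {..<n} a b"
    unfolding transitive_pair_def
  proof (intro allI impI)
    fix S assume S: "S \<subseteq> {..<n}" "S \<noteq> {}" "a ` S \<subseteq> S" "b ` S \<subseteq> S"
    have aS: "y \<in> S" if "x \<in> S" "x < h" "y < h" for x y
      using rot_closed[of 0 h a S x y] a_app(1) S(3) that by simp
    have bS: "y \<in> S" if "x \<in> S" "h - 1 \<le> x" "x < h - 1 + h" "h - 1 \<le> y" "y < h - 1 + h" for x y
      using rot_closed[of "h - 1" h b S x y] b_app(1) S(4) that by simp
    have csS: "cs ! j \<in> S" if "i < e" "cs ! i \<in> S" "j < e" for i j
      using cyclic_closed[of e a "(!) cs", OF a_app(2) S(3)] that by blast
    have dsS: "ds ! j \<in> S" if "i < e" "ds ! i \<in> S" "j < e" for i j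
      using cyclic_closed[of e b "(!) ds", OF b_app(2) S(4)] that by blast
    have "[h + 2..<h + 1 + e] ! 0 = h + 2 + 0" by (rule nth_upt) (use e in simp)
    then have c01: "cs ! 0 = 2 * h - 1" "cs ! 1 = h + 2" by (simp_all add: cs_def del: upt_Suc)
    have d0: "ds ! 0 = n - 1" by (simp add: ds_def)
    have d1: "ds ! 1 < h"
    proof -
      have "ds ! 1 = xs ! 0" by (simp add: ds_def)
      moreover have "xs ! 0 \<in> set xs" using xs_len e by simp
      ultimately show ?thesis using xs_range[of "ds ! 1"] by auto
    qed
    obtain x where x: "x \<in> S" "x < n" using S by auto
    have split: "y < h \<or> h - 1 \<le> y \<and> y < h - 1 + h \<or> y = 2 * h - 1 \<or> y = n - 1" if "y < n" for y
      using that n by auto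
    have w: "h - 1 \<in> S"
      using split[OF x(2)]
    proof (elim disjE)
      assume "x < h"
      then show ?thesis using aS[OF x(1)] h0 by simp
    next
      assume "h - 1 \<le> x \<and> x < h - 1 + h"
      then show ?thesis using bS[OF x(1)] h0 by simp
    next
      assume "x = 2 * h - 1"
      then have "h + 2 \<in> S" using csS[of 0 1] c01 x(1) e by simp
      then show ?thesis by (rule bS) (use em(5) e in auto)
    next
      assume "x = n - 1"
      then have "ds ! 1 \<in> S" using dsS[of 0 1] d0 x(1) e by simp
      then show ?thesis by (rule aS[OF _ d1]) (use h0 in simp)
    qed
    have "y \<in> S" if "y < n" for y
      using split[OF that]
    proof (elim disjE)
      assume "y < h"
      then show ?thesis using aS[OF w] h0 by simp
    next
      assume "h - 1 \<le> y \<and> y < h - 1 + h"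
      then show ?thesis using bS[OF w] h0 by simp
    next
      assume y: "y = 2 * h - 1"
      have "cs ! 1 \<in> S" unfolding c01 by (rule bS[OF w]) (use em(5) e in auto)
      then show ?thesis using csS[of 1 0] c01 y e by simp
    next
      assume y: "y = n - 1"
      have "ds ! 1 \<in> S" by (rule aS[OF w]) (use h0 d1 in auto)
      then show ?thesis using dsS[of 1 0] d0 y e by simp
    qed
    then show "S = {..<n}" using S(1) by auto
  qed
  have "generating_pair (2 * h) {..<n} a b"
  proof (rule crossing_generating_pair[OF finite_lessThan ap bp ao bo tr,
        where e = e and w = "h - 1" and v = "e - 1" and u = "h - 1 + e" and A = A and B = B])
    show "(a ^^ e) x = x" if "x \<notin> A" for x
      using permutes_not_in[OF permutes_funpow[OF rot_permutes]] that unfolding ae A_def by blast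
    show "(b ^^ e) x = x" if "x \<notin> B" for x
      using permutes_not_in[OF permutes_funpow[OF rot_permutes]] that unfolding be B_def by blast
    show "A \<inter> B = {h - 1}" using h0 by (auto simp: A_def B_def)
    show "h - 1 \<in> {..<n}" using h_range by auto
    have ape: "(a ^^ e) x = (e + x) mod h" if "x < h" for x
      using rot_funpow[OF that, of e 0] unfolding ae by simp
    have "(e + (h - 1)) mod h = e - 1"
    proof -
      have "e + (h - 1) = (e - 1) + h" using e h0 by simp
      moreover have "(e - 1 + h) mod h = (e - 1) mod h" by (rule mod_add_self2)
      moreover have "(e - 1) mod h = e - 1" by (rule mod_less) (use em(5) in linarith)
      ultimately show ?thesis by (simp only:)
    qed
    then show v: "(a ^^ e) (h - 1) = e - 1" using ape[of "h - 1"] h0 by simp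
    show "(b ^^ e) (h - 1) = h - 1 + e"
      using rot_funpow[of 0 h e "h - 1"] h0 em(5) unfolding be by simp
    fix D assume D: "h - 1 \<in> D" "e - 1 \<in> D" "D \<subseteq> {..<n}"
      "\<And>g p. g \<in> perm_span {a, b} \<Longrightarrow> p \<in> D \<Longrightarrow> g p \<in> D \<Longrightarrow> g ` D \<subseteq> D"
    have "a ^^ e \<in> perm_span {a, b}" by (intro perm_span_funpow perm_span.gen) simp
    then have aeD: "(a ^^ e) ` D \<subseteq> D" using D(4)[of "a ^^ e" "h - 1"] D(1,2) v by simp
    \<comment> \<open>Iterating \<open>a ^^ e\<close> from \<open>h - 1\<close>. At
      \<open>j = m - 1\<close> the iteration arrives at \<open>h - 1 - e\<close>, because
      \<open>e * m\<close> is a multiple of \<open>h\<close>.\<close>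
    have "(e * j + (h - 1)) mod h \<in> D" for j
    proof (induction j)
      case 0
      show ?case using D(1) h0 by simp
    next
      case (Suc j)
      have "(a ^^ e) ((e * j + (h - 1)) mod h) = (e * Suc j + (h - 1)) mod h"
        using ape[of "(e * j + (h - 1)) mod h"] h0 by (simp add: mod_simps ac_simps)
      then show ?case using aeD Suc by (metis image_subset_iff)
    qed
    from this[of "m - 1"] have "(e * (m - 1) + (h - 1)) mod h \<in> D" .
    moreover have "e * (m - 1) + (h - 1) = (h - 1 - e) + h + h"
    proof -
      have "1 \<le> m" using em(4) by (cases m) auto
      then have "e * (m - 1) + e = 2 * h" using em(1) by (metis Suc_diff_1 Suc_le_eq One_nat_def add.commute mult_Suc_right)
      then show ?thesis using em(5) by simp
    qed
    moreover have "(h - 1 - e + h + h) mod h = h - 1 - e"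
    proof -
      have "(h - 1 - e) mod h = h - 1 - e" by (rule mod_less) (use h0 in linarith)
      then show ?thesis by (simp only: mod_add_self2)
    qed
    ultimately have "h - 1 - e \<in> D" by (simp only:)
    then have b1: "b (e - 1) \<in> D" using b_app(3) U(1) D(2) by auto
    then have "b ` D \<subseteq> D" using D(4)[of b "e - 1"] D(2) perm_span.gen[of b "{a, b}"] by simp
    then have bD: "y \<in> D" if "h - 1 \<le> y" "y < h - 1 + h" for y
      using rot_closed[of "h - 1" h b D "h - 1" y] b_app(1) D(1) that h0 by simp
    have "a h \<in> {h, h + 1}" using a_app(3) T(1) by auto
    moreover have "h \<in> D" "h + 1 \<in> D" by (rule bD; use em(5) e in linarith)+
    ultimately show "(\<exists>p\<in>D. a p \<in> D) \<and> (\<exists>p\<in>D. b p \<in> D)"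
      using b1 D(2) by (intro conjI bexI[of _ h] bexI[of _ "e - 1"]) auto
  qed (use e em(5) in linarith)+
  then show ?thesis using ev by blast
qed

section \<open>Even order between the extreme degrees\<close>

text \<open>For even \<open>k\<close> a step of length 2 splits the \<open>k\<close>-cycle into its
  even and its odd points. This is an initial run of \<open>\<rho>\<close> points in the first class
  and of \<open>j\<close> points in the second, so membership changes at few places along such
  steps.\<close>

definition runs :: "nat \<Rightarrow> nat \<Rightarrow> nat set" where
  "runs \<rho> j = (\<lambda>i. 2 * i) ` {..<\<rho>} \<union> (\<lambda>i. 2 * i + 1) ` {..<j}"

lemma runs_iff: "x \<in> runs \<rho> j \<longleftrightarrow> even x \<and> x < 2 * \<rho> \<or> odd x \<and> x < 2 * j"
proof -
  have "(\<exists>i<\<rho>. x = 2 * i) \<longleftrightarrow> even x \<and> x < 2 * \<rho>" by (auto elim!: evenE)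
  moreover have "(\<exists>i<j. x = 2 * i + 1) \<longleftrightarrow> odd x \<and> x < 2 * j" by (auto elim!: oddE)
  ultimately show ?thesis unfolding runs_def by auto
qed

lemma card_runs: "card (runs \<rho> j) = \<rho> + j"
proof -
  have "(\<lambda>i. 2 * i) ` {..<\<rho>} \<inter> (\<lambda>i. 2 * i + 1) ` {..<j} = {}"
    by (auto dest: arg_cong[where f = even])
  then have "card (runs \<rho> j) = card ((\<lambda>i. 2 * i) ` {..<\<rho>}) + card ((\<lambda>i. 2 * i + 1) ` {..<j})"
    unfolding runs_def by (intro card_Un_disjoint) auto
  also have "\<dots> = \<rho> + j" by (simp add: card_image inj_on_def)
  finally show ?thesis .
qed

text \<open>The points of \<open>R\<close> are fixed by the second cycle and their copies by the
  first. A transposition of two copies can thus be multiplied to the first cycle and one of two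
  points of \<open>R\<close> to the second, without changing squares or, \<open>k\<close> being
  even, orders.\<close>

locale toggled = replacement +
  fixes T U :: "nat \<Rightarrow> nat" and p q p' q' w :: nat
  assumes even_k: "even k" and k2: "2 \<le> k" and w: "w < k" "w \<notin> R"
    and T: "T = id \<or> T = transpose (p + k) (q + k)" and pq: "p \<in> R" "q \<in> R"
    and U: "U = id \<or> U = transpose p' q'" and pq': "p' \<in> R" "q' \<in> R"
begin

definition a where "a = rot 0 k \<circ> T"
definition b where "b = rot_rep k R \<circ> U"

lemma alpha: "rot 0 k permutes {..<k}"
  using rot_permutes[of 0 k] by (simp add: lessThan_atLeast0)

lemma beta: "rot_rep k R permutes (rep_set k R - R)"
  by (rule permutes_superset[OF rot_rep_permutes]) (use rot_rep_apply(2) in auto)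

lemma T_perm: "T permutes {p + k, q + k}" and U_perm: "U permutes {p', q'}"
  using toggle_props(1)[OF T] toggle_props(1)[OF U] by auto

lemma T_disj: "{..<k} \<inter> {p + k, q + k} = {}" and U_disj: "(rep_set k R - R) \<inter> {p', q'} = {}"
  using pq' by auto

lemma a_permutes: "a permutes rep_set k R"
  unfolding a_def
  by (intro permutes_compose permutes_subset[OF T_perm] rot_permutes_rep) (use pq in \<open>auto simp: rep_set_def\<close>)

lemma b_permutes: "b permutes rep_set k R"
  unfolding b_def
  by (intro permutes_compose permutes_subset[OF U_perm] rot_rep_permutes)
    (use pq' less in \<open>auto simp: rep_set_def\<close>)

lemma a_order: "has_order k a"
  unfolding a_def
  by (rule has_order_disjoint_comp[OF alpha T_perm T_disj rot_has_order
        funpow_even_id[OF toggle_props(2)[OF T] even_k]])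

lemma b_order: "has_order k b"
  unfolding b_def
  by (rule has_order_disjoint_comp[OF beta U_perm U_disj rot_rep_has_order
        funpow_even_id[OF toggle_props(2)[OF U] even_k]])

lemma a_sq: "a ^^ 2 = rot 0 k ^^ 2"
  unfolding a_def funpow_comp_commute[OF permutes_disjoint_commute[OF alpha T_perm T_disj]]
    toggle_props(2)[OF T] by simp

lemma b_sq: "b ^^ 2 = rot_rep k R ^^ 2"
  unfolding b_def funpow_comp_commute[OF permutes_disjoint_commute[OF beta U_perm U_disj]]
    toggle_props(2)[OF U] by simp

lemma a_less: "x < k \<Longrightarrow> a x = Suc x mod k"
  using permutes_not_in[OF T_perm, of x] rot_pow(1)[of x 1] by (auto simp: a_def)

lemma a_new: "a (i + k) = T (i + k)"
proof -
  have "T (i + k) \<in> {i + k, p + k, q + k}" using T by (auto simp: transpose_def split: if_splits)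
  then show ?thesis by (auto simp: a_def rot_apply)
qed

lemma b_rep: "i < k \<Longrightarrow> b (rep k R i) = rep k R (Suc i mod k)"
proof -
  assume i: "i < k"
  have "rep k R i \<notin> {p', q'}" using pq' less i by (auto simp: rep_def)
  then have "U (rep k R i) = rep k R i" using permutes_not_in[OF U_perm] by blast
  then show ?thesis using rot_rep_apply(1)[OF i] by (simp add: b_def)
qed

lemma b_R: "i \<in> R \<Longrightarrow> b i = U i"
proof -
  assume i: "i \<in> R"
  have "U i \<in> {i, p', q'}" using U by (auto simp: transpose_def split: if_splits)
  then have "U i \<in> R" using i pq' by auto
  then show ?thesis using rot_rep_apply(2) by (simp add: b_def)
qed

lemma transitive_ab: "transitive_pair (rep_set k R) a b"
  by (rule transitive[OF a_less b_rep w])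

lemma finite_rep: "finite (rep_set k R)"
  unfolding rep_set_def using finite_subset[OF R] by simp

lemma bij: "bij a" "bij b" "bij (a ^^ 2)" "bij (b ^^ 2)"
  using permutes_bij[OF a_permutes] permutes_bij[OF b_permutes] bij_fn by auto

lemma a2: "x < k \<Longrightarrow> (a ^^ 2) x = (x + 2) mod k"
  unfolding a_sq by (rule rot_pow(1))

lemma b2: "i < k \<Longrightarrow> (b ^^ 2) (rep k R i) = rep k R ((i + 2) mod k)"
  unfolding b_sq by (rule rot_rep_pow(1))

lemma span: "a \<in> perm_span {a, b}" "b \<in> perm_span {a, b}"
  "a ^^ 2 \<in> perm_span {a, b}" "b ^^ 2 \<in> perm_span {a, b}"
  by (auto intro: perm_span.gen perm_span_funpow)

definition c where "c = a ^^ 2 \<circ> b ^^ 2 \<circ> inv' (a ^^ 2) \<circ> inv' (b ^^ 2)"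

lemma c_span: "c \<in> perm_span {a, b}"
  unfolding c_def by (intro commutator_conj_in_span span)

lemma bij_c: "bij c"
  unfolding c_def by (intro bij_comp bij_imp_bij_inv bij)

text \<open>Two steps back along the \<open>k\<close>-cycle; the second branch wraps around.\<close>

definition pr where "pr i = (if 2 \<le> i then i - 2 else i + k - 2)"

lemma pr: "i < k \<Longrightarrow> pr i < k" "i < k \<Longrightarrow> (pr i + 2) mod k = i"
proof -
  assume i: "i < k"
  then show "pr i < k" using k2 by (auto simp: pr_def)
  show "(pr i + 2) mod k = i"
  proof (cases "2 \<le> i")
    case False
    then have "pr i + 2 = i + k" using k2 by (simp add: pr_def)
    then show ?thesis using i by simp
  qed (use i in \<open>simp add: pr_def\<close>)
qed

text \<open>The case \<open>e = 2\<close> of \<open>commutator_rep\<close>, indexed by the point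
  \<open>i\<close> near which \<open>c\<close> is evaluated instead of by the point one or two
  double steps earlier.\<close>

lemma c_rules:
  assumes "i < k"
  shows "pr i \<notin> R \<Longrightarrow> pr (pr i) \<notin> R \<Longrightarrow> c (rep k R i) = i"
    "pr i \<notin> R \<Longrightarrow> i \<in> R \<Longrightarrow> c i = i + k"
    "pr i \<in> R \<Longrightarrow> i \<in> R \<Longrightarrow> c i = i"
    "pr i \<in> R \<Longrightarrow> i \<in> R \<Longrightarrow> c (i + k) = i + k"
    "pr (pr i) \<in> R \<Longrightarrow> pr i \<notin> R \<Longrightarrow> c (rep k R i) = pr i"
    "pr i \<in> R \<Longrightarrow> i \<notin> R \<Longrightarrow> c i = (i + 2) mod k"
proof -
  note q1 = pr(1)[OF assms] and e1 = pr(2)[OF assms]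
  note q2 = pr(1)[OF q1] and e2 = pr(2)[OF q1]
  note A = commutator_rep[where e = 2, folded a_sq b_sq, folded c_def, OF q1, unfolded e1]
    and B = commutator_rep[where e = 2, folded a_sq b_sq, folded c_def, OF q2, unfolded e2 e1]
  show "pr i \<notin> R \<Longrightarrow> pr (pr i) \<notin> R \<Longrightarrow> c (rep k R i) = i" by (rule B(1))
  show "pr i \<notin> R \<Longrightarrow> i \<in> R \<Longrightarrow> c i = i + k" by (rule A(2))
  show "pr i \<in> R \<Longrightarrow> i \<in> R \<Longrightarrow> c i = i" by (rule A(3))
  show "pr i \<in> R \<Longrightarrow> i \<in> R \<Longrightarrow> c (i + k) = i + k" by (rule A(4))
  show "pr (pr i) \<in> R \<Longrightarrow> pr i \<notin> R \<Longrightarrow> c (rep k R i) = pr i" by (rule B(5))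
  show "pr i \<in> R \<Longrightarrow> i \<notin> R \<Longrightarrow> c i = (i + 2) mod k" by (rule A(6))
qed

lemma c_fixed:
  assumes "x \<notin> R" "pr x \<notin> R" "pr (pr x) \<notin> R" "x < k"
  shows "c x = x"
  using c_rules(1)[OF assms(4)] assms by (simp add: rep_def)

lemma c_outside: "x \<notin> rep_set k R \<Longrightarrow> c x = x"
  using commutator_rep_outside[of x 2] unfolding c_def a_sq b_sq .

lemma a2_closed:
  assumes "\<And>g p. g \<in> perm_span {a, b} \<Longrightarrow> p \<in> D \<Longrightarrow> g p \<in> D \<Longrightarrow> g ` D \<subseteq> D"
    "x \<in> D" "a x \<in> D" "x < k" "y < k"
  shows "y \<in> D"
  using cyclic_closed[of k a "\<lambda>i. i" D x y] a_less assms span(1) by blast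

end

lemma toggled_parity:
  assumes "replacement k R" "p \<in> R" "q \<in> R" "p \<noteq> q" "p' \<in> R" "q' \<in> R" "p' \<noteq> q'"
  shows "\<exists>T U. (T = id \<or> T = transpose (p + k) (q + k)) \<and> (U = id \<or> U = transpose p' q') \<and>
     evenperm (rot 0 k \<circ> T) = pa \<and> evenperm (rot_rep k R \<circ> U) = pb"
proof -
  interpret replacement k R by fact
  have fin: "finite (rep_set k R)" unfolding rep_set_def using finite_subset[OF R] by simp
  have "permutation (rot 0 k)" by (rule permutes_imp_permutation[OF fin rot_permutes_rep])
  moreover have "permutation (rot_rep k R)" by (rule permutes_imp_permutation[OF fin rot_rep_permutes])
  moreover have "p + k \<noteq> q + k" using assms(4) by simp
  ultimately show ?thesis using toggle_parity assms(7) by metis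
qed

text \<open>Among the even points only \<open>k - 2\<close> is shared, so the two ends of the even
  run meet and \<open>c\<close> is a 3-cycle there. On the odd points the ends stay apart because
  \<open>j + 2 \<le> h\<close>, and \<open>c\<close> acts by transpositions or trivially. Hence
  \<open>c ^^ 4\<close> is the 3-cycle alone.\<close>

lemma (in toggled) generating_pair_three:
  assumes h: "k = 2 * h" "3 \<le> h" and j: "j + 2 \<le> h" and R_eq: "R = runs (h - 1) j"
    and T': "p = 0" "q = 2" and U': "p' = 0" "q' = 2"
  shows "generating_pair k (rep_set k R) a b"
proof -
  have inR: "x \<in> R \<longleftrightarrow> even x \<and> x < k - 2 \<or> odd x \<and> x < 2 * j" for x
  proof -
    have "2 * (h - 1) = k - 2" using h by simp
    then show ?thesis unfolding R_eq runs_iff by simp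
  qed
  have k6: "6 \<le> k" using h by simp
  have pr0: "pr 0 = k - 2" "pr (k - 2) = k - 4" using k6 by (auto simp: pr_def)
  have R0: "0 \<in> R" "k - 2 \<notin> R" "k - 4 \<in> R" using k6 even_k by (auto simp: inR)
  have c0: "c 0 = k" using c_rules(2)[of 0] pr0 R0 k6 by simp
  have c1: "c k = k - 2" using c_rules(5)[of 0] pr0 R0 k6 by (simp add: rep_def)
  have c2: "c (k - 2) = 0"
  proof -
    have "k - 2 + 2 = k" using k6 by linarith
    then have "(k - 2 + 2) mod k = 0" by (simp only: mod_self)
    then show ?thesis using c_rules(6)[of "k - 2"] pr0 R0 k6 by simp
  qed
  have d: "distinct [0, k, k - 2]" using k6 by auto
  have c4: "c ^^ 4 = cyc3 0 k (k - 2)"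
  proof (rule cyc3_eqI[OF d])
    show "(c ^^ 4) 0 = k" "(c ^^ 4) k = k - 2" "(c ^^ 4) (k - 2) = 0"
      using c0 c1 c2 by (simp_all add: numeral_eq_Suc)
    fix x assume x: "x \<noteq> 0" "x \<noteq> k" "x \<noteq> k - 2"
    have "c (c x) = x"
    proof (cases "x \<in> rep_set k R")
      case False
      then show ?thesis using c_outside by simp
    next
      case True
      \<comment> \<open>One transposition for each end of the odd run.\<close>
      have odd_start: "c 1 = 1 + k" "c (1 + k) = 1" "c (2 * j + 1) = 2 * j + 3" "c (2 * j + 3) = 2 * j + 1"
        if "0 < j"
      proof -
        have "pr 1 = k - 1" "pr (k - 1) = k - 3" using k6 by (auto simp: pr_def)
        then show "c 1 = 1 + k" "c (1 + k) = 1"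
          using c_rules(2)[of 1] c_rules(1)[of 1] k6 that j h even_k by (auto simp: inR rep_def)
        have "pr (2 * j + 1) = 2 * j - 1" "pr (2 * j + 3) = 2 * j + 1" using that by (auto simp: pr_def)
        then show "c (2 * j + 1) = 2 * j + 3" "c (2 * j + 3) = 2 * j + 1"
          using c_rules(6)[of "2 * j + 1"] c_rules(5)[of "2 * j + 3"] k6 that j h
          by (auto simp: inR rep_def)
      qed
      have odd_mid: "c i = i" "c (i + k) = i + k" if "i \<in> R" "i \<noteq> 0" "i \<noteq> 1" for i
      proof -
        have "pr i \<in> R" using that by (auto simp: inR pr_def)
        then show "c i = i" "c (i + k) = i + k" using c_rules(3,4)[of i] that less by auto
      qed
      from True show ?thesis
      proof (cases rule: rep_setE)
        case (1 i)
        show ?thesis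
        proof (cases "i \<in> R")
          case True
          then show ?thesis using 1 x odd_mid[of i] odd_start j by (cases "i = 1") (auto simp: inR)
        next
          case False
          then have ni: "\<not> (even i \<and> i < k - 2)" "\<not> (odd i \<and> i < 2 * j)" using inR by auto
          have "i < k" "i \<noteq> k - 2" using 1 x by auto
          then have io: "odd i" using ni(1) even_k k6 by presburger
          then have "2 * j < i" using ni(2) by presburger
          note io = io this
          show ?thesis
          proof (cases "0 < j \<and> (i = 2 * j + 1 \<or> i = 2 * j + 3)")
            case True
            then show ?thesis using odd_start 1 by auto
          next
            case nsp: False
            have "c i = i"
            proof (rule c_fixed[OF False])
              show "i < k" by fact
              have odd_pr: "odd (pr x)" if "odd x" for x using that even_k k2 by (auto simp: pr_def)
              have "\<not> pr i < 2 * j \<and> \<not> pr (pr i) < 2 * j"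
              proof (cases "j = 0")
                case False
                then have "2 * j + 4 < i" using io nsp by presburger
                then have "pr i = i - 2" "pr (i - 2) = i - 4" "\<not> i - 2 < 2 * j" "\<not> i - 4 < 2 * j"
                  by (auto simp: pr_def)
                then show ?thesis by simp
              qed simp
              then show "pr i \<notin> R" "pr (pr i) \<notin> R"
                using odd_pr[OF io(1)] odd_pr[OF odd_pr[OF io(1)]] by (auto simp: inR)
            qed
            then show ?thesis using 1 by simp
          qed
        qed
      next
        case (2 i)
        then show ?thesis using x odd_mid[of i] odd_start j by (cases "i = 1") (auto simp: inR)
      qed
    qed
    then show "(c ^^ 4) x = x" by (simp add: numeral_eq_Suc)
  qed
  have cyc: "cyc3 0 k (k - 2) \<in> perm_span {a, b}"
    unfolding c4[symmetric] by (rule perm_span_funpow[OF c_span])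
  have in_set: "0 \<in> rep_set k R" "k \<in> rep_set k R" "k - 2 \<in> rep_set k R"
    using k6 inR[of 0] by (auto simp: rep_set_def)
  have "has_three_cycles (perm_span {a, b}) (rep_set k R)"
  proof (rule all_three_cycles[OF finite_rep a_permutes b_permutes transitive_ab in_set d cyc])
    fix D assume D: "{0, k, k - 2} \<subseteq> D" "D \<subseteq> rep_set k R"
      "\<And>g p. g \<in> perm_span {a, b} \<Longrightarrow> p \<in> D \<Longrightarrow> g p \<in> D \<Longrightarrow> g ` D \<subseteq> D"
    have "k - 2 + 2 = k" using k6 by linarith
    then have mod: "(k - 2 + 2) mod k = 0" by (simp only: mod_self)
    \<comment> \<open>The square of each generator maps \<open>k - 2\<close> to another point of the
      3-cycle and so preserves \<open>D\<close>. One more application gives \<open>2\<close> and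
      \<open>2 + k\<close> in \<open>D\<close>, the partners of \<open>0\<close> and
      \<open>k\<close> in the optional transpositions.\<close>
    have "(a ^^ 2) (k - 2) = 0" using a2[of "k - 2"] mod k6 by simp
    then have aD: "(a ^^ 2) ` D \<subseteq> D" using D(3)[OF span(3), of "k - 2"] D(1) by auto
    have "rep k R (k - 2) = k - 2" "rep k R 0 = k" using R0 by (simp_all add: rep_def)
    then have "(b ^^ 2) (k - 2) = k"
      using b2[of "k - 2", unfolded mod] k6 by simp
    then have bD: "(b ^^ 2) ` D \<subseteq> D" using D(3)[OF span(4), of "k - 2"] D(1) by auto
    have "(a ^^ 2) 0 = 2" "(b ^^ 2) k = 2 + k"
      using a2[of 0] b2[of 0] k6 by (auto simp: rep_def inR)
    then have "2 \<in> D" "2 + k \<in> D" using aD bD D(1) by (metis image_subset_iff insert_subset)+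
    moreover have "a k \<in> {k, 2 + k}" using a_new[of 0] T unfolding T' by auto
    moreover have "b 0 \<in> {0, 2}" using b_R[of 0] U k6 unfolding U' by (auto simp: inR)
    ultimately show "(\<exists>p\<in>D. a p \<in> D) \<and> (\<exists>p\<in>D. b p \<in> D)"
      using D(1) by (intro conjI bexI[of _ k] bexI[of _ 0]) auto
  qed
  then show ?thesis
    unfolding generating_pair_def using a_permutes b_permutes a_order b_order by blast
qed

text \<open>The odd points lie all in \<open>R\<close> or all outside, so membership never changes
  along them and \<open>c\<close> moves only points near the ends of the even run: \<open>0\<close>,
  \<open>k\<close>, \<open>2 * \<rho>\<close> and \<open>2 * \<rho> + 2\<close>. An element that
  fixes \<open>k\<close> and sends the other three to odd points makes the conjugate of
  \<open>c\<close> meet \<open>c\<close> in \<open>k\<close> alone.\<close>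

lemma (in toggled) generating_pair_double:
  assumes h: "k = 2 * h" and \<rho>: "1 \<le> \<rho>" "\<rho> + 2 \<le> h" and R_eq: "R = runs \<rho> j"
    and j: "j = 0 \<and> 2 \<le> \<rho> \<and> p = 0 \<and> q = 2 \<and> p' = 0 \<and> q' = 2
      \<or> j = h \<and> p = 1 \<and> q = 3 \<and> p' = 1 \<and> q' = 3"
  shows "generating_pair k (rep_set k R) a b"
proof -
  have k6: "6 \<le> k" using h \<rho> by simp
  have even_R: "x \<in> R \<longleftrightarrow> x < 2 * \<rho>" if "even x" for x
    unfolding R_eq runs_iff using that by simp
  have odd_R: "x \<in> R \<longleftrightarrow> j = h" if "odd x" "x < k" for x
    unfolding R_eq runs_iff using that j h \<rho> by auto
  have pr_even: "even (pr x) \<longleftrightarrow> even x" for x using even_k k2 by (auto simp: pr_def)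
  have pr0: "pr 0 = k - 2" "pr (k - 2) = k - 4" using k6 by (auto simp: pr_def)
  have R0: "0 \<in> R" "k - 2 \<notin> R" "k - 4 \<notin> R" using \<rho> h even_R[of 0] even_R[of "k - 2"] even_R[of "k - 4"] by auto
  have ck: "c k = 0" using c_rules(1)[of 0] pr0 R0 k6 by (simp add: rep_def)
  have nR: "2 * \<rho> \<notin> R" "2 * \<rho> + 2 \<notin> R" "2 * \<rho> - 2 \<in> R" using even_R \<rho> by auto
  have pr\<rho>: "pr (2 * \<rho>) = 2 * \<rho> - 2" "pr (2 * \<rho> + 2) = 2 * \<rho>" using \<rho> by (auto simp: pr_def)
  have cfix: "c x = x" if x: "x \<notin> {0, k, 2 * \<rho>, 2 * \<rho> + 2}" for x
  proof (cases "x \<in> rep_set k R")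
    case False
    then show ?thesis by (rule c_outside)
  next
    case True
    have old: "c i = i \<and> (i \<in> R \<longrightarrow> c (i + k) = i + k)" if i: "i < k" "i \<noteq> 0" "i \<noteq> 2 * \<rho>" "i \<noteq> 2 * \<rho> + 2" for i
    proof (cases "i \<in> R")
      case True
      have "pr i \<in> R"
      proof (cases "even i")
        case True
        then have "2 \<le> i" using i by (auto elim!: evenE)
        then show ?thesis using even_R[of "pr i"] even_R[of i] \<open>i \<in> R\<close> pr_even[of i] True by (auto simp: pr_def)
      next
        case False
        then show ?thesis using odd_R[of i] odd_R[of "pr i"] pr(1)[of i] pr_even[of i] i True by auto
      qed
      then show ?thesis using c_rules(3,4)[OF i(1)] True by auto
    next
      case False
      have "pr i \<notin> R \<and> pr (pr i) \<notin> R"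
      proof (cases "even i")
        case True
        then have "2 * \<rho> < i" using even_R[of i] False i by auto
        then have "2 * \<rho> + 4 \<le> i" using True i(4) by presburger
        then have "pr i = i - 2" "pr (i - 2) = i - 4" by (auto simp: pr_def)
        then show ?thesis
          using even_R[of "i - 2"] even_R[of "i - 4"] True \<open>2 * \<rho> + 4 \<le> i\<close> by auto
      next
        case odd: False
        then show ?thesis
          using odd_R[of i] odd_R[of "pr i"] odd_R[of "pr (pr i)"] pr(1)[of i] pr(1)[of "pr i"]
            pr_even[of i] pr_even[of "pr i"] i False by auto
      qed
      then show ?thesis using c_fixed[OF False _ _ i(1)] False by auto
    qed
    from True show ?thesis
    proof (cases rule: rep_setE)
      case (1 i)
      then show ?thesis using old[of i] x by auto
    next
      case (2 i)
      have "i \<noteq> 2 * \<rho>" "i \<noteq> 2 * \<rho> + 2" "i \<noteq> 0" using 2 nR x by auto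
      then show ?thesis using old[of i] less[OF 2(1)] 2 by auto
    qed
  qed
  obtain g where g: "g \<in> perm_span {a, b}" "bij g" "g k = k" "g 0 \<in> {1, k - 1}" "odd (g (2 * \<rho>))"
    "odd (g (2 * \<rho> + 2))" "g (2 * \<rho>) < k" "g (2 * \<rho> + 2) < k"
  proof (cases "T k = k")
    case True
    then have "a k = k" using a_new[of 0] by simp
    moreover have "a 0 = 1" "a (2 * \<rho>) = 2 * \<rho> + 1" "a (2 * \<rho> + 2) = 2 * \<rho> + 3"
      using a_less[of 0] a_less[of "2 * \<rho>"] a_less[of "2 * \<rho> + 2"] \<rho> h k6 by auto
    ultimately show ?thesis using that[OF span(1) bij(1)] \<rho> h by simp
  next
    case False
    then have jz: "j = 0" "2 \<le> \<rho>" "p = 0" "q = 2" using j T by auto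
    then have Tk: "T k = 2 + k" using T False by auto
    \<comment> \<open>Here \<open>T\<close> makes \<open>a\<close> send \<open>k\<close> to
      \<open>2 + k\<close>, and going back by \<open>b ^^ 2\<close> repairs this. On the odd points
      \<open>b ^^ 2\<close> only adds 2 modulo \<open>k\<close>, so odd values stay odd.\<close>
    define g where "g = inv' (b ^^ 2) \<circ> a"
    have gI: "g x = y" if "(b ^^ 2) y = a x" for x y
      unfolding g_def using bij_inv_eq[OF bij(4) that] by simp
    have odd_b2: "(b ^^ 2) y = (y + 2) mod k" if "odd y" "y < k" for y
    proof -
      have "(y + 2) mod k < k" "odd ((y + 2) mod k)" using that k6 even_k by (auto simp: mod_if)
      then show ?thesis using b2[OF that(2)] odd_R that jz \<rho> by (auto simp: rep_def)
    qed
    have "g k = k"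
    proof (rule gI)
      have "a k = 2 + k" using a_new[of 0] Tk by simp
      moreover have "rep k R 0 = k" "rep k R 2 = 2 + k" using R0 even_R[of 2] jz by (simp_all add: rep_def)
      moreover have "(0 + 2) mod k = 2" using k6 by simp
      ultimately show "(b ^^ 2) k = a k" using b2[of 0] k6 by (metis less_le_trans zero_less_numeral)
    qed
    moreover have "g 0 = k - 1"
    proof (rule gI)
      have "(k - 1 + 2) mod k = 1" using k6 by (simp add: mod_if)
      then show "(b ^^ 2) (k - 1) = a 0" using odd_b2[of "k - 1"] a_less[of 0] even_k k6 by simp
    qed
    moreover have "g (2 * \<rho>) = 2 * \<rho> - 1"
    proof (rule gI)
      have "2 * \<rho> - 1 + 2 = 2 * \<rho> + 1" using \<rho> by simp
      then show "(b ^^ 2) (2 * \<rho> - 1) = a (2 * \<rho>)"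
        using odd_b2[of "2 * \<rho> - 1"] a_less[of "2 * \<rho>"] \<rho> h by simp
    qed
    moreover have "g (2 * \<rho> + 2) = 2 * \<rho> + 1"
      by (rule gI) (use odd_b2[of "2 * \<rho> + 1"] a_less[of "2 * \<rho> + 2"] \<rho> h in simp)
    moreover have "g \<in> perm_span {a, b}" unfolding g_def by (intro perm_span.comp perm_span.inv span)
    moreover have "bij g" unfolding g_def by (intro bij_comp bij_imp_bij_inv bij)
    ultimately show ?thesis using that[of g] \<rho> h by simp
  qed
  define d where "d = g \<circ> c \<circ> inv' g"
  have dbij: "bij d" unfolding d_def by (intro bij_comp bij_imp_bij_inv bij_c g(2))
  have dg: "d (g x) = g (c x)" for x unfolding d_def using g(2) by (simp add: bij_is_inj)
  have d_k: "d k = g 0" using dg[of k] g(3) ck by simp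
  have "odd (g 0)" "g 0 < k" using g(4) even_k k6 by auto
  have only: "x = k" if "c x \<noteq> x" "d x \<noteq> x" for x
  proof -
    obtain y where y: "x = g y" using g(2) by (metis bij_pointE)
    then have "c y \<noteq> y" using dg[of y] that(2) by metis
    then have "y \<in> {0, k, 2 * \<rho>, 2 * \<rho> + 2}" using cfix by blast
    then have "x = k \<or> odd x \<and> x < k" using y g \<open>odd (g 0)\<close> \<open>g 0 < k\<close> by auto
    moreover have "x \<in> {0, k, 2 * \<rho>, 2 * \<rho> + 2}" using cfix that(1) by blast
    ultimately show ?thesis by auto
  qed
  have ne: "c k \<noteq> k" "d k \<noteq> k" using ck d_k \<open>g 0 < k\<close> k6 by auto
  note comm = commutator_single_intersection[OF bij_c dbij ne only, unfolded ck d_k]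
  have d_span: "d \<in> perm_span {a, b}" unfolding d_def by (rule perm_span_conj[OF c_span g(1)])
  have cyc: "cyc3 k 0 (g 0) \<in> perm_span {a, b}"
    using commutator_conj_in_span[OF c_span d_span] comm(1) by metis
  have in_set: "k \<in> rep_set k R" "0 \<in> rep_set k R" "g 0 \<in> rep_set k R"
    using R0 k6 \<open>g 0 < k\<close> by (auto simp: rep_set_def)
  have "has_three_cycles (perm_span {a, b}) (rep_set k R)"
  proof (rule all_three_cycles[OF finite_rep a_permutes b_permutes transitive_ab in_set comm(2) cyc])
    fix D assume D: "{k, 0, g 0} \<subseteq> D" "D \<subseteq> rep_set k R"
      "\<And>g p. g \<in> perm_span {a, b} \<Longrightarrow> p \<in> D \<Longrightarrow> g p \<in> D \<Longrightarrow> g ` D \<subseteq> D"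
    \<comment> \<open>\<open>0\<close> and \<open>g 0\<close> are neighbours on the cycle of
      \<open>a\<close>, so \<open>D\<close> contains all of \<open>{..<k}\<close>.\<close>
    have "\<exists>x\<in>D. x < k \<and> a x \<in> D"
    proof (cases "g 0 = 1")
      case True
      then show ?thesis using a_less[of 0] D(1) k6 by (intro bexI[of _ 0]) auto
    next
      case False
      then have "g 0 = k - 1" using g(4) by auto
      then show ?thesis using a_less[of "k - 1"] D(1) k6 by (intro bexI[of _ "k - 1"]) auto
    qed
    then obtain x where x: "x \<in> D" "x < k" "a x \<in> D" by blast
    have "2 \<in> D" by (rule a2_closed[OF D(3) x(1,3,2)]) (use k6 in auto)
    moreover have "b 0 \<in> {0, 2}" using b_R[OF R0(1)] U j by auto
    ultimately show "(\<exists>p\<in>D. a p \<in> D) \<and> (\<exists>p\<in>D. b p \<in> D)"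
      using D(1) x by (intro conjI bexI[of _ x] bexI[of _ 0]) auto
  qed
  then show ?thesis
    unfolding generating_pair_def using a_permutes b_permutes a_order b_order by blast
qed

lemma even_middle:
  assumes ek: "even k" "6 \<le> k" and r: "2 \<le> r" "r + 2 \<le> k"
  shows "\<exists>(\<Omega> :: nat set) a b. finite \<Omega> \<and> card \<Omega> = k + r \<and> generating_pair k \<Omega> a b \<and>
     evenperm a = pa \<and> evenperm b = pb"
proof -
  obtain h where h: "k = 2 * h" using ek(1) by blast
  have h3: "3 \<le> h" using h ek(2) by simp
  have card: "finite (rep_set k (runs \<rho> j)) \<and> card (rep_set k (runs \<rho> j)) = k + (\<rho> + j)" for \<rho> j
  proof -
    have "rep_set k (runs \<rho> j) = {..<k} \<union> (\<lambda>i. i + k) ` runs \<rho> j" unfolding rep_set_def ..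
    moreover have "finite (runs \<rho> j)" unfolding runs_def by simp
    moreover have "card ({..<k} \<union> (\<lambda>i. i + k) ` runs \<rho> j) = card {..<k} + card ((\<lambda>i. i + k) ` runs \<rho> j)"
      by (rule card_Un_disjoint) (use \<open>finite (runs \<rho> j)\<close> in auto)
    moreover have "card ((\<lambda>i. i + k) ` runs \<rho> j) = \<rho> + j"
      using card_image[of "\<lambda>i. i + k" "runs \<rho> j"] card_runs[of \<rho> j] by (simp add: inj_on_def)
    ultimately show ?thesis by simp
  qed
  \<comment> \<open>For \<open>r\<close> from \<open>h - 1\<close> to \<open>2 * h - 3\<close> the
    even run can have length \<open>h - 1\<close>. Smaller \<open>r\<close> use even points only.
    For \<open>r = 2 * h - 2\<close> every odd point is replaced, together with all even points but
    two.\<close>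
  consider (three) "h - 1 \<le> r" "r \<le> 2 * h - 3" | (low) "r + 2 \<le> h" | (high) "r = 2 * h - 2"
    using r h by linarith
  then show ?thesis
  proof cases
    case three
    define j where "j = r - (h - 1)"
    define R where "R = runs (h - 1) j"
    have rep: "replacement k R"
      unfolding R_def by unfold_locales (use ek three h j_def in \<open>auto simp: runs_iff\<close>)
    have mem: "0 \<in> R" "2 \<in> R" "k - 1 \<notin> R"
      unfolding R_def runs_iff using h3 h three j_def by auto
    obtain T U where TU: "T = id \<or> T = transpose (0 + k) (2 + k)" "U = id \<or> U = transpose 0 2"
      "evenperm (rot 0 k \<circ> T) = pa" "evenperm (rot_rep k R \<circ> U) = pb"
      using toggled_parity[OF rep mem(1,2) _ mem(1,2)] by (metis zero_neq_numeral)
    interpret replacement k R by (rule rep)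
    interpret toggled k R T U 0 2 0 2 "k - 1"
      by unfold_locales (use ek TU mem in auto)
    have "generating_pair k (rep_set k R) a b"
    proof (rule generating_pair_three[OF h h3, of j])
      show "j + 2 \<le> h" using three h3 unfolding j_def by linarith
    qed (use R_def in auto)
    moreover have "h - 1 + j = r" using three j_def by simp
    moreover have "evenperm a = pa" "evenperm b = pb" using TU unfolding a_def b_def by auto
    ultimately show ?thesis
      using card[of "h - 1" j, folded R_def] by metis
  next
    case low
    define R where "R = runs r 0"
    have rep: "replacement k R"
      unfolding R_def by unfold_locales (use ek low h in \<open>auto simp: runs_iff\<close>)
    have mem: "0 \<in> R" "2 \<in> R" "k - 1 \<notin> R"
      unfolding R_def runs_iff using h3 h low r by auto
    obtain T U where TU: "T = id \<or> T = transpose (0 + k) (2 + k)" "U = id \<or> U = transpose 0 2"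
      "evenperm (rot 0 k \<circ> T) = pa" "evenperm (rot_rep k R \<circ> U) = pb"
      using toggled_parity[OF rep mem(1,2) _ mem(1,2)] by (metis zero_neq_numeral)
    interpret replacement k R by (rule rep)
    interpret toggled k R T U 0 2 0 2 "k - 1"
      by unfold_locales (use ek TU mem in auto)
    have "generating_pair k (rep_set k R) a b"
      by (rule generating_pair_double[OF h, of r 0]) (use low r R_def in auto)
    moreover have "evenperm a = pa" "evenperm b = pb" using TU unfolding a_def b_def by auto
    moreover have "r + 0 = r" by simp
    ultimately show ?thesis
      using card[of r 0, folded R_def] by metis
  next
    case high
    define R where "R = runs (h - 2) h"
    have rep: "replacement k R"
      unfolding R_def by unfold_locales (use ek h h3 in \<open>auto simp: runs_iff\<close>)
    have mem: "1 \<in> R" "3 \<in> R" "k - 2 \<notin> R"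
      unfolding R_def runs_iff using h3 h by auto
    obtain T U where TU: "T = id \<or> T = transpose (1 + k) (3 + k)" "U = id \<or> U = transpose 1 3"
      "evenperm (rot 0 k \<circ> T) = pa" "evenperm (rot_rep k R \<circ> U) = pb"
      using toggled_parity[OF rep mem(1,2) _ mem(1,2)] by (metis numeral_eq_one_iff semiring_norm(86))
    interpret replacement k R by (rule rep)
    interpret toggled k R T U 1 3 1 3 "k - 2"
      by unfold_locales (use ek TU mem in auto)
    have "generating_pair k (rep_set k R) a b"
      by (rule generating_pair_double[OF h, of "h - 2" h]) (use h3 R_def in auto)
    moreover have "h - 2 + h = r" using high h3 by simp
    moreover have "evenperm a = pa" "evenperm b = pb" using TU unfolding a_def b_def by auto
    ultimately show ?thesis
      using card[of "h - 2" h, folded R_def] by metis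
  qed
qed

section \<open>Order 3 and small degrees\<close>

text \<open>A table of values, so that the properties of concrete permutations can be
  evaluated.\<close>

definition list_perm :: "nat list \<Rightarrow> nat \<Rightarrow> nat" where
  "list_perm ys x = (if x < length ys then ys ! x else x)"

lemma list_perm_permutes:
  assumes "distinct ys" "\<forall>y\<in>set ys. y < length ys"
  shows "list_perm ys permutes {..<length ys}"
proof (rule bij_imp_permutes)
  have "inj_on (list_perm ys) {..<length ys}"
    by (rule inj_onI) (use assms(1) in \<open>simp add: list_perm_def nth_eq_iff_index_eq\<close>)
  moreover have "list_perm ys ` {..<length ys} \<subseteq> {..<length ys}"
    using assms(2) by (auto simp: list_perm_def)
  ultimately show "bij_betw (list_perm ys) {..<length ys} {..<length ys}"
    unfolding bij_betw_def using endo_inj_surj[of "{..<length ys}" "list_perm ys"] by blast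
qed (simp add: list_perm_def)

lemma list_perm_order_3:
  assumes "\<forall>x<length ys. list_perm ys (list_perm ys (list_perm ys x)) = x"
    and "list_perm ys z \<noteq> z"
  shows "has_order 3 (list_perm ys)"
proof (rule has_orderI)
  show "list_perm ys ^^ 3 = id"
  proof
    fix x
    show "(list_perm ys ^^ 3) x = id x"
      using assms(1) by (cases "x < length ys") (auto simp: eval_nat_numeral list_perm_def)
  qed
  fix i :: nat assume "0 < i" "i < 3"
  then have "i = 1 \<or> i = 2" by auto
  moreover have "list_perm ys (list_perm ys z) \<noteq> z"
  proof
    assume "list_perm ys (list_perm ys z) = z"
    moreover have "z < length ys" using assms(2) by (auto simp: list_perm_def split: if_splits)
    ultimately show False using assms by metis
  qed
  ultimately show "(list_perm ys ^^ i) z \<noteq> z" using assms(2) by (auto simp: numeral_2_eq_2)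
qed

text \<open>Invariant for order 3: \<open>a b\<close> consists of the 3-cycle \<open>(x y z)\<close>, a cycle listed by \<open>xs\<close> and
  cycles of length at most 2; a further 3-cycle can be attached at an end of \<open>xs\<close>, lengthening \<open>xs\<close> by 2.\<close>

definition triangles :: "nat \<Rightarrow> (nat \<Rightarrow> nat) \<Rightarrow> (nat \<Rightarrow> nat) \<Rightarrow> nat \<Rightarrow> nat \<Rightarrow> nat \<Rightarrow> nat list \<Rightarrow> bool" where
  "triangles n a b x y z xs \<longleftrightarrow> a permutes {..<n} \<and> b permutes {..<n} \<and> has_order 3 a \<and> has_order 3 b \<and>
     transitive_pair {..<n} a b \<and> distinct [x, y, z] \<and> x < n \<and> y < n \<and> z < n \<and>
     (a \<circ> b) x = y \<and> (a \<circ> b) y = z \<and> (a \<circ> b) z = x \<and> (\<exists>p\<in>{x, y, z}. a p \<in> {x, y, z}) \<and>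
     xs \<noteq> [] \<and> distinct xs \<and> set xs \<subseteq> {..<n} - {x, y, z} \<and> map (a \<circ> b) xs = rotate1 xs \<and>
     (\<forall>w. w \<notin> {x, y, z} \<longrightarrow> w \<notin> set xs \<longrightarrow> (a \<circ> b) ((a \<circ> b) w) = w) \<and>
     (a (hd xs) = hd xs \<or> b (last xs) = last xs)"

lemma cyc3_permutes: "distinct [x, y, z] \<Longrightarrow> cyc3 x y z permutes {x, y, z}"
  using cycle_permutes[of "[x, y, z]"] cyc3_cycle_of_list[of x y z] by simp

lemma cyc3_pow3:
  assumes "distinct [x, y, z]"
  shows "cyc3 x y z ^^ 3 = id"
proof -
  have "length [x, y, z] = 3" by simp
  then show ?thesis
    using cycle_is_id_root[OF assms] unfolding cyc3_cycle_of_list[OF assms] by metis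
qed

text \<open>As \<open>h\<close> is a fixed point of \<open>f\<close>, the 3-cycle through
  \<open>h\<close> and two new points is disjoint from \<open>f\<close> and keeps the order
  3.\<close>

lemma attach_props:
  assumes f: "f permutes {..<n}" "has_order 3 f" and h: "h < n" "f h = h"
  defines "f' \<equiv> f \<circ> cyc3 h n (Suc n)"
  shows "f' permutes {..<n + 2}" "has_order 3 f'" "f' h = n" "f' n = Suc n" "f' (Suc n) = h"
    "w \<noteq> h \<Longrightarrow> w < n \<Longrightarrow> f' w = f w" "Suc (Suc n) \<le> w \<Longrightarrow> f' w = w"
proof -
  have d: "distinct [h, n, Suc n]" using h by auto
  have fh: "f permutes ({..<n} - {h})"
    by (rule permutes_superset[OF f(1)]) (use h in auto)
  have "has_order 3 (f \<circ> cyc3 h n (Suc n))"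
    by (rule has_order_disjoint_comp[OF fh cyc3_permutes[OF d] _ f(2) cyc3_pow3[OF d]]) auto
  then show "has_order 3 f'" unfolding f'_def .
  show "f' permutes {..<n + 2}"
    unfolding f'_def
    by (rule permutes_compose[OF permutes_subset[OF cyc3_permutes[OF d]] permutes_subset[OF f(1)]])
      (use h in auto)
  have out: "f w = w" if "n \<le> w" for w using permutes_not_in[OF f(1), of w] that by simp
  show "f' h = n" "f' n = Suc n" "f' (Suc n) = h"
    unfolding f'_def using h out by (simp_all add: cyc3_apply(1-3)[OF d])
  show "f' w = f w" if "w \<noteq> h" "w < n"
    unfolding f'_def using cyc3_apply(4)[OF d, of w] that by simp
  show "f' w = w" if "Suc (Suc n) \<le> w"
    unfolding f'_def using cyc3_apply(4)[OF d, of w] that h out by simp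
qed

lemma attach_transitive:
  assumes tr: "transitive_pair {..<n} f g" and fp: "f permutes {..<n}" "g permutes {..<n}"
    and h: "h < n" "f h = h"
    and f': "f' h = n" "f' n = Suc n" "f' (Suc n) = h" "\<And>w. w \<noteq> h \<Longrightarrow> w < n \<Longrightarrow> f' w = f w"
    and S: "S \<subseteq> {..<n + 2}" "S \<noteq> {}" "f' ` S \<subseteq> S" "g ` S \<subseteq> S"
  shows "S = {..<n + 2}"
proof -
  have fS: "f' w \<in> S" if "w \<in> S" for w using that S by blast
  have "S \<inter> {..<n} \<noteq> {}"
  proof -
    obtain w where w: "w \<in> S" using S by blast
    have "w < n \<or> w = n \<or> w = Suc n" using w S(1) by (auto simp: less_Suc_eq)
    then have "w < n \<or> h \<in> S" using fS[OF w] fS[of "Suc n"] f' w by auto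
    then show ?thesis using w h by auto
  qed
  moreover have "f w \<in> S" if "w \<in> S" "w < n" for w
    using fS[OF that(1)] f'(4)[of w] that h by (cases "w = h") auto
  then have "f ` (S \<inter> {..<n}) \<subseteq> S \<inter> {..<n}"
    using permutes_in_image[OF fp(1)] by fastforce
  moreover have "g ` (S \<inter> {..<n}) \<subseteq> S \<inter> {..<n}"
    using S(4) permutes_in_image[OF fp(2)] by fastforce
  ultimately have "S \<inter> {..<n} = {..<n}"
    using tr unfolding transitive_pair_def by (metis inf_le2)
  then have "{..<n} \<subseteq> S" by blast
  moreover have "n \<in> S" "Suc n \<in> S" using fS[of h] fS[of n] f' h \<open>{..<n} \<subseteq> S\<close> by auto
  moreover have "{..<n + 2} = insert (Suc n) (insert n {..<n})" by auto
  ultimately have "{..<n + 2} \<subseteq> S" by simp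
  with S(1) show ?thesis by (rule subset_antisym)
qed

text \<open>A 3-cycle put on \<open>a\<close> at a fixed \<open>hd xs\<close> redirects the arrow
  into that point through the two new points, which are appended to \<open>xs\<close>; put on
  \<open>b\<close> at a fixed \<open>last xs\<close>, it adds one new point at each end. In either
  case the other permutation fixes a suitable new end, so the process can go on.\<close>

lemma triangles_step:
  assumes "triangles n a b x y z xs"
  shows "\<exists>a' b' xs'. triangles (n + 2) a' b' x y z xs' \<and> length xs' = length xs + 2"
proof -
  have ab: "a permutes {..<n}" "b permutes {..<n}" "has_order 3 a" "has_order 3 b" "transitive_pair {..<n} a b"
    and xyz: "distinct [x, y, z]" "x < n" "y < n" "z < n" "(a \<circ> b) x = y" "(a \<circ> b) y = z" "(a \<circ> b) z = x"
    and p: "\<exists>p\<in>{x, y, z}. a p \<in> {x, y, z}"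
    and xs: "xs \<noteq> []" "distinct xs" "set xs \<subseteq> {..<n} - {x, y, z}" "map (a \<circ> b) xs = rotate1 xs"
    and rest: "\<And>w. w \<notin> {x, y, z} \<Longrightarrow> w \<notin> set xs \<Longrightarrow> (a \<circ> b) ((a \<circ> b) w) = w"
    and ends: "a (hd xs) = hd xs \<or> b (last xs) = last xs"
    using assms unfolding triangles_def by auto
  have aout: "a w = w" if "n \<le> w" for w using permutes_not_in[OF ab(1), of w] that by simp
  have bout: "b w = w" if "n \<le> w" for w using permutes_not_in[OF ab(2), of w] that by simp
  have aless: "a w < n \<longleftrightarrow> w < n" and bless: "b w < n \<longleftrightarrow> w < n" for w
    using permutes_in_image[OF ab(1), of w] permutes_in_image[OF ab(2), of w] by auto
  have bp2: "b permutes {..<n + 2}" and ap2: "a permutes {..<n + 2}"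
    by (rule permutes_subset[OF ab(2)] permutes_subset[OF ab(1)]; auto)+
  from ends show ?thesis
  proof
    assume "a (hd xs) = hd xs"
    define h where "h = hd xs"
    obtain ys where ys: "xs = h # ys" using xs(1) unfolding h_def by (cases xs) auto
    have h: "h < n" "a h = h" "h \<notin> {x, y, z}" "h \<notin> set ys"
      using xs ys \<open>a (hd xs) = hd xs\<close> by auto
    define a' where "a' = a \<circ> cyc3 h n (Suc n)"
    note a' = attach_props[OF ab(1,3) h(1,2), folded a'_def]
    define t where "t = a \<circ> b"
    have binh: "t w = h \<longleftrightarrow> b w = h" for w
      using inj_eq[OF permutes_inj[OF ab(1)], of "b w" h] h(2) unfolding t_def by simp
    have t': "(a' \<circ> b) w = (if t w = h then n else t w)" if "w < n" for w
      using a'(3) a'(6)[of "b w"] that bless[of w] binh[of w] unfolding t_def by auto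
    have t'n: "(a' \<circ> b) n = Suc n" "(a' \<circ> b) (Suc n) = h" using a' bout by auto
    have mt: "map t xs = ys @ [h]" using xs(4) ys unfolding t_def by simp
    \<comment> \<open>Only the arrow into \<open>h\<close> changes: it now ends in
      \<open>n\<close>.\<close>
    have "map (a' \<circ> b) xs = map (\<lambda>v. if v = h then n else v) (map t xs)"
      using t' xs(3) by auto
    also have "\<dots> = ys @ [n]" unfolding mt using h(4) by (auto intro!: map_idI)
    finally have m: "map (a' \<circ> b) (xs @ [n, Suc n]) = rotate1 (xs @ [n, Suc n])"
      unfolding map_append using t'n ys by simp
    have "triangles (n + 2) a' b x y z (xs @ [n, Suc n])"
      unfolding triangles_def
    proof (intro conjI)
      show "transitive_pair {..<n + 2} a' b"
        unfolding transitive_pair_def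
        using attach_transitive[OF ab(5,1,2) h(1,2) a'(3-5) a'(6)] by blast
      show "(a' \<circ> b) x = y" "(a' \<circ> b) y = z" "(a' \<circ> b) z = x"
        using t' xyz h(3) unfolding t_def by auto
      obtain q where q: "q \<in> {x, y, z}" "a q \<in> {x, y, z}" using p by blast
      then have "q \<noteq> h" "q < n" using h(3) xyz by blast+
      then have "a' q = a q" by (rule a'(6))
      then show "\<exists>p\<in>{x, y, z}. a' p \<in> {x, y, z}" using q by metis
      show "set (xs @ [n, Suc n]) \<subseteq> {..<n + 2} - {x, y, z}" using xs(3) xyz by auto
      show "distinct (xs @ [n, Suc n])" using xs by auto
      show "\<forall>w. w \<notin> {x, y, z} \<longrightarrow> w \<notin> set (xs @ [n, Suc n]) \<longrightarrow> (a' \<circ> b) ((a' \<circ> b) w) = w"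
      proof (intro allI impI)
        fix w assume w: "w \<notin> {x, y, z}" "w \<notin> set (xs @ [n, Suc n])"
        show "(a' \<circ> b) ((a' \<circ> b) w) = w"
        proof (cases "w < n")
          case True
          have r: "t (t w) = w" using rest w unfolding t_def by auto
          have hxs: "h \<in> set xs" using ys by simp
          have "t h \<in> set xs"
            using mt hxs ys by (metis image_eqI list.set_map rotate1.simps(2) set_rotate1)
          then have "t w \<noteq> h" using r w by auto
          moreover have "w \<noteq> h" using w hxs by auto
          moreover have "t w < n" using True aless bless unfolding t_def by simp
          ultimately show ?thesis using t'[OF True] t'[of "t w"] r by simp
        next
          case False
          then have "Suc (Suc n) \<le> w" using w by auto
          then show ?thesis using bout a'(7)[of w] by simp
        qed
      qed
      show "a' (hd (xs @ [n, Suc n])) = hd (xs @ [n, Suc n]) \<or> b (last (xs @ [n, Suc n])) = last (xs @ [n, Suc n])"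
        using bout by simp
    qed (rule a'(1) bp2 a'(2) ab(4) xyz(1) m | use xyz in simp)+
    then show ?thesis by (intro exI[of _ a'] exI[of _ b] exI[of _ "xs @ [n, Suc n]"]) simp
  next
    assume "b (last xs) = last xs"
    define l where "l = last xs"
    obtain ys where ys: "xs = ys @ [l]" using xs(1) unfolding l_def by (metis append_butlast_last_id)
    have l: "l < n" "b l = l" "l \<notin> {x, y, z}" "l \<notin> set ys"
      using xs ys \<open>b (last xs) = last xs\<close> by auto
    define b' where "b' = b \<circ> cyc3 l n (Suc n)"
    note b' = attach_props[OF ab(2,4) l(1,2), folded b'_def]
    define t where "t = a \<circ> b"
    have t': "(a \<circ> b') w = t w" if "w < n" "w \<noteq> l" for w
      using b'(6)[of w] that unfolding t_def by simp
    have t'n: "(a \<circ> b') l = n" "(a \<circ> b') n = Suc n" "(a \<circ> b') (Suc n) = t l"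
      using b' aout l(2) unfolding t_def by auto
    have mt: "t l # map t ys = ys @ [l]"
      using xs(4) unfolding ys t_def[symmetric] by (cases ys) auto
    have mys: "map (a \<circ> b') ys = map t ys" using t' xs(3) l(4) ys by auto
    have "map (a \<circ> b') (Suc n # xs @ [n]) = (t l # map t ys) @ [n, Suc n]"
      unfolding ys list.map map_append mys t'n by simp
    then have m: "map (a \<circ> b') (Suc n # xs @ [n]) = rotate1 (Suc n # xs @ [n])"
      unfolding mt ys by simp
    have "triangles (n + 2) a b' x y z (Suc n # xs @ [n])"
      unfolding triangles_def
    proof (intro conjI)
      have swap: "transitive_pair {..<n} b a" using ab(5) unfolding transitive_pair_def by blast
      show "transitive_pair {..<n + 2} a b'"
        unfolding transitive_pair_def
        using attach_transitive[OF swap ab(2,1) l(1,2) b'(3-5) b'(6)] by blast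
      show "(a \<circ> b') x = y" "(a \<circ> b') y = z" "(a \<circ> b') z = x"
        using t' xyz l(3) unfolding t_def by auto
      show "set (Suc n # xs @ [n]) \<subseteq> {..<n + 2} - {x, y, z}" using xs(3) xyz by auto
      show "distinct (Suc n # xs @ [n])" using xs by auto
      show "\<forall>w. w \<notin> {x, y, z} \<longrightarrow> w \<notin> set (Suc n # xs @ [n]) \<longrightarrow> (a \<circ> b') ((a \<circ> b') w) = w"
      proof (intro allI impI)
        fix w assume w: "w \<notin> {x, y, z}" "w \<notin> set (Suc n # xs @ [n])"
        show "(a \<circ> b') ((a \<circ> b') w) = w"
        proof (cases "w < n")
          case True
          have r: "t (t w) = w" using rest w unfolding t_def by auto
          have lxs: "l \<in> set xs" using ys by simp
          have "t l \<in> set xs" using arg_cong[OF mt, of set] ys by auto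
          then have "t w \<noteq> l" using r w by auto
          moreover have "w \<noteq> l" using w lxs by auto
          moreover have "t w < n" using True aless bless unfolding t_def by simp
          ultimately show ?thesis using t'[OF True] t'[of "t w"] r by simp
        next
          case False
          then have "Suc (Suc n) \<le> w" using w by auto
          then show ?thesis using aout b'(7)[of w] by simp
        qed
      qed
      show "a (hd (Suc n # xs @ [n])) = hd (Suc n # xs @ [n]) \<or> b' (last (Suc n # xs @ [n])) = last (Suc n # xs @ [n])"
        using aout by simp
    qed (rule ap2 b'(1) ab(3) b'(2) xyz(1) p m | use xyz in simp)+
    then show ?thesis by (intro exI[of _ a] exI[of _ b'] exI[of _ "Suc n # xs @ [n]"]) simp
  qed
qed

lemma triangles_extend:
  assumes "triangles n a b x y z xs"
  shows "\<exists>a b xs'. triangles (n + 2 * i) a b x y z xs' \<and> length xs' = length xs + 2 * i"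
proof (induction i)
  case 0
  show ?case using assms by auto
next
  case (Suc i)
  then obtain a b xs' where "triangles (n + 2 * i) a b x y z xs'" "length xs' = length xs + 2 * i" by blast
  from triangles_step[OF this(1)] this(2) show ?case by (auto simp: algebra_simps)
qed

lemma triangles_generating_pair:
  assumes "triangles n a b x y z xs" "\<not> 3 dvd length xs"
  shows "generating_pair 3 {..<n} a b"
proof -
  have ab: "a permutes {..<n}" "b permutes {..<n}" "has_order 3 a" "has_order 3 b" "transitive_pair {..<n} a b"
    and xyz: "distinct [x, y, z]" "x < n" "y < n" "z < n" "(a \<circ> b) x = y" "(a \<circ> b) y = z" "(a \<circ> b) z = x"
    and p: "\<exists>p\<in>{x, y, z}. a p \<in> {x, y, z}"
    and xs: "map (a \<circ> b) xs = rotate1 xs"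
    and rest: "\<And>w. w \<notin> {x, y, z} \<Longrightarrow> w \<notin> set xs \<Longrightarrow> (a \<circ> b) ((a \<circ> b) w) = w"
    using assms unfolding triangles_def by auto
  define t where "t = a \<circ> b"
  define N where "N = 2 * length xs"
  have N3: "N mod 3 \<noteq> 0" using assms(2) unfolding N_def by presburger
  have rot: "map (t ^^ j) xs = rotate j xs" for j
  proof (induction j)
    case (Suc j)
    have "map (t ^^ Suc j) xs = map t (map (t ^^ j) xs)" by simp
    also have "\<dots> = rotate j (map t xs)" unfolding Suc by (rule rotate_map[symmetric])
    also have "\<dots> = rotate (Suc j) xs" unfolding t_def xs by (simp add: rotate1_rotate_swap)
    finally show ?case .
  qed simp
  have idN: "(t ^^ N) w = w" if "w \<notin> {x, y, z}" for w
  proof (cases "w \<in> set xs")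
    case True
    have "map (t ^^ length xs) xs = xs" using rot[of "length xs"] by simp
    then have "(t ^^ length xs) w = w" using True by (metis in_set_conv_nth nth_map)
    then have "((t ^^ length xs) ^^ 2) w = w" by (rule funpow_fixed)
    then show ?thesis unfolding N_def by (simp add: funpow_mult mult.commute)
  next
    case False
    have "(t ^^ 2) w = w" using rest[OF that False] unfolding t_def by (simp add: numeral_2_eq_2)
    then have "((t ^^ 2) ^^ length xs) w = w" by (rule funpow_fixed)
    then show ?thesis unfolding N_def by (simp add: funpow_mult)
  qed
  \<comment> \<open>\<open>N\<close> kills the cycle \<open>xs\<close> and the cycles of length at
    most 2. Its square does so too and is 1 modulo 3, since \<open>N\<close> is prime to 3; so it
    leaves the 3-cycle itself, not its inverse.\<close>
  define M where "M = N * N"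
  have "M mod 3 = 1"
  proof -
    have "N mod 3 = 1 \<or> N mod 3 = 2" using N3 by linarith
    moreover have "M mod 3 = (N mod 3) * (N mod 3) mod 3" unfolding M_def by (rule mod_mult_eq[symmetric])
    ultimately show ?thesis by auto
  qed
  then obtain i where i: "M = 3 * i + 1" by (metis mult_div_mod_eq)
  have pow3: "(t ^^ M) w = t w" if "w \<in> {x, y, z}" for w
  proof -
    have "t w \<in> {x, y, z}" using that xyz unfolding t_def by auto
    then have "(t ^^ 3) (t w) = t w" using xyz unfolding t_def by (auto simp: eval_nat_numeral)
    then have "((t ^^ 3) ^^ i) (t w) = t w" by (rule funpow_fixed)
    then have "(t ^^ (3 * i)) (t w) = t w" unfolding funpow_mult .
    then show ?thesis unfolding i by (simp add: funpow_swap1)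
  qed
  have tM: "t ^^ M = cyc3 x y z"
  proof (rule cyc3_eqI[OF xyz(1)])
    show "(t ^^ M) x = y" "(t ^^ M) y = z" "(t ^^ M) z = x" using pow3 xyz unfolding t_def by auto
    show "(t ^^ M) w = w" if "w \<noteq> x" "w \<noteq> y" "w \<noteq> z" for w
    proof -
      have "(t ^^ N) w = w" by (rule idN) (use that in auto)
      then have "((t ^^ N) ^^ N) w = w" by (rule funpow_fixed)
      then show ?thesis unfolding M_def funpow_mult .
    qed
  qed
  have t_span: "t \<in> perm_span {a, b}" unfolding t_def by (intro perm_span.comp perm_span.gen) auto
  have cyc: "cyc3 x y z \<in> perm_span {a, b}" unfolding tM[symmetric] by (rule perm_span_funpow[OF t_span])
  have "has_three_cycles (perm_span {a, b}) {..<n}"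
  proof (rule all_three_cycles[OF finite_lessThan ab(1,2,5) _ _ _ xyz(1) cyc])
    fix D assume D: "{x, y, z} \<subseteq> D" "D \<subseteq> {..<n}"
      "\<And>g p. g \<in> perm_span {a, b} \<Longrightarrow> p \<in> D \<Longrightarrow> g p \<in> D \<Longrightarrow> g ` D \<subseteq> D"
    obtain q where q: "q \<in> {x, y, z}" "a q \<in> {x, y, z}" using p by blast
    then have "a ` D \<subseteq> D" using D(1) D(3)[of a q] perm_span.gen[of a "{a, b}"] by blast
    \<comment> \<open>On the finite set \<open>D\<close> closure under \<open>a\<close> is
      invariance. Hence \<open>b x\<close>, which \<open>a\<close> maps to \<open>y\<close>, lies in
      \<open>D\<close>.\<close>
    then have "a ` D = D"
      by (intro endo_inj_surj finite_subset[OF D(2)] inj_on_subset[OF permutes_inj[OF ab(1)]]) auto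
    then obtain d where d: "d \<in> D" "a d = y" using D(1) by (metis imageE insert_subset)
    have "a (b x) = y" using xyz(5) by simp
    then have "b x = d" using d(2) inj_eq[OF permutes_inj[OF ab(1)], of "b x" d] by simp
    then show "(\<exists>p\<in>D. a p \<in> D) \<and> (\<exists>p\<in>D. b p \<in> D)"
      using d(1) q D(1) by (intro conjI bexI[of _ q] bexI[of _ x]) auto
  qed (use xyz in auto)
  then show ?thesis using ab unfolding generating_pair_def by blast
qed

section \<open>Small cases checked by evaluation\<close>

lemma successively_closed:
  assumes "successively (\<lambda>x y. y = a x \<or> y = b x) ws" "a ` S \<subseteq> S" "b ` S \<subseteq> S" "hd ws \<in> S"
  shows "set ws \<subseteq> S"
  using assms by (induction ws rule: induct_list012) auto

text \<open>One forward walk through all points is enough: if \<open>S\<close> misses its first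
  point, then the complement of \<open>S\<close>, which is closed as well, contains the whole
  walk.\<close>

lemma transitive_pair_walk:
  assumes a: "a permutes {..<n}" and b: "b permutes {..<n}"
    and ws: "successively (\<lambda>x y. y = a x \<or> y = b x) ws" "set ws = {..<n::nat}"
  shows "transitive_pair {..<n} a b"
  unfolding transitive_pair_def
proof (intro allI impI)
  fix S assume S: "S \<subseteq> {..<n}" "S \<noteq> {}" "a ` S \<subseteq> S" "b ` S \<subseteq> S"
  have closed: "f ` ({..<n} - S) \<subseteq> {..<n} - S" if f: "f permutes {..<n}" "f ` S \<subseteq> S" for f
  proof -
    have "f ` S = S" using endo_inj_surj[OF finite_subset[OF S(1) finite_lessThan] f(2)] permutes_inj_on[OF f(1)] by blast
    then show ?thesis using permutes_image[OF f(1)] image_set_diff[OF permutes_inj[OF f(1)], of "{..<n}" S] by simp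
  qed
  show "S = {..<n}"
  proof (cases "hd ws \<in> S")
    case True
    then show ?thesis using successively_closed[OF ws(1) S(3,4)] ws(2) S(1) by blast
  next
    case False
    have "ws \<noteq> []" using S(1,2) ws(2) by auto
    then have "hd ws \<in> {..<n} - S" using False ws(2) hd_in_set by blast
    then have "{..<n} \<subseteq> {..<n} - S"
      using successively_closed[OF ws(1) closed[OF a S(3)] closed[OF b S(4)]] ws(2) by blast
    then show ?thesis using S(1,2) by blast
  qed
qed

text \<open>The conditions are stated with executable list functions, so that every instance is
  decided by evaluation.\<close>

lemma triangles_list_perm:
  fixes ys zs xs ws :: "nat list" and x y z n :: nat
  defines "a \<equiv> list_perm ys" and "b \<equiv> list_perm zs"
  assumes len: "length ys = n" "length zs = n"
    and perm: "distinct ys \<and> distinct zs \<and> list_all (\<lambda>v. v < n) ys \<and> list_all (\<lambda>v. v < n) zs"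
    and ord: "list_all (\<lambda>v. a (a (a v)) = v \<and> b (b (b v)) = v) [0..<n] \<and> list_ex (\<lambda>v. a v \<noteq> v) [0..<n] \<and> list_ex (\<lambda>v. b v \<noteq> v) [0..<n]"
    and walk: "successively (\<lambda>v w. w = a v \<or> w = b v) ws \<and> list_all (\<lambda>v. v < n) ws \<and> list_all (\<lambda>v. v \<in> set ws) [0..<n]"
    and xyz: "distinct [x, y, z] \<and> x < n \<and> y < n \<and> z < n \<and> a (b x) = y \<and> a (b y) = z \<and> a (b z) = x
      \<and> list_ex (\<lambda>v. a v \<in> set [x, y, z]) [x, y, z]"
    and xs: "xs \<noteq> [] \<and> distinct xs \<and> list_all (\<lambda>v. v < n \<and> v \<notin> set [x, y, z]) xs
      \<and> map (\<lambda>v. a (b v)) xs = rotate1 xs \<and> (a (hd xs) = hd xs \<or> b (last xs) = last xs)"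
    and inv: "list_all (\<lambda>v. v \<in> set [x, y, z] \<or> v \<in> set xs \<or> a (b (a (b v))) = v) [0..<n]"
  shows "triangles n a b x y z xs"
proof -
  have ap: "a permutes {..<n}" and bp: "b permutes {..<n}"
    unfolding a_def b_def using perm list_perm_permutes[of ys] list_perm_permutes[of zs] len by (auto simp: list_all_iff)
  have "\<exists>v. a v \<noteq> v" "\<exists>v. b v \<noteq> v"
    using ord by (auto simp: list_ex_iff)
  then have order: "has_order 3 a" "has_order 3 b"
    unfolding a_def b_def using list_perm_order_3[of ys] list_perm_order_3[of zs] ord len
    by (auto simp: list_all_iff a_def b_def)
  have tr: "transitive_pair {..<n} a b"
    using walk by (intro transitive_pair_walk[OF ap bp, of ws]) (auto simp: list_all_iff)
  have "(a \<circ> b) ((a \<circ> b) w) = w" if "w \<notin> {x, y, z}" "w \<notin> set xs" for w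
  proof (cases "w < n")
    case True
    then show ?thesis using inv that by (auto simp: list_all_iff)
  next
    case False
    then show ?thesis using permutes_not_in[OF ap, of w] permutes_not_in[OF bp, of w] by simp
  qed
  then show ?thesis
    unfolding triangles_def using ap bp order tr xyz xs by (auto simp: list_all_iff comp_def)
qed

text \<open>The four starting tables differ in the parity of the degree and in the difference of
  list length and degree modulo 3. That difference survives each step, so every residue of
  \<open>n\<close> needs a table for which the final length is prime to 3.\<close>

lemma triangles_7_short: "\<exists>a b. triangles 7 a b 2 4 6 [0, 5]"
  by (intro exI, rule triangles_list_perm[where ys = "[0, 3, 6, 4, 1, 2, 5]" and zs = "[6, 1, 3, 4, 2, 0, 5]"
        and ws = "[0, 6, 5, 2, 3, 4, 1]"]) code_simp+

lemma triangles_7_long: "\<exists>a b. triangles 7 a b 0 4 2 [6, 5, 1]"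
  by (intro exI, rule triangles_list_perm[where ys = "[4, 0, 5, 2, 1, 3, 6]" and zs = "[0, 6, 1, 5, 3, 4, 2]"
        and ws = "[0, 4, 1, 6, 2, 5, 3]"]) code_simp+

lemma triangles_8: "\<exists>a b. triangles 8 a b 0 3 2 [7, 5, 1, 6, 4]"
  by (intro exI, rule triangles_list_perm[where ys = "[6, 2, 5, 3, 0, 1, 4, 7]" and zs = "[3, 0, 4, 1, 7, 5, 6, 2]"
        and ws = "[0, 6, 4, 7, 2, 5, 1, 0, 3]"]) code_simp+

lemma triangles_10: "\<exists>a b. triangles 10 a b 4 9 7 [6, 8, 1, 3, 0]"
  by (intro exI, rule triangles_list_perm[where ys = "[6, 2, 7, 8, 4, 0, 5, 1, 9, 3]" and zs = "[0, 9, 1, 5, 8, 6, 3, 4, 7, 2]"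
        and ws = "[0, 6, 5, 6, 3, 8, 9, 2, 7, 1, 2, 7, 4]"]) code_simp+

lemma order_3_degree_6: "\<exists>a b. generating_pair 3 {..<6::nat} a b"
proof -
  define ys zs where "ys = [5, 3, 1, 2, 0, 4::nat]" and "zs = [4, 1, 2, 0, 3, 5::nat]"
  have len: "length ys = 6" "length zs = 6" by (simp_all add: ys_def zs_def)
  have p: "list_perm ys permutes {..<6}" "list_perm zs permutes {..<6}"
    using list_perm_permutes[of ys, unfolded len] list_perm_permutes[of zs, unfolded len] by (simp_all add: ys_def zs_def)
  have "list_all (\<lambda>x. list_perm ys (list_perm ys (list_perm ys x)) = x) [0..<6]"
    "list_all (\<lambda>x. list_perm zs (list_perm zs (list_perm zs x)) = x) [0..<6]"
    "list_perm ys 0 \<noteq> 0" "list_perm zs 0 \<noteq> 0"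
    unfolding ys_def zs_def by code_simp+
  then have o: "has_order 3 (list_perm ys)" "has_order 3 (list_perm zs)"
    using list_perm_order_3[of ys 0] list_perm_order_3[of zs 0] len by (auto simp: list_all_iff)
  have "successively (\<lambda>v w. w = list_perm ys v \<or> w = list_perm zs v) [0, 5, 4, 3, 2, 1]"
    unfolding ys_def zs_def by code_simp
  moreover have "set [0, 5, 4, 3, 2, 1] = {..<6::nat}" by auto
  ultimately have tr: "transitive_pair {..<6} (list_perm ys) (list_perm zs)"
    by (rule transitive_pair_walk[OF p])
  \<comment> \<open>Here one generator is itself a 3-cycle.\<close>
  have "list_perm zs = cyc3 0 4 3"
  proof
    fix w :: nat
    have "w = 0 \<or> w = 1 \<or> w = 2 \<or> w = 3 \<or> w = 4 \<or> w = 5 \<or> 6 \<le> w" by linarith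
    then show "list_perm zs w = cyc3 0 4 3 w" by (auto simp: zs_def list_perm_def cyc3_def)
  qed
  then have "cyc3 0 4 3 \<in> perm_span {list_perm ys, list_perm zs}" by (metis insertCI perm_span.gen)
  then have "generating_pair 3 {..<6} (list_perm ys) (list_perm zs)"
    by (intro generating_pairI[OF finite_lessThan p o tr, of 0 4 3]) (auto simp: ys_def zs_def list_perm_def)
  then show ?thesis by blast
qed

lemma cycle_has_order: "distinct cs \<Longrightarrow> cs \<noteq> [] \<Longrightarrow> has_order (length cs) (cycle_of_list cs)"
proof (rule has_orderI)
  assume cs: "distinct cs" "cs \<noteq> []"
  show "cycle_of_list cs ^^ length cs = id" by (rule cycle_is_id_root[OF cs(1)])
  fix i assume "0 < i" "i < length cs"
  then show "(cycle_of_list cs ^^ i) (cs ! 0) \<noteq> cs ! 0"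
    using cycle_of_list_funpow_nth[OF cs(1), of 0 i] cs by (simp add: nth_eq_iff_index_eq)
qed

lemma cycle_pair_order:
  assumes "distinct (cs @ ds)" "cs \<noteq> []" "length cs = k" "k = length ds * m"
  shows "has_order k (cycle_of_list cs \<circ> cycle_of_list ds)"
proof (rule has_order_disjoint_comp[OF cycle_permutes cycle_permutes])
  show "cycle_of_list ds ^^ k = id"
    using cycle_is_id_root[of ds] assms(1,4) funpow_mult[where f = "cycle_of_list ds" and m = "length ds" and n = m]
    by (simp add: id_funpow)
  show "has_order k (cycle_of_list cs)" using cycle_has_order[of cs] assms by simp
qed (use assms in auto)

text \<open>This degree lies below the range of \<open>crossing_tail\<close>, and
  \<open>even_middle\<close> starts at \<open>k = 6\<close>. In the even pair
  \<open>a \<circ> (b \<circ> b)\<close> is a 3-cycle; replacing \<open>a\<close> by its odd factor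
  \<open>\<alpha>\<close> makes the square of \<open>\<alpha> \<circ> b\<close> one.\<close>

lemma order_4_degree_6:
  shows "\<exists>a b. generating_pair 4 {..<6::nat} a b \<and> evenperm a \<and> evenperm b"
    and "\<exists>a b. generating_pair 4 {..<6::nat} a b \<and> \<not> evenperm a"
proof -
  define \<alpha> \<beta> \<gamma> where "\<alpha> = cycle_of_list [2, 3, 4, 5::nat]" and "\<beta> = cycle_of_list [0, 1::nat]"
    and "\<gamma> = cycle_of_list [0, 3, 1, 4::nat]"
  define \<delta> where "\<delta> = cycle_of_list [2, 5::nat]"
  define a b where "a = \<alpha> \<circ> \<beta>" and "b = \<gamma> \<circ> \<delta>"
  note defs = a_def b_def \<alpha>_def \<beta>_def \<gamma>_def \<delta>_def
  have perm: "permutation \<alpha>" "permutation \<beta>" "permutation \<gamma>" "permutation \<delta>"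
    unfolding defs by (rule permutation_of_cycle)+
  have odd: "\<not> evenperm \<alpha>" "\<not> evenperm \<beta>" "\<not> evenperm \<gamma>" "\<not> evenperm \<delta>"
    using evenperm_cycle_of_list[of "[2, 3, 4, 5::nat]"] evenperm_cycle_of_list[of "[0, 1::nat]"]
      evenperm_cycle_of_list[of "[0, 3, 1, 4::nat]"] evenperm_cycle_of_list[of "[2, 5::nat]"]
    unfolding defs by (simp_all del: cycle_of_list.simps)
  have ev: "evenperm a" "evenperm b"
    unfolding a_def b_def using perm odd by (simp_all add: evenperm_comp)
  have bp: "b permutes {..<6}"
    unfolding b_def \<gamma>_def \<delta>_def
    by (rule permutes_compose[OF permutes_subset[OF cycle_permutes] permutes_subset[OF cycle_permutes]]) auto
  have ap: "a permutes {..<6}"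
    unfolding a_def \<alpha>_def \<beta>_def
    by (rule permutes_compose[OF permutes_subset[OF cycle_permutes] permutes_subset[OF cycle_permutes]]) auto
  have \<alpha>p: "\<alpha> permutes {..<6}"
    unfolding \<alpha>_def by (rule permutes_subset[OF cycle_permutes]) auto
  have orders: "has_order 4 a" "has_order 4 b" "has_order 4 \<alpha>"
    using cycle_pair_order[of "[2, 3, 4, 5::nat]" "[0, 1]" 4 2] cycle_pair_order[of "[0, 3, 1, 4::nat]" "[2, 5]" 4 2]
      cycle_has_order[of "[2, 3, 4, 5::nat]"]
    unfolding defs by (simp_all del: cycle_of_list.simps add: numeral_eq_Suc)
  have \<alpha>v: "\<alpha> 0 = 0" "\<alpha> 1 = 1" "\<alpha> 2 = 3" "\<alpha> 3 = 4" "\<alpha> 4 = 5" "\<alpha> 5 = 2"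
    and av: "a 0 = 1" "a 1 = 0" "a 2 = 3" "a 3 = 4" "a 4 = 5" "a 5 = 2"
    and bv: "b 0 = 3" "b 1 = 4" "b 2 = 5" "b 3 = 1" "b 4 = 0" "b 5 = 2"
    unfolding defs by (simp_all add: transpose_def)
  have less6: "x = 0 \<or> x = 1 \<or> x = 2 \<or> x = 3 \<or> x = 4 \<or> x = 5" if "x < 6" for x :: nat
    using that by presburger
  have tr: "transitive_pair {..<6} f b" if "f permutes {..<6}" "f 4 = 5" "f 5 = 2" for f
    by (rule transitive_pair_walk[OF that(1) bp, of "[0, 3, 1, 4, 5, 2]"]) (auto simp: that bv[simplified])
  have out: "f x = x" if "f permutes {..<6}" "6 \<le> x" for f and x :: nat
    using permutes_not_in[OF that(1), of x] that(2) by simp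
  show "\<exists>a b. generating_pair 4 {..<6::nat} a b \<and> evenperm a \<and> evenperm b"
  proof -
    have d: "distinct [2::nat, 3, 5]" by simp
    have "a \<circ> (b \<circ> b) = cyc3 2 3 5"
    proof (rule cyc3_eqI[OF d])
      fix w :: nat assume "w \<noteq> 2" "w \<noteq> 3" "w \<noteq> 5"
      then have "w = 0 \<or> w = 1 \<or> w = 4 \<or> 6 \<le> w" using less6[of w] by auto
      then show "(a \<circ> (b \<circ> b)) w = w" using av bv out[OF ap] out[OF bp] by auto
    qed (simp_all add: av[simplified] bv[simplified])
    moreover have "a \<circ> (b \<circ> b) \<in> perm_span {a, b}" by (intro perm_span.comp perm_span.gen) auto
    ultimately have cyc: "cyc3 2 3 5 \<in> perm_span {a, b}" by simp
    have "generating_pair 4 {..<6} a b"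
      by (rule generating_pairI[OF finite_lessThan ap bp orders(1,2) tr[OF ap av(5,6)] _ _ _ d cyc])
        (auto simp: av[simplified] bv[simplified])
    then show ?thesis using ev by blast
  qed
  show "\<exists>a b. generating_pair 4 {..<6::nat} a b \<and> \<not> evenperm a"
  proof -
    have d: "distinct [1::nat, 3, 5]" by simp
    have "(\<alpha> \<circ> b) \<circ> (\<alpha> \<circ> b) = cyc3 1 3 5"
    proof (rule cyc3_eqI[OF d])
      fix w :: nat assume "w \<noteq> 1" "w \<noteq> 3" "w \<noteq> 5"
      then have "w = 0 \<or> w = 2 \<or> w = 4 \<or> 6 \<le> w" using less6[of w] by auto
      then show "((\<alpha> \<circ> b) \<circ> (\<alpha> \<circ> b)) w = w" using \<alpha>v bv out[OF \<alpha>p] out[OF bp] by auto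
    qed (simp_all add: \<alpha>v[simplified] bv[simplified])
    moreover have "(\<alpha> \<circ> b) \<circ> (\<alpha> \<circ> b) \<in> perm_span {\<alpha>, b}" by (intro perm_span.comp perm_span.gen) auto
    ultimately have cyc: "cyc3 1 3 5 \<in> perm_span {\<alpha>, b}" by simp
    have "generating_pair 4 {..<6} \<alpha> b"
      by (rule generating_pairI[OF finite_lessThan \<alpha>p bp orders(3,2) tr[OF \<alpha>p \<alpha>v(5,6)] _ _ _ d cyc])
        (auto simp: \<alpha>v[simplified] bv[simplified])
    then show ?thesis using odd(1) by blast
  qed
qed

text \<open>For \<open>k = 6\<close> one has \<open>h = 3\<close> and \<open>e = 2\<close>, which
  violates \<open>e + 2 \<le> h\<close>. The same shape of pair, two 3-cycles crossing at
  \<open>2\<close>, is built by hand on seven points.\<close>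

lemma order_6_degree_7:
  "\<exists>a b. generating_pair 6 {..<7::nat} a b \<and> evenperm a \<and> evenperm b"
proof -
  define T U where "T = transpose 4 (6::nat)" and "U = transpose 0 (1::nat)"
  define a b where "a = mixed 0 3 [3, 5] T" and "b = mixed 2 3 [5, 6] U"
  have A: "2 * 3 = 2 * (3::nat)" "coprime 2 (3::nat)" "even (2::nat)" "0 < (3::nat)"
    "distinct [3, 5::nat]" "length [3, 5::nat] = 2" "set [3, 5] \<inter> {0..<0 + 3::nat} = {}"
    "T = id \<or> T = transpose 4 6" "{4, 6} \<inter> {0..<0 + 3::nat} = {}" "{4, 6} \<inter> set [3, 5::nat] = {}"
    by (auto simp: T_def)
  have B: "2 * 3 = 2 * (3::nat)" "coprime 2 (3::nat)" "even (2::nat)" "0 < (3::nat)"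
    "distinct [5, 6::nat]" "length [5, 6::nat] = 2" "set [5, 6] \<inter> {2..<2 + 3::nat} = {}"
    "U = id \<or> U = transpose 0 1" "{0, 1} \<inter> {2..<2 + 3::nat} = {}" "{0, 1} \<inter> set [5, 6::nat] = {}"
    by (auto simp: U_def)
  have ap: "a permutes {..<7}" unfolding a_def by (rule mixed_permutes[OF A]) auto
  have bp: "b permutes {..<7}" unfolding b_def by (rule mixed_permutes[OF B]) auto
  have ao: "has_order 6 a" using mixed_has_order[OF A] unfolding a_def by simp
  have bo: "has_order 6 b" using mixed_has_order[OF B] unfolding b_def by simp
  have a2: "a ^^ 2 = rot 0 3 ^^ 2" unfolding a_def by (rule mixed_pow[OF A])
  have b2: "b ^^ 2 = rot 2 3 ^^ 2" unfolding b_def by (rule mixed_pow[OF B])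
  have av: "a 0 = 1" "a 1 = 2" "a 2 = 0" "a 3 = 5" "a 4 = 6" "a 5 = 3" "a 6 = 4"
    and bv: "b 0 = 1" "b 1 = 0" "b 2 = 3" "b 3 = 4" "b 4 = 2" "b 5 = 6" "b 6 = 5"
    unfolding a_def b_def mixed_def T_def U_def by (simp_all add: transpose_def rot_apply)
  have ev: "evenperm a" "evenperm b"
  proof -
    have "permutation (rot 0 3)" "permutation (rot 2 3)"
      by (rule permutes_imp_permutation[OF _ rot_permutes]; simp)+
    moreover have "evenperm (rot 0 3)" "evenperm (rot 2 3)" by (simp_all add: evenperm_rot)
    moreover have "\<not> evenperm (cycle_of_list [3, 5::nat])" "\<not> evenperm (cycle_of_list [5, 6::nat])"
      using evenperm_cycle_of_list[of "[3, 5::nat]"] evenperm_cycle_of_list[of "[5, 6::nat]"]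
      by (simp_all del: cycle_of_list.simps)
    moreover have "\<not> evenperm T" "\<not> evenperm U" unfolding T_def U_def by (simp_all add: evenperm_swap)
    moreover have "permutation T" "permutation U" unfolding T_def U_def by (rule permutation_swap_id)+
    ultimately show "evenperm a" "evenperm b"
      unfolding a_def b_def mixed_def
      by (simp_all add: evenperm_comp permutation_compose permutation_of_cycle del: cycle_of_list.simps)
  qed
  have tr: "transitive_pair {..<7} a b"
    by (rule transitive_pair_walk[OF ap bp, of "[0, 1, 2, 3, 5, 3, 4, 6]"]) (auto simp: av[simplified] bv[simplified])
  have "generating_pair 6 {..<7} a b"
  proof (rule crossing_generating_pair[OF finite_lessThan ap bp ao bo tr,
        where e = 2 and w = 2 and v = 1 and u = 4 and A = "{0..<0 + 3}" and B = "{2..<2 + 3}"])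
    show "(a ^^ 2) x = x" if "x \<notin> {0..<0 + 3}" for x
      unfolding a2 by (rule permutes_not_in[OF permutes_funpow[OF rot_permutes] that])
    show "(b ^^ 2) x = x" if "x \<notin> {2..<2 + 3}" for x
      unfolding b2 by (rule permutes_not_in[OF permutes_funpow[OF rot_permutes] that])
    show "(a ^^ 2) 2 = 1"
      unfolding a2 using rot_funpow[of 2 3 2 0, simplified] by (simp add: numeral_2_eq_2)
    show "(b ^^ 2) 2 = 4"
      unfolding b2 using rot_funpow[of 0 3 2 2] by simp
    fix D assume D: "2 \<in> D" "1 \<in> D" "D \<subseteq> {..<7}"
      "\<And>g p. g \<in> perm_span {a, b} \<Longrightarrow> p \<in> D \<Longrightarrow> g p \<in> D \<Longrightarrow> g ` D \<subseteq> D"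
    have "a 1 \<in> D" "a 2 = 0" using D(1) av by auto
    then have "a ` D \<subseteq> D" using D(4)[of a 1] D(2) perm_span.gen[of a "{a, b}"] by simp
    then have "0 \<in> D" using D(1) av(3) by (metis image_subset_iff)
    then show "(\<exists>p\<in>D. a p \<in> D) \<and> (\<exists>p\<in>D. b p \<in> D)"
      using D(2) av bv by (intro conjI bexI[of _ 0]) auto
  qed auto
  then show ?thesis using ev by blast
qed

section \<open>Case distinctions on \<open>k\<close> and \<open>n\<close>\<close>

lemma order_3_generating_pair:
  assumes "4 \<le> n"
  shows "\<exists>a b. generating_pair 3 {..<n::nat} a b"
proof -
  have ext: "\<exists>a b. generating_pair 3 {..<n::nat} a b"
    if m: "\<exists>a b. triangles m a b x y z xs" "m \<le> n" "even (n - m)" "\<not> 3 dvd length xs + (n - m)" for m x y z xs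
  proof -
    obtain a b where "triangles m a b x y z xs" using m(1) by blast
    moreover obtain i where i: "n - m = 2 * i" using m(3) by blast
    ultimately obtain a b xs' where ab: "triangles (m + 2 * i) a b x y z xs'" "length xs' = length xs + 2 * i"
      using triangles_extend by blast
    have "m + 2 * i = n" using i m(2) by simp
    then show ?thesis using triangles_generating_pair[OF ab(1)] ab(2) m(4) i by auto
  qed
  \<comment> \<open>Each extension adds two points, so the table is chosen by the parity of
    \<open>n\<close> and by its residue modulo 3. Degrees 4, 5 and 6 are handled directly.\<close>
  have "n = 4 \<or> n = 5 \<or> n = 6 \<or> 7 \<le> n \<and> odd n \<or> 8 \<le> n \<and> even n \<and> n mod 3 \<noteq> 0 \<or>
      10 \<le> n \<and> even n \<and> n mod 3 = 0"
    using assms by presburger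
  then consider "n = 4" | "n = 5" | "n = 6" | "7 \<le> n" "odd n" "n mod 3 \<noteq> 2" | "7 \<le> n" "odd n" "n mod 3 = 2"
    | "8 \<le> n" "even n" "n mod 3 \<noteq> 0" | "10 \<le> n" "even n" "n mod 3 = 0"
    by metis
  then show ?thesis
  proof cases
    case 1
    then show ?thesis using two_cycles_one_new[of 3] by auto
  next
    case 2
    then show ?thesis using two_cycles_crossing[of 3] by auto
  next
    case 3
    then show ?thesis using order_3_degree_6 by simp
  next
    case 4
    have "\<not> 3 dvd length [0, 5::nat] + (n - 7)" using 4 by (simp) presburger
    then show ?thesis using ext[OF triangles_7_short] 4 by simp
  next
    case 5
    have "\<not> 3 dvd length [6, 5, 1::nat] + (n - 7)" using 5 by (simp) presburger
    then show ?thesis using ext[OF triangles_7_long] 5 by simp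
  next
    case 6
    have "\<not> 3 dvd length [7, 5, 1, 6, 4::nat] + (n - 8)" using 6 by (simp) presburger
    then show ?thesis using ext[OF triangles_8] 6 by simp
  next
    case 7
    have "\<not> 3 dvd length [6, 8, 1, 3, 0::nat] + (n - 10)" using 7 by (simp) presburger
    then show ?thesis using ext[OF triangles_10] 7 by simp
  qed
qed

text \<open>Write \<open>n = k + r + q * k\<close> with \<open>r < k\<close>: a base on
  \<open>k + r\<close> points is followed by \<open>q\<close> links. For \<open>r \<ge> 3\<close>
  and \<open>q > 0\<close> the base already contains one link, so one fewer is added.\<close>

lemma odd_generating_pair:
  assumes k: "odd k" "3 \<le> k" "k \<le> n" and n: "n \<noteq> 3"
  shows "\<exists>a b. generating_pair k {..<n::nat} a b"
proof (cases "k = 3")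
  case True
  then show ?thesis using order_3_generating_pair[of n] k n by simp
next
  case False
  then have k5: "5 \<le> k" using k by presburger
  then have k4: "4 \<le> k" by simp
  define q r where "q = n div k - 1" and "r = n mod k"
  have "1 \<le> n div k" using k div_greater_zero_iff[of n k] by simp
  then have n_eq: "n = k + r + q * k"
    using div_mult_mod_eq[of n k] unfolding q_def r_def by (simp add: diff_mult_distrib)
  have r: "r < k" using k unfolding r_def by simp
  consider "r = 0" | "r = 1" | "r = 2" | "q = 0" "3 \<le> r" "r + 2 \<le> k" | "q = 0" "r = k - 1" | "0 < q" "3 \<le> r"
    using r by linarith
  then show ?thesis
  proof cases
    case 1
    then show ?thesis using two_cycles_same_support[OF k4] chainable_extend[OF k4, of k _ _ 2 q] k5 n_eq by auto
  next
    case 2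
    then show ?thesis
      using two_cycles_one_new[of k] chainable_extend[OF k4, of "k + 1" _ _ 1 q] k4 n_eq by auto
  next
    case 3
    then show ?thesis using two_cycles_two_new[OF k5] chainable_extend[OF k4, of "k + 2" _ _ 3 q] n_eq by auto
  next
    case 4
    then show ?thesis using two_cycles_middle[of r k] n_eq by simp
  next
    case 5
    then have "n = 2 * k - 1" using n_eq r by simp
    then show ?thesis using two_cycles_crossing[of k] k by simp
  next
    case 6
    then obtain q' where "q = Suc q'" using gr0_conv_Suc by blast
    then have "n = k + r + k + q' * k" using n_eq by simp
    then show ?thesis using chainable_many_new[of r k] chainable_extend[OF k4] 6 r by metis
  qed
qed

lemma d_gen_alt_group_odd:
  assumes "odd k" "3 \<le> k" "k \<le> n" "n \<noteq> 3"
  shows "d_gen k (alt_group n) = 2"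
proof -
  obtain c d where "generating_pair k {..<n} c d" using odd_generating_pair[OF assms] by blast
  then obtain a b where ab: "generating_pair k {1..n} a b"
    using generating_pair_transport[of k "{..<n}" c d "{1..n}"] by auto
  have "evenperm f" if "f permutes {1..n}" "has_order k f" for f
    using odd_order_evenperm[of f k] permutes_imp_permutation[OF _ that(1)] that(2) assms(1)
    unfolding has_order_def by blast
  then have "evenperm a" "evenperm b" using ab unfolding generating_pair_def by blast+
  then show ?thesis using d_gen_alt_group[of n k a b] ab assms by simp
qed

text \<open>\<open>p = True\<close> gives two even generators for A_n, and \<open>p = False\<close>
  gives an odd first generator, which is what S_n requires.\<close>

lemma even_generating_pair:
  assumes k: "even k" "4 \<le> k" "k + 2 \<le> n"
  shows "\<exists>a b. generating_pair k {1..n} a b \<and> evenperm a = p \<and> (p \<longrightarrow> evenperm b)"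
proof -
  have move: "\<exists>a b. generating_pair k {1..n} a b \<and> evenperm a = p \<and> (p \<longrightarrow> evenperm b)"
    if "generating_pair k \<Omega> c d" "evenperm c = p" "p \<longrightarrow> evenperm d" "finite \<Omega>" "card \<Omega> = n" for c d and \<Omega> :: "nat set"
    using generating_pair_transport[of k \<Omega> c d "{1..n}"] that by auto
  have "2 * k - 1 \<le> n \<or> k = 4 \<and> n = 6 \<or> 6 \<le> k \<and> n + 2 \<le> 2 * k" using k by presburger
  then consider "2 * k - 1 \<le> n" | "k = 4" "n = 6" | "6 \<le> k" "n + 2 \<le> 2 * k" by metis
  then show ?thesis
  proof cases
    case 1
    then show ?thesis using crossing_tail[OF k(2,1) 1, of p p] move[of "{..<n}"] by auto
  next
    case 2
    show ?thesis
    proof (cases p)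
      case True
      then show ?thesis using order_4_degree_6(1) 2 move[of "{..<n}"] by fastforce
    next
      case False
      then show ?thesis using order_4_degree_6(2) 2 move[of "{..<n}"] by fastforce
    qed
  next
    case 3
    then have "2 \<le> n - k" "n - k + 2 \<le> k" using k by simp_all
    from even_middle[OF k(1) 3(1) this, of p p]
    obtain \<Omega> :: "nat set" and a b where "finite \<Omega>" "card \<Omega> = k + (n - k)" "generating_pair k \<Omega> a b"
      "evenperm a = p" "evenperm b = p"
      by blast
    then show ?thesis using move[of \<Omega> a b] k by simp
  qed
qed

lemma d_gen_sym_group_even:
  assumes k: "even k" "4 \<le> k" "k \<le> n"
  shows "d_gen k (sym_group n) = 2"
proof -
  \<comment> \<open>On \<open>k\<close> or \<open>k + 1\<close> points the first generator is a
    single \<open>k\<close>-cycle, which is odd for even \<open>k\<close>.\<close>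
  have short: "\<exists>a b. generating_pair k {1..n} a b \<and> \<not> evenperm a" if "generating_pair k {..<n} (rot 0 k) b" for b
    using generating_pair_transport[OF that, of "{1..n}"] evenperm_rot[of k 0] k by auto
  consider "n = k" | "n = k + 1" | "k + 2 \<le> n" using k by linarith
  then have "\<exists>a b. generating_pair k {1..n} a b \<and> \<not> evenperm a"
  proof cases
    case 1
    then show ?thesis using two_cycles_same_support[OF k(2)] short by auto
  next
    case 2
    then show ?thesis using two_cycles_one_new[of k] short k by auto
  next
    case 3
    then show ?thesis using even_generating_pair[OF k(1,2), of n False] by auto
  qed
  then show ?thesis using d_gen_sym_group[of n k] k by auto
qed

lemma even_generating_pair_short:
  assumes k: "even k" "3 \<le> k" "\<nexists>j. k = 2 ^ j" and n: "n = k \<or> n = k + 1" "\<not> (n = 6 \<and> k = 6)"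
  shows "\<exists>a b. generating_pair k {..<n} a b \<and> evenperm a \<and> evenperm b"
proof (cases "k = 6")
  case True
  then show ?thesis using order_6_degree_7 n by auto
next
  case False
  define \<alpha> where "\<alpha> = multiplicity 2 k"
  obtain m where m: "k = 2 ^ \<alpha> * m" "odd m"
    unfolding \<alpha>_def by (rule multiplicity_decompose'[of k "2::nat"]) (use k(2) in auto)
  have "m \<noteq> 1" using m k(3) by auto
  then have m3: "3 \<le> m" using m(2) by presburger
  have "\<alpha> \<noteq> 0" using m k(1) by auto
  then obtain \<beta> where \<beta>: "\<alpha> = Suc \<beta>" using not0_implies_Suc by blast
  define h where "h = 2 ^ \<beta> * m"
  have kh: "k = 2 * h" using m(1) \<beta> by (simp add: h_def)
  \<comment> \<open>If \<open>4\<close> does not divide \<open>k\<close>, then \<open>h = m\<close>,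
    and \<open>k \<noteq> 6\<close> gives \<open>m \<ge> 5\<close>. Otherwise
    \<open>2 ^ \<beta> \<ge> 2\<close> and \<open>m \<ge> 3\<close> suffice.\<close>
  have "2 ^ \<alpha> + 2 \<le> h"
  proof (cases "\<beta> = 0")
    case True
    then have "m \<noteq> 3" using False m \<beta> by auto
    then show ?thesis using m3 m(2) True \<beta> unfolding h_def by simp
  next
    case False
    then have "(2::nat) \<le> 2 ^ \<beta>" using self_le_power[of "2::nat" \<beta>] by simp
    then have "2 * 2 ^ \<beta> + 2 \<le> 2 ^ \<beta> * (3::nat)" by simp
    also have "\<dots> \<le> h" unfolding h_def by (rule mult_le_mono2[OF m3])
    finally show ?thesis using \<beta> by simp
  qed
  moreover have "coprime (2 ^ \<alpha>) m" using m(2) by simp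
  ultimately show ?thesis
    using half_cycles_generating_pair[of "2 ^ \<alpha>" m h n True True] m \<beta> n(1) kh by auto
qed

lemma d_gen_alt_group_even:
  assumes k: "even k" "4 \<le> k" "k \<le> n"
    and "\<not> ((k \<in> {n - 1, n} \<and> (\<exists>j. k = 2 ^ j)) \<or> (n = 6 \<and> k = 6))"
  shows "d_gen k (alt_group n) = 2"
proof -
  have "\<exists>a b. generating_pair k {1..n} a b \<and> evenperm a \<and> evenperm b"
  proof (cases "k + 2 \<le> n")
    case True
    then show ?thesis using even_generating_pair[OF k(1,2) True, of True] by auto
  next
    case False
    then have n: "n = k \<or> n = k + 1" using k by linarith
    then have "k \<in> {n - 1, n}" by auto
    then have "\<nexists>j. k = 2 ^ j" "\<not> (n = 6 \<and> k = 6)" using assms(4) by blast+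
    then obtain c d where cd: "generating_pair k {..<n} c d" "evenperm c" "evenperm d"
      using even_generating_pair_short[of k n] k n by auto
    then show ?thesis using generating_pair_transport[OF cd(1), of "{1..n}"] by auto
  qed
  then show ?thesis using d_gen_alt_group[of n k] k by auto
qed

theorem theorem1p1:
  fixes n k :: nat
  assumes "3 \<le> k" and "k \<le> n"
  shows "(even k \<longrightarrow>
            d_gen k (sym_group n) = 2 \<and>
            (\<not> ((k \<in> {n - 1, n} \<and> (\<exists>j. k = 2 ^ j)) \<or> (n = 6 \<and> k = 6))
               \<longrightarrow> d_gen k (alt_group n) = 2))
       \<and> (odd k \<longrightarrow>
            (n \<noteq> 3 \<longrightarrow> d_gen k (alt_group n) = 2) \<and>
            (n = 3 \<longrightarrow> d_gen k (alt_group n) = 1))"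
proof (intro conjI impI)
  assume "even k"
  then have "4 \<le> k" using assms(1) by presburger
  then show "d_gen k (sym_group n) = 2" by (rule d_gen_sym_group_even[OF \<open>even k\<close> _ assms(2)])
  show "d_gen k (alt_group n) = 2" if "\<not> ((k \<in> {n - 1, n} \<and> (\<exists>j. k = 2 ^ j)) \<or> (n = 6 \<and> k = 6))"
    by (rule d_gen_alt_group_even[OF \<open>even k\<close> \<open>4 \<le> k\<close> assms(2) that])
next
  show "d_gen k (alt_group n) = 2" if "odd k" "n \<noteq> 3"
    by (rule d_gen_alt_group_odd[OF that(1) assms that(2)])
  show "d_gen k (alt_group n) = 1" if "n = 3"
    using d_gen_alt_group_3 that assms by simp
qed

end
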